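(* Assume $\rho_{\min}:=\min_{s\in\mathcal S}\rho(s)>0$. Run S-FedPG (with $\mathcal{T}$ the identity) with $H$ local steps, batches of $B$ trajectories of length $T$, and step size $\eta>0$, and assume that there is $\underline{\mu}\in(0,1)$ such that $\inf_{r\ge 0}\mu_{\mathrm s}(\theta^r)\ge\underline{\mu}$ almost surely. If $\eta H L_2\le 1/74$, then $$\begin{aligned}J^\star-\mathbb{E}[J(\theta^R)]\le{}&\frac{J^\star-J(\theta^0)}{1+R\,(J^\star-J(\theta^0))\,\eta H\underline{\mu}/4}+\Big(\frac{6\eta L_2\sigma_2^2}{M\underline{\mu}}\Big)^{1/2}+\Big(\frac{16\cdot12^3\eta^4L_3^2H(H-1)\sigma_4^4}{\underline{\mu}}\Big)^{1/2}\\&+\Big(\frac{2\zeta^2}{\underline{\mu}}\Big)^{1/2}+\Big(\frac{8\beta^2}{\underline{\mu}}\Big)^{1/2}+\frac{\zeta^2}{12L_2}+\frac{\eta\sigma_2^2}{4M}+\frac{\beta^2}{3L_2}+\frac{12^3\eta^4L_3^2H(H-1)\sigma_4^4}{L_2},\end{aligned}$$ where $$L_2=\frac{8}{(1-\gamma)^3},\quad L_3=\frac{480}{(1-\gamma)^4},\quad \zeta^2=\frac{56\,\varepsilon_{\mathsf P}^2}{(1-\gamma)^6}+\frac{36\,\varepsilon_{\mathsf r}^2}{(1-\gamma)^4},\quad \beta=\frac{2\gamma^T}{1-\gamma}\Big(T+\frac1{1-\gamma}\Big),$$ $$\sigma_2^2=\frac{12}{B(1-\gamma)^4},\qquad \s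igma_4^4=\frac{1120}{B^2(1-\gamma)^8}.$$
   Context: Setting. $M$ agents; agent $c\in[M]$ has a finite MDP $(\mathcal S,\mathcal A,\gamma,\mathsf P_c,\mathsf r_c,\rho)$ with common finite state space $\mathcal S$, finite action space $\mathcal A$, discount $\gamma\in(0,1)$ and initial distribution $\rho$, its own transition kernel $\mathsf P_c$, and its own reward $\mathsf r_c:\mathcal S\times\mathcal A\to[0,1]$. Heterogeneity: $\varepsilon_{\mathsf P}=\max_{s,a}\max_{c,c'}\|\mathsf P_c(\cdot|s,a)-\mathsf P_{c'}(\cdot|s,a)\|_1$ and $\varepsilon_{\mathsf r}=\max_{c,c'}\|\mathsf r_c-\mathsf r_{c'}\|_\infty$. Softmax policies: for $\theta\in\mathbb{R}^{\mathcal S\times\mathcal A}$, $\pi_\theta(a|s)=e^{\theta(s,a)}/\sum_{a'}e^{\theta(s,a')}$. Objective: $J_c(\theta)=\mathbb{E}[\sum_{t\ge0}\gamma^t\mathsf r_c(S^t,A^t)]$ with $S^0\sim\rho$, $A^t\sim\pi_\theta(\cdot|S^t)$, $S^{t+1}\sim\mathsf P_c(\cdot|S^t,A^t)$; $J=\frac1M\sum_cJ_c$; $J_c^\star=\sup_\theta J_c(\theta)$; $J^\star=\frac1M\sum_cJ_c^\star$. Occupancy: for a stationary policy $\pi$, $d_c^{\rho,\pi}(s)=(1-\gamma)\sum_{t\ge0}\gamma^t\,\mathbb{P}_c^\pi(S^t=s)$ where $S^0\sim\rho$ and the trajectory follows $\pi$ in agent $c$'s MDP. For each $c$ fix a deterministic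 optimal policy $\pi_c^\star$ of agent $c$'s MDP, choosing action $a_c^\star(s)$ in state $s$. Set $$\mu_{c,\mathrm s}(\theta)=\frac1{2|\mathcal S|}\min_s\pi_\theta(a_c^\star(s)|s)^2\Big(\max_s\frac{d_c^{\rho,\pi_c^\star}(s)}{d_c^{\rho,\pi_\theta}(s)}\Big)^{-2},\qquad \mu_{\mathrm s}(\theta)=\min_c\mu_{c,\mathrm s}(\theta).$$ Algorithm S-FedPG. Given a deterministic $\theta^0$, for $r=0,\dots,R-1$: each agent sets $\theta_c^{r,0}=\theta^r$; for $h=0,\dots,H-1$ it samples, with fresh randomness independent across agents, $B$ i.i.d. trajectories $z=(s_b^t,a_b^t)_{0\le t\le T-1,\,1\le b\le B}$ of length $T$ from its own MDP (initial distribution $\rho$) with policy $\pi_{\theta_c^{r,h}}$, and sets $\theta_c^{r,h+1}=\theta_c^{r,h}+\eta\,g_c^z(\theta_c^{r,h})$ where $$g_c^z(\theta)=\frac1B\sum_{b=1}^B\sum_{t=0}^{T-1}\gamma^t\Big(\sum_{\ell=0}^t\nabla_\theta\log\pi_\theta(a_b^\ell|s_b^\ell)\Big)\mathsf r_c(s_b^t,a_b^t).$$ Then $\theta^{r+1}=\frac1M\sum_{c=1}^M\theta_c^{r,H}$. *)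

theory Defs
  imports "HOL-Probability.Probability"
begin

section \<open>Markov chains with discrete kernels\<close>

definition chain_kernel :: "'x pmf \<Rightarrow> ('x \<Rightarrow> 'x pmf) \<Rightarrow> nat \<Rightarrow> (nat \<Rightarrow> 'x) \<Rightarrow> 'x measure" where
  "chain_kernel p K i \<omega> = measure_pmf (if i = 0 then p else K (\<omega> (i - 1)))"

lemma Ionescu_Tulcea_chain_kernel:
  "Ionescu_Tulcea (chain_kernel p K) (\<lambda>_. count_space UNIV)"
proof (rule Ionescu_Tulcea.intro)
  fix i
  show "chain_kernel p K i \<in> PiM {0..<i} (\<lambda>_. count_space UNIV) \<rightarrow>\<^sub>M subprob_algebra (count_space UNIV)"
  proof (cases i)
    case 0
    then show ?thesis
      by (simp add: chain_kernel_def[abs_def] measure_pmf_in_subprob_algebra)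
  next
    case (Suc n)
    have "(\<lambda>\<omega>. \<omega> n) \<in> PiM {0..<i} (\<lambda>_. count_space UNIV) \<rightarrow>\<^sub>M count_space UNIV"
      using Suc by (intro measurable_component_singleton) auto
    moreover have "(\<lambda>x. measure_pmf (K x)) \<in> count_space UNIV \<rightarrow>\<^sub>M subprob_algebra (count_space UNIV)"
      by (simp add: measure_pmf_in_subprob_algebra)
    ultimately have "(\<lambda>\<omega>. measure_pmf (K (\<omega> n))) \<in>
        PiM {0..<i} (\<lambda>_. count_space UNIV) \<rightarrow>\<^sub>M subprob_algebra (count_space UNIV)"
      by (rule measurable_compose)
    with Suc show ?thesis
      by (simp add: chain_kernel_def[abs_def])
  qed
next
  show "prob_space (chain_kernel p K i \<omega>)" for i \<omega>
    by (simp add: chain_kernel_def prob_space_measure_pmf)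
qed

text \<open>The law on infinite paths of the chain with initial distribution \<open>p\<close> and transition
  kernel \<open>K\<close>, obtained from the Ionescu-Tulcea theorem.\<close>

definition markov_chain :: "'x pmf \<Rightarrow> ('x \<Rightarrow> 'x pmf) \<Rightarrow> (nat \<Rightarrow> 'x) measure" where
  "markov_chain p K = projective_family.lim UNIV
     (Ionescu_Tulcea.CI (chain_kernel p K) (\<lambda>_. count_space UNIV)) (\<lambda>_. count_space UNIV)"

primrec chain_prefix :: "nat \<Rightarrow> 'x pmf \<Rightarrow> ('x \<Rightarrow> 'x pmf) \<Rightarrow> 'x list pmf" where
  "chain_prefix 0 p K = return_pmf []"
| "chain_prefix (Suc n) p K = bind_pmf p (\<lambda>x. map_pmf (Cons x) (chain_prefix n (K x) K))"

context
  fixes p :: "'x pmf" and K :: "'x \<Rightarrow> 'x pmf"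
begin

interpretation IT: Ionescu_Tulcea "chain_kernel p K" "\<lambda>_. count_space UNIV"
  by (rule Ionescu_Tulcea_chain_kernel)

lemma sets_markov_chain [measurable_cong]:
  "sets (markov_chain p K) = sets (PiM UNIV (\<lambda>_. count_space UNIV))"
  by (simp add: markov_chain_def)

lemma space_markov_chain [simp]: "space (markov_chain p K) = UNIV"
  by (simp add: markov_chain_def space_PiM)

lemma prob_space_markov_chain: "prob_space (markov_chain p K)"
proof -
  have "emeasure IT.PF.lim (IT.PF.emb UNIV {} {\<lambda>_. undefined}) = emeasure (IT.CI {}) {\<lambda>_. undefined}"
    by (rule IT.lim) (simp_all add: PiM_empty)
  also have "\<dots> = 1"
    using prob_space.emeasure_space_1[OF IT.PF.prob_space_P[of "{}"]]
    by (simp add: IT.PF.space_P space_PiM)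
  finally show ?thesis
    by (intro prob_spaceI) (simp add: markov_chain_def prod_emb_def space_PiM restrict_def vimage_def)
qed

lemma emeasure_markov_chain_prefix:
  "emeasure (markov_chain p K) {\<omega>. \<forall>i\<le>n. \<omega> i = x i} =
     ennreal (pmf p (x 0) * (\<Prod>i<n. pmf (K (x i)) (x (Suc i))))"
proof -
  define cyl where "cyl m = {restrict x {0..<m}}" for m
  have cyl_eq: "cyl m = PiE {0..<m} (\<lambda>i. {x i})" for m
    by (auto simp: cyl_def PiE_eq_singleton intro!: ext)
  have cyl_sets [measurable]: "cyl m \<in> sets (PiM {0..<m} (\<lambda>_. count_space UNIV))" for m
    unfolding cyl_eq by (intro sets_PiM_I_finite) auto
  have step: "emeasure (IT.C 0 (Suc m) (\<lambda>_. undefined)) (cyl (Suc m)) =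
      emeasure (chain_kernel p K m (restrict x {0..<m})) {x m} *
      emeasure (IT.C 0 m (\<lambda>_. undefined)) (cyl m)" for m
  proof -
    have u: "(\<lambda>_. undefined) \<in> space (PiM {0..<0::nat} (\<lambda>_. count_space (UNIV :: 'x set)))"
      by (simp add: space_PiM)
    have sC: "sets (IT.C 0 m (\<lambda>_. undefined)) = sets (PiM {0..<m} (\<lambda>_. count_space UNIV))"
      using IT.sets_C[OF u, of m] by simp
    have "emeasure (IT.C 0 (Suc m) (\<lambda>_. undefined)) (cyl (Suc m)) =
        (\<integral>\<^sup>+\<omega>. emeasure (IT.eP m \<omega>) (cyl (Suc m)) \<partial>IT.C 0 m (\<lambda>_. undefined))"
      using sC IT.measurable_eP[of m] cyl_sets[of "Suc m"]
      by (simp, subst emeasure_bind[where N = "PiM {0..<Suc m} (\<lambda>_. count_space UNIV)"])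
         (auto simp: IT.space_C measurable_cong_sets[OF sC refl])
    also have "\<dots> = (\<integral>\<^sup>+\<omega>. emeasure (chain_kernel p K m (restrict x {0..<m})) {x m} *
        indicator (cyl m) \<omega> \<partial>IT.C 0 m (\<lambda>_. undefined))"
    proof (intro nn_integral_cong)
      fix \<omega> assume "\<omega> \<in> space (IT.C 0 m (\<lambda>_. undefined))"
      then have \<omega>: "\<omega> \<in> space (PiM {0..<m} (\<lambda>_. count_space UNIV))"
        using sets_eq_imp_space_eq[OF sC] by simp
      then have ext: "\<omega> \<in> extensional {0..<m}"
        by (simp add: space_PiM PiE_def)
      have "(fun_upd \<omega> m y \<in> cyl (Suc m)) \<longleftrightarrow> \<omega> \<in> cyl m \<and> y = x m" for y
      proof -
        have "fun_upd \<omega> m y = restrict x {0..<Suc m} \<longleftrightarrow> \<omega> = restrict x {0..<m} \<and> y = x m"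
          using ext by (auto simp: fun_eq_iff extensional_def restrict_def less_Suc_eq)
        then show ?thesis by (simp add: cyl_def)
      qed
      then have "fun_upd \<omega> m -` cyl (Suc m) = (if \<omega> \<in> cyl m then {x m} else {})"
        by auto
      then show "emeasure (IT.eP m \<omega>) (cyl (Suc m)) =
          emeasure (chain_kernel p K m (restrict x {0..<m})) {x m} * indicator (cyl m) \<omega>"
        using \<omega> cyl_sets[of "Suc m"] by (cases "\<omega> \<in> cyl m") (simp_all add: IT.emeasure_eP, simp add: cyl_def)
    qed
    also have "\<dots> = emeasure (chain_kernel p K m (restrict x {0..<m})) {x m} *
        emeasure (IT.C 0 m (\<lambda>_. undefined)) (cyl m)"
      using sC cyl_sets[of m] by (simp add: nn_integral_cmult_indicator)
    finally show ?thesis .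
  qed
  have C: "emeasure (IT.C 0 (Suc m) (\<lambda>_. undefined)) (cyl (Suc m)) =
      ennreal (pmf p (x 0) * (\<Prod>i<m. pmf (K (x i)) (x (Suc i))))" for m
  proof (induction m)
    case 0
    have "emeasure (IT.C 0 0 (\<lambda>_. undefined)) (cyl 0) = 1"
      using cyl_sets[of 0] by (simp add: cyl_def restrict_def)
    then show ?case
      by (subst step) (simp add: chain_kernel_def emeasure_pmf_single)
  next
    case (Suc m)
    have "chain_kernel p K (Suc m) (restrict x {0..<Suc m}) = measure_pmf (K (x m))"
      by (simp add: chain_kernel_def)
    then show ?case
      unfolding step[of "Suc m"] Suc.IH
      by (simp add: emeasure_pmf_single ennreal_mult'[symmetric] prod_nonneg mult_ac)
  qed
  have "{\<omega>. \<forall>i\<le>n. \<omega> i = x i} = IT.PF.emb UNIV {0..<Suc n} (cyl (Suc n))"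
    by (simp add: prod_emb_def space_PiM cyl_def restrict_def fun_eq_iff less_Suc_eq_le set_eq_iff)
  then have "emeasure (markov_chain p K) {\<omega>. \<forall>i\<le>n. \<omega> i = x i} =
      emeasure (IT.CI {0..<Suc n}) (cyl (Suc n))"
    using IT.lim[of "{0..<Suc n}" "cyl (Suc n)"] cyl_sets[of "Suc n"]
    by (simp add: markov_chain_def)
  also have "\<dots> = emeasure (IT.C 0 (Suc n) (\<lambda>_. undefined)) (cyl (Suc n))"
    using IT.emeasure_CI[of "{0..<Suc n}" "Suc n" "cyl (Suc n)"] cyl_sets[of "Suc n"]
      sets.sets_into_space[OF cyl_sets[of "Suc n"]]
    by (simp add: prod_emb_id space_PiM del: IT.C.simps)
  finally show ?thesis
    by (simp only: C)
qed

end

lemma pmf_chain_prefix: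
  "pmf (chain_prefix (Suc n) p K) (map x [0..<Suc n]) =
     pmf p (x 0) * (\<Prod>i<n. pmf (K (x i)) (x (Suc i)))"
proof (induction n arbitrary: p x)
  case 0
  have "chain_prefix (Suc 0) p K = map_pmf (\<lambda>y. [y]) p"
    by (simp add: map_pmf_def bind_return_pmf)
  then show ?case
    using pmf_map_inj'[of "\<lambda>y. [y]" p "x 0"] by (simp add: inj_def del: chain_prefix.simps)
next
  case (Suc n)
  have *: "map x [0..<Suc (Suc n)] = x 0 # map (x \<circ> Suc) [0..<Suc n]"
    by (simp only: upt_conv_Cons[of 0 "Suc (Suc n)"] map_Suc_upt[symmetric] list.map map_map)
  have "pmf (chain_prefix (Suc (Suc n)) p K) (map x [0..<Suc (Suc n)]) =
      (\<integral>y. pmf (map_pmf (Cons y) (chain_prefix (Suc n) (K y) K)) (x 0 # map (x \<circ> Suc) [0..<Suc n]) \<partial>p)"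
    unfolding * by (simp only: chain_prefix.simps(2)[of "Suc n"] pmf_bind)
  also have "\<dots> = (\<integral>y. pmf (chain_prefix (Suc n) (K (x 0)) K) (map (x \<circ> Suc) [0..<Suc n]) * indicator {x 0} y \<partial>p)"
  proof (intro Bochner_Integration.integral_cong refl)
    fix y
    show "pmf (map_pmf (Cons y) (chain_prefix (Suc n) (K y) K)) (x 0 # map (x \<circ> Suc) [0..<Suc n]) =
        pmf (chain_prefix (Suc n) (K (x 0)) K) (map (x \<circ> Suc) [0..<Suc n]) * indicator {x 0} y"
    proof (cases "y = x 0")
      case True
      then show ?thesis
        using pmf_map_inj'[of "Cons y"] by (simp add: inj_def del: chain_prefix.simps upt_Suc)
    next
      case False
      then show ?thesis
        by (subst pmf_map_outside) auto
    qed
  qed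
  also have "\<dots> = pmf p (x 0) * pmf (chain_prefix (Suc n) (K (x 0)) K) (map (x \<circ> Suc) [0..<Suc n])"
    by (simp add: measure_pmf_single del: chain_prefix.simps upt_Suc)
  also have "\<dots> = pmf p (x 0) * (\<Prod>i<Suc n. pmf (K (x i)) (x (Suc i)))"
    by (simp only: Suc.IH prod.lessThan_Suc_shift) simp
  finally show ?case .
qed

theorem measure_markov_chain_prefix:
  "measure (markov_chain p K) {\<omega>. map \<omega> [0..<Suc n] = map x [0..<Suc n]} =
     pmf (chain_prefix (Suc n) p K) (map x [0..<Suc n])"
proof -
  have "{\<omega>. map \<omega> [0..<Suc n] = map x [0..<Suc n]} = {\<omega>. \<forall>i\<le>n. \<omega> i = x i}"
    by (auto simp: less_Suc_eq_le)
  then show ?thesis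
    unfolding measure_def
    by (simp add: emeasure_markov_chain_prefix pmf_chain_prefix prod_nonneg del: chain_prefix.simps upt_Suc)
qed


section \<open>Finite discounted Markov decision processes\<close>

text \<open>A stationary policy is a function from states to distributions over actions; the path of an
  MDP records the pairs \<open>(S\<^sup>t, A\<^sup>t)\<close>.\<close>

definition state_action :: "'s pmf \<Rightarrow> ('s \<Rightarrow> 'a pmf) \<Rightarrow> ('s \<times> 'a) pmf" where
  "state_action q \<pi> = bind_pmf q (\<lambda>s. map_pmf (Pair s) (\<pi> s))"

definition mdp_process ::
    "('s \<Rightarrow> 'a \<Rightarrow> 's pmf) \<Rightarrow> 's pmf \<Rightarrow> ('s \<Rightarrow> 'a pmf) \<Rightarrow> (nat \<Rightarrow> 's \<times> 'a) measure" where
  "mdp_process P \<rho> \<pi> = markov_chain (state_action \<rho> \<pi>) (\<lambda>(s, a). state_action (P s a) \<pi>)"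

definition mdp_trajectory ::
    "nat \<Rightarrow> ('s \<Rightarrow> 'a \<Rightarrow> 's pmf) \<Rightarrow> 's pmf \<Rightarrow> ('s \<Rightarrow> 'a pmf) \<Rightarrow> ('s \<times> 'a) list pmf" where
  "mdp_trajectory T P \<rho> \<pi> = chain_prefix T (state_action \<rho> \<pi>) (\<lambda>(s, a). state_action (P s a) \<pi>)"

definition expected_return ::
    "real \<Rightarrow> ('s \<Rightarrow> 'a \<Rightarrow> 's pmf) \<Rightarrow> ('s \<Rightarrow> 'a \<Rightarrow> real) \<Rightarrow> 's pmf \<Rightarrow> ('s \<Rightarrow> 'a pmf) \<Rightarrow> real" where
  "expected_return \<gamma> P r \<rho> \<pi> =
     (\<integral>\<omega>. (\<Sum>t. \<gamma> ^ t * r (fst (\<omega> t)) (snd (\<omega> t))) \<partial>mdp_process P \<rho> \<pi>)"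

definition occupancy ::
    "real \<Rightarrow> ('s \<Rightarrow> 'a \<Rightarrow> 's pmf) \<Rightarrow> 's pmf \<Rightarrow> ('s \<Rightarrow> 'a pmf) \<Rightarrow> 's \<Rightarrow> real" where
  "occupancy \<gamma> P \<rho> \<pi> s =
     (1 - \<gamma>) * (\<Sum>t. \<gamma> ^ t * \<P>(\<omega> in mdp_process P \<rho> \<pi>. fst (\<omega> t) = s))"

definition det_policy :: "('s \<Rightarrow> 'a) \<Rightarrow> 's \<Rightarrow> 'a pmf" where
  "det_policy f s = return_pmf (f s)"

text \<open>Optimality means attaining the largest value from every initial state.\<close>

definition optimal_policy ::
    "real \<Rightarrow> ('s \<Rightarrow> 'a \<Rightarrow> 's pmf) \<Rightarrow> ('s \<Rightarrow> 'a \<Rightarrow> real) \<Rightarrow> ('s \<Rightarrow> 'a pmf) \<Rightarrow> bool" where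
  "optimal_policy \<gamma> P r \<pi> \<longleftrightarrow>
     (\<forall>\<pi>' s. expected_return \<gamma> P r (return_pmf s) \<pi>' \<le> expected_return \<gamma> P r (return_pmf s) \<pi>)"


section \<open>Softmax policies and the policy gradient estimator\<close>

type_synonym ('s, 'a) param = "real ^ ('s \<times> 'a)"

definition softmax :: "('s::finite, 'a::finite) param \<Rightarrow> 's \<Rightarrow> 'a pmf" where
  "softmax \<theta> s = embed_pmf (\<lambda>a. exp (\<theta> $ (s, a)) / (\<Sum>a'\<in>UNIV. exp (\<theta> $ (s, a'))))"

lemma pmf_softmax:
  "pmf (softmax \<theta> s) a = exp (\<theta> $ (s, a)) / (\<Sum>a'\<in>UNIV. exp (\<theta> $ (s, a')))"
proof -
  have pos: "(\<Sum>a'\<in>UNIV. exp (\<theta> $ (s, a'))) > 0"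
    by (intro sum_pos) auto
  show ?thesis
    unfolding softmax_def
  proof (rule pmf_embed_pmf)
    show "0 \<le> exp (\<theta> $ (s, a)) / (\<Sum>a'\<in>UNIV. exp (\<theta> $ (s, a')))" for a
      using pos by simp
    show "(\<integral>\<^sup>+a. ennreal (exp (\<theta> $ (s, a)) / (\<Sum>a'\<in>UNIV. exp (\<theta> $ (s, a')))) \<partial>count_space UNIV) = 1"
      using pos
      by (simp add: nn_integral_count_space_finite sum_ennreal sum_divide_distrib[symmetric])
  qed
qed

definition gradient :: "('v::real_inner \<Rightarrow> real) \<Rightarrow> 'v \<Rightarrow> 'v" where
  "gradient f x = (THE D. GDERIV f x :> D)"

lemma gradient_eqI:
  assumes "GDERIV f x :> D"
  shows "gradient f x = D"
  unfolding gradient_def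
proof (rule the_equality)
  fix D' assume "GDERIV f x :> D'"
  with assms have "(\<lambda>h. inner h D') = (\<lambda>h. inner h D)"
    unfolding gderiv_def by (blast intro: has_derivative_unique)
  then have "inner (D' - D) (D' - D) = 0"
    by (simp add: inner_diff_right fun_eq_iff)
  then show "D' = D"
    by simp
qed (fact assms)

definition score :: "('s::finite, 'a::finite) param \<Rightarrow> 's \<times> 'a \<Rightarrow> ('s, 'a) param" where
  "score \<theta> = (\<lambda>(s, a). gradient (\<lambda>\<theta>'. ln (pmf (softmax \<theta>' s) a)) \<theta>)"

text \<open>In \<open>pg_estimator\<close>, \<open>z ! b ! t\<close> is the \<open>t\<close>-th state-action pair of the \<open>b\<close>-th trajectory.\<close>

definition pg_estimator ::
    "real \<Rightarrow> ('s::finite \<Rightarrow> 'a::finite \<Rightarrow> real) \<Rightarrow> nat \<Rightarrow> nat \<Rightarrow> ('s \<times> 'a) list list \<Rightarrow>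
     ('s, 'a) param \<Rightarrow> ('s, 'a) param" where
  "pg_estimator \<gamma> r B T z \<theta> =
     (1 / real B) *\<^sub>R (\<Sum>b<B. \<Sum>t<T.
        (\<gamma> ^ t * r (fst (z ! b ! t)) (snd (z ! b ! t))) *\<^sub>R (\<Sum>l\<le>t. score \<theta> (z ! b ! l)))"


section \<open>Federated objective and the S-FedPG algorithm\<close>

text \<open>The finite type \<open>'c\<close> indexes the agents; agent \<open>c\<close> has kernel \<open>P c\<close> and reward \<open>r c\<close>.\<close>

definition kernel_heterogeneity ::
    "('c::finite \<Rightarrow> 's::finite \<Rightarrow> 'a::finite \<Rightarrow> 's pmf) \<Rightarrow> real" where
  "kernel_heterogeneity P =
     Max (range (\<lambda>(s, a, c, c'). \<Sum>s'\<in>UNIV. \<bar>pmf (P c s a) s' - pmf (P c' s a) s'\<bar>))"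

definition reward_heterogeneity ::
    "('c::finite \<Rightarrow> 's::finite \<Rightarrow> 'a::finite \<Rightarrow> real) \<Rightarrow> real" where
  "reward_heterogeneity r = Max (range (\<lambda>(c, c', s, a). \<bar>r c s a - r c' s a\<bar>))"

definition local_objective ::
    "real \<Rightarrow> ('s::finite \<Rightarrow> 'a::finite \<Rightarrow> 's pmf) \<Rightarrow> ('s \<Rightarrow> 'a \<Rightarrow> real) \<Rightarrow> 's pmf \<Rightarrow>
     ('s, 'a) param \<Rightarrow> real" where
  "local_objective \<gamma> P r \<rho> \<theta> = expected_return \<gamma> P r \<rho> (softmax \<theta>)"

definition local_optimum ::
    "real \<Rightarrow> ('s::finite \<Rightarrow> 'a::finite \<Rightarrow> 's pmf) \<Rightarrow> ('s \<Rightarrow> 'a \<Rightarrow> real) \<Rightarrow> 's pmf \<Rightarrow> real" where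
  "local_optimum \<gamma> P r \<rho> = (SUP \<theta>. local_objective \<gamma> P r \<rho> \<theta>)"

definition fed_objective ::
    "real \<Rightarrow> ('c::finite \<Rightarrow> 's::finite \<Rightarrow> 'a::finite \<Rightarrow> 's pmf) \<Rightarrow> ('c \<Rightarrow> 's \<Rightarrow> 'a \<Rightarrow> real) \<Rightarrow> 's pmf \<Rightarrow>
     ('s, 'a) param \<Rightarrow> real" where
  "fed_objective \<gamma> P r \<rho> \<theta> =
     1 / real CARD('c) * (\<Sum>c\<in>UNIV. local_objective \<gamma> (P c) (r c) \<rho> \<theta>)"

definition fed_optimum ::
    "real \<Rightarrow> ('c::finite \<Rightarrow> 's::finite \<Rightarrow> 'a::finite \<Rightarrow> 's pmf) \<Rightarrow> ('c \<Rightarrow> 's \<Rightarrow> 'a \<Rightarrow> real) \<Rightarrow> 's pmf \<Rightarrow> real" where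
  "fed_optimum \<gamma> P r \<rho> = 1 / real CARD('c) * (\<Sum>c\<in>UNIV. local_optimum \<gamma> (P c) (r c) \<rho>)"

definition local_mu ::
    "real \<Rightarrow> ('s::finite \<Rightarrow> 'a::finite \<Rightarrow> 's pmf) \<Rightarrow> 's pmf \<Rightarrow> ('s \<Rightarrow> 'a) \<Rightarrow> ('s, 'a) param \<Rightarrow> real" where
  "local_mu \<gamma> P \<rho> a\<^sub>o\<^sub>p\<^sub>t \<theta> =
     1 / (2 * real CARD('s)) * Min (range (\<lambda>s. (pmf (softmax \<theta> s) (a\<^sub>o\<^sub>p\<^sub>t s))\<^sup>2)) *
     (Max (range (\<lambda>s. occupancy \<gamma> P \<rho> (det_policy a\<^sub>o\<^sub>p\<^sub>t) s / occupancy \<gamma> P \<rho> (softmax \<theta>) s))) powi (-2)"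

definition fed_mu ::
    "real \<Rightarrow> ('c::finite \<Rightarrow> 's::finite \<Rightarrow> 'a::finite \<Rightarrow> 's pmf) \<Rightarrow> 's pmf \<Rightarrow> ('c \<Rightarrow> 's \<Rightarrow> 'a) \<Rightarrow>
     ('s, 'a) param \<Rightarrow> real" where
  "fed_mu \<gamma> P \<rho> a\<^sub>o\<^sub>p\<^sub>t \<theta> = Min (range (\<lambda>c. local_mu \<gamma> (P c) \<rho> (a\<^sub>o\<^sub>p\<^sub>t c) \<theta>))"

definition local_step ::
    "real \<Rightarrow> ('s::finite \<Rightarrow> 'a::finite \<Rightarrow> 's pmf) \<Rightarrow> ('s \<Rightarrow> 'a \<Rightarrow> real) \<Rightarrow> 's pmf \<Rightarrow>
     real \<Rightarrow> nat \<Rightarrow> nat \<Rightarrow> ('s, 'a) param \<Rightarrow> ('s, 'a) param pmf" where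
  "local_step \<gamma> P r \<rho> \<eta> B T \<theta> =
     map_pmf (\<lambda>z. \<theta> + \<eta> *\<^sub>R pg_estimator \<gamma> r B T z \<theta>)
       (replicate_pmf B (mdp_trajectory T P \<rho> (softmax \<theta>)))"

primrec local_iterate ::
    "real \<Rightarrow> ('s::finite \<Rightarrow> 'a::finite \<Rightarrow> 's pmf) \<Rightarrow> ('s \<Rightarrow> 'a \<Rightarrow> real) \<Rightarrow> 's pmf \<Rightarrow>
     real \<Rightarrow> nat \<Rightarrow> nat \<Rightarrow> nat \<Rightarrow> ('s, 'a) param \<Rightarrow> ('s, 'a) param pmf" where
  "local_iterate \<gamma> P r \<rho> \<eta> B T 0 \<theta> = return_pmf \<theta>"
| "local_iterate \<gamma> P r \<rho> \<eta> B T (Suc h) \<theta> =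
     bind_pmf (local_iterate \<gamma> P r \<rho> \<eta> B T h \<theta>) (local_step \<gamma> P r \<rho> \<eta> B T)"

text \<open>Independence across agents is the product \<open>Pi_pmf\<close>; its default value is irrelevant since
  the index set is \<open>UNIV\<close>.\<close>

definition fedpg_round ::
    "real \<Rightarrow> ('c::finite \<Rightarrow> 's::finite \<Rightarrow> 'a::finite \<Rightarrow> 's pmf) \<Rightarrow> ('c \<Rightarrow> 's \<Rightarrow> 'a \<Rightarrow> real) \<Rightarrow> 's pmf \<Rightarrow>
     real \<Rightarrow> nat \<Rightarrow> nat \<Rightarrow> nat \<Rightarrow> ('s, 'a) param \<Rightarrow> ('s, 'a) param pmf" where
  "fedpg_round \<gamma> P r \<rho> \<eta> H B T \<theta> =
     map_pmf (\<lambda>\<theta>'. (1 / real CARD('c)) *\<^sub>R (\<Sum>c\<in>UNIV. \<theta>' c))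
       (Pi_pmf UNIV undefined (\<lambda>c. local_iterate \<gamma> (P c) (r c) \<rho> \<eta> B T H \<theta>))"

text \<open>The joint law of the global iterates \<open>\<theta>\<^sup>0, \<theta>\<^sup>1, \<dots>\<close>.\<close>

definition fedpg ::
    "real \<Rightarrow> ('c::finite \<Rightarrow> 's::finite \<Rightarrow> 'a::finite \<Rightarrow> 's pmf) \<Rightarrow> ('c \<Rightarrow> 's \<Rightarrow> 'a \<Rightarrow> real) \<Rightarrow> 's pmf \<Rightarrow>
     real \<Rightarrow> nat \<Rightarrow> nat \<Rightarrow> nat \<Rightarrow> ('s, 'a) param \<Rightarrow> (nat \<Rightarrow> ('s, 'a) param) measure" where
  "fedpg \<gamma> P r \<rho> \<eta> H B T \<theta>\<^sub>0 = markov_chain (return_pmf \<theta>\<^sub>0) (fedpg_round \<gamma> P r \<rho> \<eta> H B T)"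

end

theory Submission
  imports Defs
begin

text \<open>
  Write \<open>n = t + 1\<close>. The stage-\<open>t\<close> expected reward is a finite sum over trajectories of length
  \<open>n\<close>, and by the likelihood-ratio identity each derivative in \<open>\<theta>\<close> costs one factor of order \<open>n\<close>
  (a score vector has norm at most 2). Summing \<open>\<gamma>\<^sup>t n\<^sup>k\<close> yields the smoothness constant
  \<open>12 / (1 - \<gamma>)\<^sup>3\<close> of the objective, a bound of order \<open>(1 - \<gamma>)\<^sup>-\<^sup>4\<close> on the second derivative of
  the truncated gradient, the truncation bias \<open>\<beta>\<close>, the almost sure bound \<open>2 / (1 - \<gamma>)\<^sup>2\<close> on a
  trajectory gradient, and the distance between the gradients of two agents. The gradient of the
  infinite-horizon objective is taken to be the discounted series of the stage gradients; a quadratic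
  lower bound replaces its differentiability.

  In one round, the mean and the variance of a local iterate are tracked separately. The variance grows
  by at most \<open>O(\<eta>\<^sup>2)\<close> per step, and it enters the mean only through the curvature of the gradient.
  Hence the averaged iterate has mean \<open>\<theta> + \<eta> H v\<close> with \<open>v\<close> close to the gradient and a variance
  divided by the number of agents. Polarising the inner product of the gradient with \<open>v\<close> absorbs the
  \<open>v\<close> part of the smoothness penalty; the average over agents of the squared gradients then dominates
  \<open>2 \<mu> \<Delta>\<^sup>2\<close>, \<open>\<Delta>\<close> being the optimality gap. This gives
  \<open>E \<Delta>' \<le> E \<Delta> - a (E \<Delta>)\<^sup>2 + e\<close> with \<open>a = \<eta> H \<mu> / 4\<close>, a recursion that solves to
  \<open>\<Delta>\<^sub>0 / (1 + R a \<Delta>\<^sub>0) + sqrt (e / a) + e\<close>.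
\<close>

section \<open>Marginals of Markov chains\<close>

text \<open>The theorem admits noise of first order in \<eta> only after division by the number of
  agents; undivided noise must be of order \<open>\<eta> ^ 4\<close>. The difference between the
  expected gradient at a random local iterate and the gradient at its mean is not reduced by
  averaging over agents. Lipschitz continuity would leave a squared difference of order
  \<open>\<eta> ^ 2\<close>. The second derivative makes the difference linear in the variance, and
  the square of that variance stands where the statement has a fourth moment.

  Every agent has its own optimum, so gradient domination holds agent by agent and controls the
  average of squared agent gradients, not the squared average gradient. The term
  \<open>zeta_sq\<close> pays for the exchange.

  The constants differ from those in the statement in both directions. The smoothness constant is
  \<open>3 / 2 * L2\<close>, which turns the step condition 1/74 into 3/148, below 1/49. The
  variance of the estimator is at most a third of \<open>sigma2_sq\<close>.

  There are finitely many trajectories of each length, so all iterates have finitely supported laws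
  and expectations are finite sums, although the parameter space is uncountable.\<close>

primrec chain_marginal :: "nat \<Rightarrow> 'x pmf \<Rightarrow> ('x \<Rightarrow> 'x pmf) \<Rightarrow> 'x pmf" where
  "chain_marginal 0 p K = p"
| "chain_marginal (Suc n) p K = bind_pmf (chain_marginal n p K) K"

text \<open>\<open>chain_marginal\<close> extends the chain at its end, whereas
  \<open>chain_prefix\<close> splits off the first state; this reconciles the two
  recursions.\<close>

lemma chain_marginal_Suc_front:
  "chain_marginal (Suc n) p K = bind_pmf p (\<lambda>x. chain_marginal n (K x) K)"
  by (induction n) (simp_all add: bind_assoc_pmf)

lemma length_chain_prefix: "xs \<in> set_pmf (chain_prefix n p K) \<Longrightarrow> length xs = n"
  by (induction n arbitrary: p xs) auto

lemma map_last_chain_prefix: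
  "map_pmf last (chain_prefix (Suc n) p K) = chain_marginal n p K"
proof (induction n arbitrary: p)
  case 0
  show ?case by (simp add: map_bind_pmf bind_return_pmf')
next
  case (Suc n)
  have "map_pmf last (chain_prefix (Suc (Suc n)) p K) =
      bind_pmf p (\<lambda>x. map_pmf last (map_pmf (Cons x) (chain_prefix (Suc n) (K x) K)))"
    by (simp only: chain_prefix.simps(2)[of "Suc n"] map_bind_pmf)
  also have "\<dots> = bind_pmf p (\<lambda>x. map_pmf last (chain_prefix (Suc n) (K x) K))"
  proof (intro bind_pmf_cong refl)
    fix x
    show "map_pmf last (map_pmf (Cons x) (chain_prefix (Suc n) (K x) K)) =
        map_pmf last (chain_prefix (Suc n) (K x) K)"
      unfolding pmf.map_comp using length_chain_prefix[of _ "Suc n"]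
      by (intro map_pmf_cong refl) force
  qed
  also have "\<dots> = chain_marginal (Suc n) p K"
    by (simp only: Suc.IH chain_marginal_Suc_front)
  finally show ?case .
qed

text \<open>For the estimator, each of whose stages reads its own prefix of one sample of length
  \<open>T\<close>.\<close>

lemma map_take_chain_prefix:
  "m \<le> n \<Longrightarrow> map_pmf (take m) (chain_prefix n p K) = chain_prefix m p K"
proof (induction m arbitrary: n p)
  case 0
  then show ?case by (simp add: map_pmf_const)
next
  case (Suc m)
  then obtain k where k: "n = Suc k" "m \<le> k" by (cases n) auto
  have "map_pmf (take (Suc m)) (chain_prefix (Suc k) p K) =
      bind_pmf p (\<lambda>x. map_pmf (Cons x) (map_pmf (take m) (chain_prefix k (K x) K)))"
    by (simp add: map_bind_pmf pmf.map_comp o_def)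
  then show ?case using Suc.IH[OF k(2)] k(1) by simp
qed

lemma sets_prefix_eq:
  "{\<omega>. map \<omega> [0..<n] = xs} \<in> sets (markov_chain p K)"
proof -
  have "{\<omega>. map \<omega> [0..<n] = xs} = (if length xs = n then (\<Inter>i\<in>{..<n}. {\<omega>. \<omega> i = xs ! i}) \<inter> UNIV else {})"
    by (auto simp: list_eq_iff_nth_eq)
  moreover have "{\<omega>. \<omega> i = a} \<in> sets (markov_chain p K)" for i a
  proof -
    have "(\<lambda>\<omega>. \<omega> i) -` {a} \<inter> space (markov_chain p K) \<in> sets (markov_chain p K)"
      by (rule measurable_sets[of _ _ "count_space UNIV"]) 
         (auto intro!: measurable_component_singleton simp: measurable_cong_sets[OF sets_markov_chain refl])
    then show ?thesis by (simp add: vimage_def)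
  qed
  moreover have "UNIV \<in> sets (markov_chain p K)"
    using sets.top[of "markov_chain p K"] by simp
  ultimately show ?thesis
    by (cases "n = 0") (auto intro!: sets.Int sets.finite_INT)
qed

lemma measurable_markov_chain_component [measurable]:
  "(\<lambda>\<omega>. \<omega> i) \<in> measurable (markov_chain p K) (count_space UNIV)"
  by (auto intro!: measurable_component_singleton simp: measurable_cong_sets[OF sets_markov_chain refl])

text \<open>The state type may be uncountable (later it is the parameter space), so the event is not
  split over all prefixes. Only the countably many prefixes in the support are used; their cylinders
  are disjoint and lie in the event, which gives one direction.\<close>

lemma emeasure_markov_chain_component_ge:
  "emeasure (measure_pmf (chain_marginal n p K)) B \<le> emeasure (markov_chain p K) {\<omega>. \<omega> n \<in> B}"
proof -
  let ?C = "chain_prefix (Suc n) p K" and ?M = "markov_chain p K"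
  let ?pre = "\<lambda>xs. {\<omega>. map \<omega> [0..<Suc n] = xs}"
  define A where "A = set_pmf ?C \<inter> last -` B"
  have cA: "countable A" by (simp add: A_def del: chain_prefix.simps)
  have single: "emeasure ?M (?pre xs) = emeasure (measure_pmf ?C) {xs}" if "xs \<in> A" for xs
  proof -
    have "length xs = Suc n" using that length_chain_prefix unfolding A_def by blast
    then have xs: "map (\<lambda>i. xs ! i) [0..<Suc n] = xs"
      using map_nth[of xs] by simp
    interpret M: prob_space ?M by (rule prob_space_markov_chain)
    show ?thesis
      using measure_markov_chain_prefix[of p K n "\<lambda>i. xs ! i"]
      unfolding xs by (simp add: M.emeasure_eq_measure emeasure_pmf_single del: chain_prefix.simps upt_Suc)
  qed
  have "emeasure (measure_pmf (chain_marginal n p K)) B = emeasure (measure_pmf ?C) (last -` B)"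
    by (simp only: map_last_chain_prefix[symmetric] emeasure_map_pmf)
  also have "\<dots> = emeasure (measure_pmf ?C) A"
    unfolding A_def by (metis Int_commute emeasure_Int_set_pmf)
  also have "\<dots> = (\<integral>\<^sup>+xs. emeasure (measure_pmf ?C) {xs} \<partial>count_space A)"
    by (rule emeasure_countable_singleton) (auto simp: cA)
  also have "\<dots> = (\<integral>\<^sup>+xs. emeasure ?M (?pre xs) \<partial>count_space A)"
    by (intro nn_integral_cong) (simp add: single del: chain_prefix.simps upt_Suc)
  also have "\<dots> = emeasure ?M (\<Union>xs\<in>A. ?pre xs)"
    by (rule emeasure_UN_countable[symmetric])
       (auto simp: cA disjoint_family_on_def sets_prefix_eq simp del: upt_Suc)
  also have "\<dots> \<le> emeasure ?M {\<omega>. \<omega> n \<in> B}"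
  proof (rule emeasure_mono)
    show "(\<Union>xs\<in>A. ?pre xs) \<subseteq> {\<omega>. \<omega> n \<in> B}"
    proof
      fix \<omega> assume "\<omega> \<in> (\<Union>xs\<in>A. ?pre xs)"
      then have "last (map \<omega> [0..<Suc n]) \<in> B" unfolding A_def by blast
      then show "\<omega> \<in> {\<omega>. \<omega> n \<in> B}" by (simp add: last_map)
    qed
    have "(\<lambda>\<omega>. \<omega> n) -` B \<inter> space ?M \<in> sets ?M"
      by (rule measurable_sets[OF measurable_markov_chain_component]) simp
    then show "{\<omega>. \<omega> n \<in> B} \<in> sets ?M" by (simp add: vimage_def)
  qed
  finally show ?thesis .
qed

text \<open>A probability measure that dominates another on every set equals it: the one-sided bound
  is applied to a set and to its complement.\<close>

lemma distr_markov_chain_component: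
  "distr (markov_chain p K) (count_space UNIV) (\<lambda>\<omega>. \<omega> n) = measure_pmf (chain_marginal n p K)"
  (is "?N = measure_pmf ?q")
proof (rule measure_eqI)
  fix B assume "B \<in> sets ?N"
  interpret N: prob_space ?N
    by (intro prob_space.prob_space_distr prob_space_markov_chain measurable_markov_chain_component)
  have ge: "measure ?N D \<ge> measure ?q D" for D
  proof -
    have "emeasure ?q D \<le> emeasure ?N D"
      using emeasure_markov_chain_component_ge[of n p K D]
      by (subst emeasure_distr) (auto simp: vimage_def)
    then show ?thesis by (simp add: N.emeasure_eq_measure measure_pmf.emeasure_eq_measure)
  qed
  have "measure ?N (- B) = 1 - measure ?N B" "measure ?q (- B) = 1 - measure ?q B"
    using N.prob_compl[of B] measure_pmf.prob_compl[of B ?q] by (simp_all add: Compl_eq_Diff_UNIV)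
  with ge[of B] ge[of "- B"] show "emeasure ?N B = emeasure ?q B"
    by (simp add: N.emeasure_eq_measure measure_pmf.emeasure_eq_measure)
qed simp

lemma integral_markov_chain_component:
  fixes f :: "'x \<Rightarrow> 'b::{banach, second_countable_topology}"
  shows "(\<integral>\<omega>. f (\<omega> n) \<partial>markov_chain p K) = measure_pmf.expectation (chain_marginal n p K) f"
  unfolding distr_markov_chain_component[symmetric]
  by (rule integral_distr[symmetric]) auto

lemma integrable_markov_chain_component:
  fixes f :: "'x \<Rightarrow> real"
  assumes "\<And>x. \<bar>f x\<bar> \<le> C"
  shows "integrable (markov_chain p K) (\<lambda>\<omega>. f (\<omega> n))"
proof -
  interpret prob_space "markov_chain p K" by (rule prob_space_markov_chain)
  show ?thesis
    using assms
    by (intro integrable_const_bound[where B = C])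
       (auto intro: measurable_compose[OF measurable_markov_chain_component])
qed

text \<open>Points of the support have positive mass. This makes the almost sure hypothesis on
  \<open>fed_mu\<close> available at every reachable iterate.\<close>

lemma AE_markov_chain_componentD:
  assumes "AE \<omega> in markov_chain p K. Q (\<omega> n)" "x \<in> set_pmf (chain_marginal n p K)"
  shows "Q x"
proof -
  have "AE x in distr (markov_chain p K) (count_space UNIV) (\<lambda>\<omega>. \<omega> n). Q x"
    using assms(1) by (subst AE_distr_iff) auto
  then show ?thesis
    using assms(2) unfolding distr_markov_chain_component by (simp add: AE_measure_pmf_iff)
qed

section \<open>Softmax scores and trajectory derivatives\<close>

lemma pmf_softmax_pos: "0 < pmf (softmax \<theta> s) a"
  unfolding pmf_softmax by (intro divide_pos_pos sum_pos) auto

lemma sum_pmf_finite_UNIV: "(\<Sum>a\<in>UNIV. pmf p (a :: 'a :: finite)) = 1"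
  by (rule sum_pmf_eq_1) auto

lemma abs_pmf_sum_le:
  fixes f :: "'a::finite \<Rightarrow> real"
  assumes "\<And>a. \<bar>f a\<bar> \<le> C"
  shows "\<bar>\<Sum>a\<in>UNIV. pmf p a * f a\<bar> \<le> C"
proof -
  have "\<bar>\<Sum>a\<in>UNIV. pmf p a * f a\<bar> \<le> (\<Sum>a\<in>UNIV. pmf p a * C)"
    by (rule order_trans[OF sum_abs]) (auto intro!: sum_mono mult_left_mono assms simp: abs_mult)
  then show ?thesis by (simp add: sum_distrib_right[symmetric] sum_pmf_finite_UNIV)
qed

text \<open>The logarithm of a softmax probability is a coordinate minus a log-sum-exp, and the
  gradient of the latter is the policy itself.\<close>

lemma GDERIV_ln_softmax:
  "GDERIV (\<lambda>\<theta>'. ln (pmf (softmax \<theta>' s) a)) \<theta> :>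
     axis (s, a) 1 - (\<Sum>a'\<in>UNIV. pmf (softmax \<theta> s) a' *\<^sub>R axis (s, a') 1)"
proof -
  have pos: "(\<Sum>a'\<in>UNIV. exp (\<theta>' $ (s, a'))) > 0" for \<theta>' :: "('a, 'b) param"
    by (intro sum_pos) auto
  have d: "((\<lambda>\<theta>' :: ('a, 'b) param. \<theta>' $ (s, a) - ln (\<Sum>a'\<in>UNIV. exp (\<theta>' $ (s, a')))) has_derivative
      (\<lambda>h. h $ (s, a) - (\<Sum>a'\<in>UNIV. h $ (s, a') * exp (\<theta> $ (s, a'))) / (\<Sum>a'\<in>UNIV. exp (\<theta> $ (s, a'))))) (at \<theta>)"
    using pos[of \<theta>]
    by (auto intro!: derivative_eq_intros bounded_linear.has_derivative[OF bounded_linear_vec_nth]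
          simp: divide_inverse mult_ac)
  have l: "ln (pmf (softmax \<theta>' s) a) = \<theta>' $ (s, a) - ln (\<Sum>a'\<in>UNIV. exp (\<theta>' $ (s, a')))" for \<theta>' :: "('a, 'b) param"
    using pos[of \<theta>'] by (simp add: pmf_softmax ln_div)
  have h: "h $ (s, a) - (\<Sum>a'\<in>UNIV. h $ (s, a') * exp (\<theta> $ (s, a'))) / (\<Sum>a'\<in>UNIV. exp (\<theta> $ (s, a'))) =
      h \<bullet> (axis (s, a) 1 - (\<Sum>a'\<in>UNIV. pmf (softmax \<theta> s) a' *\<^sub>R axis (s, a') 1))" for h
    by (simp add: inner_diff_right inner_sum_right inner_axis pmf_softmax sum_divide_distrib mult_ac)
  show ?thesis
    using d unfolding gderiv_def l h .
qed

lemma score_eq: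
  "score \<theta> (s, a) = axis (s, a) 1 - (\<Sum>a'\<in>UNIV. pmf (softmax \<theta> s) a' *\<^sub>R axis (s, a') 1)"
  unfolding score_def using gradient_eqI[OF GDERIV_ln_softmax] by auto

lemma inner_score:
  "score \<theta> (s, a) \<bullet> w = w $ (s, a) - (\<Sum>a'\<in>UNIV. pmf (softmax \<theta> s) a' * w $ (s, a'))"
  by (simp add: score_eq inner_diff_left inner_sum_left inner_axis')

text \<open>By \<open>inner_score\<close> the product is an entry of \<open>w\<close> minus the
  policy average of such entries; each has modulus at most \<open>norm w\<close>.\<close>

lemma abs_inner_score_le: "\<bar>score \<theta> y \<bullet> w\<bar> \<le> 2 * norm w"
proof (cases y)
  case (Pair s a)
  have "\<bar>\<Sum>a'\<in>UNIV. pmf (softmax \<theta> s) a' * w $ (s, a')\<bar> \<le> norm w"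
    by (rule abs_pmf_sum_le) (rule component_le_norm_cart)
  with component_le_norm_cart[of w "(s, a)"] show ?thesis
    unfolding Pair inner_score by linarith
qed

lemma norm_score_le: "norm (score \<theta> y) \<le> 2"
  using abs_inner_score_le[of \<theta> y "score \<theta> y"]
  by (cases "score \<theta> y = 0") (auto simp: dot_square_norm power2_eq_square)

text \<open>All derivatives are taken along lines and tested against fixed vectors, so that scalar
  calculus suffices. The probability is differentiated as the exponential of its logarithm.\<close>

lemma DERIV_softmax_line:
  "((\<lambda>x. pmf (softmax (\<theta> + x *\<^sub>R u) s) a) has_real_derivative
     pmf (softmax (\<theta> + x *\<^sub>R u) s) a * (score (\<theta> + x *\<^sub>R u) (s, a) \<bullet> u)) (at x)"
proof -
  have "((\<lambda>x. \<theta> + x *\<^sub>R u) has_derivative (\<lambda>h. h *\<^sub>R u)) (at x)"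
    by (auto intro!: derivative_eq_intros)
  from has_derivative_compose[OF this GDERIV_ln_softmax[unfolded gderiv_def, of s a "\<theta> + x *\<^sub>R u"]]
  have "((\<lambda>x. ln (pmf (softmax (\<theta> + x *\<^sub>R u) s) a)) has_real_derivative
      (score (\<theta> + x *\<^sub>R u) (s, a) \<bullet> u)) (at x)"
    by (simp add: has_field_derivative_def score_eq inner_commute mult_commute_abs)
  then have "((\<lambda>x. exp (ln (pmf (softmax (\<theta> + x *\<^sub>R u) s) a))) has_real_derivative
     exp (ln (pmf (softmax (\<theta> + x *\<^sub>R u) s) a)) * (score (\<theta> + x *\<^sub>R u) (s, a) \<bullet> u)) (at x)"
    by (rule DERIV_fun_exp)
  then show ?thesis by (simp add: pmf_softmax_pos)
qed

text \<open>Minus the covariance of \<open>u\<close> and \<open>w\<close> at \<open>s\<close> under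
  the policy, that is, the Hessian of the negative log-sum-exp. No action occurs, because the action
  enters the score only through an entry of \<open>w\<close> that is free of \<theta>.\<close>

definition score_deriv :: "('s::finite, 'a::finite) param \<Rightarrow> ('s, 'a) param \<Rightarrow> ('s, 'a) param \<Rightarrow> 's \<Rightarrow> real" where
  "score_deriv \<theta> u w s =
     - (\<Sum>a\<in>UNIV. pmf (softmax \<theta> s) a * (w $ (s, a) * (score \<theta> (s, a) \<bullet> u)))"

text \<open>The square comes from differentiating the policy, the other summand from differentiating
  the score.\<close>

definition score_deriv2 :: "('s::finite, 'a::finite) param \<Rightarrow> ('s, 'a) param \<Rightarrow> ('s, 'a) param \<Rightarrow> 's \<Rightarrow> real" where
  "score_deriv2 \<theta> u w s =
     - (\<Sum>a\<in>UNIV. pmf (softmax \<theta> s) a * (w $ (s, a) * ((score \<theta> (s, a) \<bullet> u)\<^sup>2 + score_deriv \<theta> u u s)))"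

lemma DERIV_score_line:
  "((\<lambda>x. score (\<theta> + x *\<^sub>R u) (s, a) \<bullet> w) has_real_derivative score_deriv (\<theta> + x *\<^sub>R u) u w s) (at x)"
  unfolding inner_score score_deriv_def
  by (auto intro!: derivative_eq_intros DERIV_softmax_line sum.cong simp: sum_negf[symmetric] inner_score mult_ac)

lemma DERIV_score_deriv_line:
  "((\<lambda>x. score_deriv (\<theta> + x *\<^sub>R u) u w s) has_real_derivative score_deriv2 (\<theta> + x *\<^sub>R u) u w s) (at x)"
  unfolding score_deriv_def[of _ u w] score_deriv2_def
  by (auto intro!: derivative_eq_intros DERIV_softmax_line DERIV_score_line sum.cong
      simp: algebra_simps power2_eq_square)

lemma abs_score_deriv_le: "\<bar>score_deriv \<theta> u w s\<bar> \<le> 2 * norm w * norm u"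
  unfolding score_deriv_def abs_minus_cancel
proof (rule abs_pmf_sum_le)
  fix a
  show "\<bar>w $ (s, a) * (score \<theta> (s, a) \<bullet> u)\<bar> \<le> 2 * norm w * norm u"
    using mult_mono[OF component_le_norm_cart[of w "(s, a)"] abs_inner_score_le[of \<theta> "(s, a)" u]]
    by (simp add: abs_mult)
qed

lemma abs_score_deriv2_le: "\<bar>score_deriv2 \<theta> u w s\<bar> \<le> 6 * norm w * (norm u)\<^sup>2"
  unfolding score_deriv2_def abs_minus_cancel
proof (rule abs_pmf_sum_le)
  fix a
  have "(score \<theta> (s, a) \<bullet> u)\<^sup>2 \<le> (2 * norm u)\<^sup>2"
    using abs_inner_score_le[of \<theta> "(s, a)" u] by (metis abs_ge_zero power2_abs power_mono)
  \<comment> \<open>Four from the squared score, two from \<open>abs_score_deriv_le\<close> with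
    \<open>w = u\<close>.\<close>
  then have "\<bar>(score \<theta> (s, a) \<bullet> u)\<^sup>2 + score_deriv \<theta> u u s\<bar> \<le> 6 * (norm u)\<^sup>2"
    using abs_score_deriv_le[of \<theta> u u s] unfolding power2_eq_square abs_le_iff by (simp add: mult.assoc) (smt (verit) zero_le_square)
  from mult_mono[OF component_le_norm_cart[of w "(s, a)"] this]
  show "\<bar>w $ (s, a) * ((score \<theta> (s, a) \<bullet> u)\<^sup>2 + score_deriv \<theta> u u s)\<bar> \<le> 6 * norm w * (norm u)\<^sup>2"
    by (simp add: abs_mult mult_ac)
qed

section \<open>Trajectory probabilities and the likelihood-ratio rule\<close>

lemma pmf_chain_prefix_Cons:
  "pmf (chain_prefix (Suc n) p K) (x # xs) = pmf p x * pmf (chain_prefix n (K x) K) xs"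
proof -
  have "pmf (chain_prefix (Suc n) p K) (x # xs) =
      (\<integral>y. pmf (map_pmf (Cons y) (chain_prefix n (K y) K)) (x # xs) \<partial>p)"
    by (simp add: pmf_bind)
  also have "\<dots> = (\<integral>y. pmf (chain_prefix n (K x) K) xs * indicator {x} y \<partial>p)"
  proof (intro Bochner_Integration.integral_cong refl)
    fix y
    show "pmf (map_pmf (Cons y) (chain_prefix n (K y) K)) (x # xs) = pmf (chain_prefix n (K x) K) xs * indicator {x} y"
    proof (cases "y = x")
      case True
      then show ?thesis using pmf_map_inj'[of "Cons y"] by (simp add: inj_def)
    next
      case False
      then show ?thesis by (subst pmf_map_outside) auto
    qed
  qed
  also have "\<dots> = pmf p x * pmf (chain_prefix n (K x) K) xs"
    by (simp add: measure_pmf_single)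
  finally show ?thesis .
qed

lemma pmf_state_action: "pmf (state_action q \<pi>) (s, a) = pmf q s * pmf (\<pi> s) a"
proof -
  have "pmf (state_action q \<pi>) (s, a) = (\<integral>y. pmf (map_pmf (Pair y) (\<pi> y)) (s, a) \<partial>q)"
    by (simp add: state_action_def pmf_bind)
  also have "\<dots> = (\<integral>y. pmf (\<pi> s) a * indicator {s} y \<partial>q)"
  proof (intro Bochner_Integration.integral_cong refl)
    fix y
    show "pmf (map_pmf (Pair y) (\<pi> y)) (s, a) = pmf (\<pi> s) a * indicator {s} y"
    proof (cases "y = s")
      case True
      then show ?thesis using pmf_map_inj'[of "Pair y"] by (simp add: inj_def)
    next
      case False
      then show ?thesis by (subst pmf_map_outside) auto
    qed
  qed
  also have "\<dots> = pmf q s * pmf (\<pi> s) a"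
    by (simp add: measure_pmf_single)
  finally show ?thesis .
qed

lemma pmf_mdp_trajectory_Nil: "pmf (mdp_trajectory 0 P q \<pi>) [] = 1"
  by (simp add: mdp_trajectory_def)

lemma pmf_mdp_trajectory_Cons:
  "pmf (mdp_trajectory (Suc n) P q \<pi>) ((s, a) # z) =
     pmf q s * pmf (\<pi> s) a * pmf (mdp_trajectory n P (P s a) \<pi>) z"
  by (simp add: mdp_trajectory_def pmf_chain_prefix_Cons pmf_state_action del: chain_prefix.simps)

lemma length_mdp_trajectory: "z \<in> set_pmf (mdp_trajectory n P q \<pi>) \<Longrightarrow> length z = n"
  unfolding mdp_trajectory_def by (rule length_chain_prefix)

lemma finite_lists_length: "finite {z :: 'x::finite list. length z = n}"
  using finite_lists_length_eq[of "UNIV :: 'x set" n] by simp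

lemma finite_set_mdp_trajectory:
  fixes P :: "'s::finite \<Rightarrow> 'a::finite \<Rightarrow> 's pmf"
  shows "finite (set_pmf (mdp_trajectory n P q \<pi>))"
  by (rule finite_subset[OF _ finite_lists_length[of n]]) (auto dest: length_mdp_trajectory)

lemma expectation_mdp_trajectory:
  fixes P :: "'s::finite \<Rightarrow> 'a::finite \<Rightarrow> 's pmf" and f :: "_ \<Rightarrow> 'v::{banach, second_countable_topology}"
  shows "measure_pmf.expectation (mdp_trajectory n P q \<pi>) f =
    (\<Sum>z | length z = n. pmf (mdp_trajectory n P q \<pi>) z *\<^sub>R f z)"
  by (rule integral_measure_pmf) (auto simp: finite_lists_length dest: length_mdp_trajectory)

lemma sum_pmf_mdp_trajectory:
  fixes P :: "'s::finite \<Rightarrow> 'a::finite \<Rightarrow> 's pmf"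
  shows "(\<Sum>z | length z = n. pmf (mdp_trajectory n P q \<pi>) z) = 1"
  by (rule sum_pmf_eq_1) (auto simp: finite_lists_length dest: length_mdp_trajectory)

lemma sum_lists_length_Suc:
  fixes f :: "('s::finite \<times> 'a::finite) list \<Rightarrow> 'v::comm_monoid_add"
  shows "(\<Sum>z | length z = Suc n. f z) = (\<Sum>s\<in>UNIV. \<Sum>a\<in>UNIV. \<Sum>z | length z = n. f ((s, a) # z))"
proof -
  have "(\<Sum>z | length z = Suc n. f z) = (\<Sum>(y, z)\<in>UNIV \<times> {z. length z = n}. f (y # z))"
    by (rule sum.reindex_bij_witness[where j = "\<lambda>z. (hd z, tl z)" and i = "\<lambda>(y, z). y # z"])
       (auto simp: length_Suc_conv)
  also have "\<dots> = (\<Sum>y\<in>UNIV. \<Sum>z | length z = n. f (y # z))"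
    by (rule sum.cartesian_product[symmetric])
  also have "\<dots> = (\<Sum>(s, a)\<in>UNIV \<times> UNIV. \<Sum>z | length z = n. f ((s, a) # z))"
    by (intro sum.cong) auto
  also have "\<dots> = (\<Sum>s\<in>UNIV. \<Sum>a\<in>UNIV. \<Sum>z | length z = n. f ((s, a) # z))"
    by (rule sum.cartesian_product[symmetric])
  finally show ?thesis .
qed

lemma norm_expectation_mdp_trajectory_le:
  fixes P :: "'s::finite \<Rightarrow> 'a::finite \<Rightarrow> 's pmf" and f :: "_ \<Rightarrow> 'v::{banach, second_countable_topology}"
  assumes "\<And>z. length z = n \<Longrightarrow> norm (f z) \<le> C"
  shows "norm (measure_pmf.expectation (mdp_trajectory n P q \<pi>) f) \<le> C"
proof -
  have "norm (measure_pmf.expectation (mdp_trajectory n P q \<pi>) f)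
      \<le> (\<Sum>z | length z = n. pmf (mdp_trajectory n P q \<pi>) z * C)"
    unfolding expectation_mdp_trajectory
    by (rule order_trans[OF norm_sum]) (auto intro!: sum_mono mult_left_mono assms)
  then show ?thesis by (simp add: sum_distrib_right[symmetric] sum_pmf_mdp_trajectory)
qed

text \<open>Only the policy factors of a trajectory probability depend on \<theta>, and the
  logarithmic derivative of a product is a sum of scores. The initial law is generalised because the
  tail of the trajectory starts from \<open>P s a\<close>.\<close>

lemma DERIV_pmf_mdp_trajectory:
  "length z = n \<Longrightarrow> ((\<lambda>x. pmf (mdp_trajectory n P q (softmax (\<theta> + x *\<^sub>R u))) z) has_real_derivative
     pmf (mdp_trajectory n P q (softmax (\<theta> + x *\<^sub>R u))) z * (\<Sum>y\<leftarrow>z. score (\<theta> + x *\<^sub>R u) y \<bullet> u)) (at x)"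
proof (induction z arbitrary: n q)
  case Nil
  then show ?case by (simp add: pmf_mdp_trajectory_Nil)
next
  case (Cons y z)
  obtain s a where y: "y = (s, a)" by (cases y)
  obtain m where m: "n = Suc m" "length z = m" using Cons.prems by auto
  show ?case
    unfolding y m(1) pmf_mdp_trajectory_Cons
    by (rule derivative_eq_intros DERIV_softmax_line Cons.IH[OF m(2)] refl)+ (simp add: algebra_simps)
qed

text \<open>Differentiating the weight multiplies the integrand by the total score. Repeated use of
  this rule produces \<open>grad_integrand1\<close> and \<open>grad_integrand2\<close>.\<close>

lemma DERIV_expectation_mdp_trajectory:
  assumes "\<And>z. length z = n \<Longrightarrow> ((\<lambda>x. f x z) has_real_derivative f' z) (at x)"
  shows "((\<lambda>x. measure_pmf.expectation (mdp_trajectory n P q (softmax (\<theta> + x *\<^sub>R u))) (f x)) has_real_derivative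
    measure_pmf.expectation (mdp_trajectory n P q (softmax (\<theta> + x *\<^sub>R u)))
      (\<lambda>z. f' z + f x z * (\<Sum>y\<leftarrow>z. score (\<theta> + x *\<^sub>R u) y \<bullet> u))) (at x)"
  unfolding expectation_mdp_trajectory real_scaleR_def
  by (rule DERIV_cong[OF DERIV_sum[OF DERIV_mult[OF DERIV_pmf_mdp_trajectory assms]]])
     (auto simp: algebra_simps intro!: sum.cong)

lemma DERIV_sum_list:
  assumes "\<And>y. y \<in> set z \<Longrightarrow> ((\<lambda>x. f x y) has_real_derivative f' y) (at x)"
  shows "((\<lambda>x. \<Sum>y\<leftarrow>z. f x y) has_real_derivative (\<Sum>y\<leftarrow>z. f' y)) (at x)"
  using assms by (induction z) (auto intro!: derivative_eq_intros)

lemma norm_sum_list_le: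
  fixes f :: "'y \<Rightarrow> 'v::real_normed_vector"
  assumes "\<And>y. norm (f y) \<le> C"
  shows "norm (\<Sum>y\<leftarrow>z. f y) \<le> real (length z) * C"
proof (induction z)
  case (Cons y z)
  have "norm (\<Sum>y\<leftarrow>y # z. f y) \<le> norm (f y) + norm (\<Sum>y\<leftarrow>z. f y)"
    by (simp add: norm_triangle_ineq)
  with Cons assms[of y] show ?case by (simp add: algebra_simps)
qed simp

section \<open>Stage gradients\<close>

text \<open>Multiplication by \<open>1 - \<gamma>\<close> turns coefficients into their differences,
  and the difference of a rising factorial is a multiple of the one of lower degree; powers of
  \<open>t + 1\<close> are dominated by rising factorials. The bounds are uniform in
  \<open>N\<close>, so they serve truncated sums and series alike.\<close>

lemma sum_geometric_le:
  assumes "0 < \<gamma>" "\<gamma> < (1::real)"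
  shows "(\<Sum>t<N. \<gamma> ^ t) \<le> 1 / (1 - \<gamma>)"
    and "(\<Sum>t<N. \<gamma> ^ t * (real t + 1)) \<le> 1 / (1 - \<gamma>) ^ 2"
    and "(\<Sum>t<N. \<gamma> ^ t * (real t + 1) ^ 2) \<le> 2 / (1 - \<gamma>) ^ 3"
    and "(\<Sum>t<N. \<gamma> ^ t * (real t + 1) ^ 3) \<le> 6 / (1 - \<gamma>) ^ 4"
    and "(\<Sum>t<N. \<gamma> ^ t * ((real t + 1) * real t)) \<le> 2 / (1 - \<gamma>) ^ 3"
proof -
  define d where "d = 1 - \<gamma>"
  have d: "d > 0" using assms by (simp add: d_def)
  \<comment> \<open>Drops the nonnegative boundary term \<open>Y\<close> and divides by
    \<open>1 - \<gamma>\<close>.\<close>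
  have le: "S \<le> X / d" if "(1 - \<gamma>) * S = X - Y" "0 \<le> Y" for S X Y
    using that d by (simp add: pos_le_divide_eq mult.commute d_def)
  have 0: "(1 - \<gamma>) * (\<Sum>t<N. \<gamma> ^ t) = 1 - \<gamma> ^ N"
    by (simp add: one_diff_power_eq)
  have 1: "(1 - \<gamma>) * (\<Sum>t<N. \<gamma> ^ t * (real t + 1)) = (\<Sum>t<N. \<gamma> ^ t) - real N * \<gamma> ^ N"
    by (induction N) (simp, simp only: sum.lessThan_Suc distrib_left, simp (no_asm) add: algebra_simps)
  have 2: "(1 - \<gamma>) * (\<Sum>t<N. \<gamma> ^ t * ((real t + 1) * (real t + 2))) =
      2 * (\<Sum>t<N. \<gamma> ^ t * (real t + 1)) - real N * (real N + 1) * \<gamma> ^ N"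
    by (induction N) (simp, simp only: sum.lessThan_Suc distrib_left, simp (no_asm) add: algebra_simps)
  have 3: "(1 - \<gamma>) * (\<Sum>t<N. \<gamma> ^ t * ((real t + 1) * (real t + 2) * (real t + 3))) =
      3 * (\<Sum>t<N. \<gamma> ^ t * ((real t + 1) * (real t + 2))) - real N * (real N + 1) * (real N + 2) * \<gamma> ^ N"
    by (induction N) (simp, simp only: sum.lessThan_Suc distrib_left, simp (no_asm) add: algebra_simps)
  show a0: "(\<Sum>t<N. \<gamma> ^ t) \<le> 1 / (1 - \<gamma>)"
    using le[OF 0] assms by (simp add: d_def)
  have "(\<Sum>t<N. \<gamma> ^ t * (real t + 1)) \<le> (\<Sum>t<N. \<gamma> ^ t) / d"
    using le[OF 1] assms by simp
  also have "\<dots> \<le> (1 / d) / d" using a0 d by (intro divide_right_mono) (auto simp: d_def)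
  finally show a1: "(\<Sum>t<N. \<gamma> ^ t * (real t + 1)) \<le> 1 / (1 - \<gamma>) ^ 2"
    by (simp add: d_def power2_eq_square)
  have "(\<Sum>t<N. \<gamma> ^ t * ((real t + 1) * (real t + 2))) \<le> 2 * (\<Sum>t<N. \<gamma> ^ t * (real t + 1)) / d"
    using le[OF 2] assms by simp
  also have "\<dots> \<le> 2 * (1 / d ^ 2) / d"
    using a1 d by (intro divide_right_mono mult_left_mono) (auto simp: d_def)
  finally have a2: "(\<Sum>t<N. \<gamma> ^ t * ((real t + 1) * (real t + 2))) \<le> 2 / d ^ 3"
    by (simp add: power3_eq_cube power2_eq_square)
  have "(\<Sum>t<N. \<gamma> ^ t * ((real t + 1) * (real t + 2) * (real t + 3)))
      \<le> 3 * (\<Sum>t<N. \<gamma> ^ t * ((real t + 1) * (real t + 2))) / d"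
    using le[OF 3] assms by simp
  also have "\<dots> \<le> 3 * (2 / d ^ 3) / d"
    using a2 d by (intro divide_right_mono mult_left_mono) auto
  finally have a3: "(\<Sum>t<N. \<gamma> ^ t * ((real t + 1) * (real t + 2) * (real t + 3))) \<le> 6 / d ^ 4"
    by (simp add: power4_eq_xxxx power3_eq_cube mult_ac)
  have "(\<Sum>t<N. \<gamma> ^ t * (real t + 1) ^ 2) \<le> (\<Sum>t<N. \<gamma> ^ t * ((real t + 1) * (real t + 2)))"
    using assms by (intro sum_mono mult_left_mono) (auto simp: power2_eq_square)
  with a2 show "(\<Sum>t<N. \<gamma> ^ t * (real t + 1) ^ 2) \<le> 2 / (1 - \<gamma>) ^ 3" by (simp add: d_def)
  have "(\<Sum>t<N. \<gamma> ^ t * ((real t + 1) * real t)) \<le> (\<Sum>t<N. \<gamma> ^ t * ((real t + 1) * (real t + 2)))"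
    using assms by (intro sum_mono mult_left_mono) auto
  with a2 show "(\<Sum>t<N. \<gamma> ^ t * ((real t + 1) * real t)) \<le> 2 / (1 - \<gamma>) ^ 3" by (simp add: d_def)
  have "(\<Sum>t<N. \<gamma> ^ t * (real t + 1) ^ 3) \<le> (\<Sum>t<N. \<gamma> ^ t * ((real t + 1) * (real t + 2) * (real t + 3)))"
    using assms unfolding power3_eq_cube
    by (intro sum_mono mult_left_mono mult_mono) auto
  with a3 show "(\<Sum>t<N. \<gamma> ^ t * (real t + 1) ^ 3) \<le> 6 / (1 - \<gamma>) ^ 4" by (simp add: d_def)
qed

lemma norm_suminf_weighted_le:
  fixes f :: "nat \<Rightarrow> 'v::banach"
  assumes "\<And>t. norm (f t) \<le> b t" "\<And>N. (\<Sum>t<N. b t) \<le> C"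
  shows "summable f" "norm (suminf f) \<le> C"
proof -
  have b0: "0 \<le> b t" for t using assms(1)[of t] norm_ge_zero order_trans by blast
  have sb: "summable b" by (rule summableI_nonneg_bounded[OF b0 assms(2)])
  show "summable f" by (rule summable_comparison_test'[OF sb assms(1)])
  have "norm (suminf f) \<le> suminf b" by (rule norm_suminf_le[OF assms(1) sb])
  also have "\<dots> \<le> C" by (rule suminf_le_const[OF sb assms(2)])
  finally show "norm (suminf f) \<le> C" .
qed

lemma convex_on_lines:
  fixes f :: "'v::real_vector \<Rightarrow> real"
  assumes "\<And>x u. convex_on UNIV (\<lambda>t. f (x + t *\<^sub>R u))"
  shows "convex_on UNIV f"
proof (rule convex_onI)
  fix t :: real and x y :: 'v
  assume t: "0 < t" "t < 1"
  have "f (x + ((1 - t) *\<^sub>R 0 + t *\<^sub>R 1) *\<^sub>R (y - x)) \<le> (1 - t) * f (x + 0 *\<^sub>R (y - x)) + t * f (x + 1 *\<^sub>R (y - x))"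
    by (rule convex_onD[OF assms]) (use t in auto)
  then show "f ((1 - t) *\<^sub>R x + t *\<^sub>R y) \<le> (1 - t) * f x + t * f y"
    by (simp add: algebra_simps)
qed simp

lemma jensen_pmf_finite:
  fixes p :: "'v::euclidean_space pmf" and h :: "'v \<Rightarrow> real"
  assumes "convex_on UNIV h" "finite (set_pmf p)"
  shows "h (measure_pmf.expectation p (\<lambda>x. x)) \<le> measure_pmf.expectation p h"
proof -
  have "measure_pmf.expectation p (\<lambda>x. x) = (\<Sum>x\<in>set_pmf p. pmf p x *\<^sub>R x)"
    "measure_pmf.expectation p h = (\<Sum>x\<in>set_pmf p. pmf p x * h x)"
    using assms(2) by (auto intro!: integral_measure_pmf[where 'a = 'v] simp: integral_measure_pmf_real mult.commute)
  moreover have "h (\<Sum>x\<in>set_pmf p. pmf p x *\<^sub>R x) \<le> (\<Sum>x\<in>set_pmf p. pmf p x * h x)"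
    by (rule convex_on_sum[OF assms(2) set_pmf_not_empty assms(1)])
       (auto simp: sum_pmf_eq_1 assms(2))
  ultimately show ?thesis by simp
qed

definition last_reward :: "('s \<Rightarrow> 'a \<Rightarrow> real) \<Rightarrow> ('s \<times> 'a) list \<Rightarrow> real" where
  "last_reward r z = r (fst (last z)) (snd (last z))"

definition stage_reward ::
    "('s::finite \<Rightarrow> 'a::finite \<Rightarrow> 's pmf) \<Rightarrow> ('s \<Rightarrow> 'a \<Rightarrow> real) \<Rightarrow> nat \<Rightarrow> 's pmf \<Rightarrow> ('s, 'a) param \<Rightarrow> real" where
  "stage_reward P r t q \<theta> =
     measure_pmf.expectation (mdp_trajectory (Suc t) P q (softmax \<theta>)) (last_reward r)"

text \<open>The likelihood-ratio formula is taken as the definition;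
  \<open>DERIV_stage_reward\<close> confirms that it gives the derivatives of
  \<open>stage_reward\<close> along lines.\<close>

definition stage_grad ::
    "('s::finite \<Rightarrow> 'a::finite \<Rightarrow> 's pmf) \<Rightarrow> ('s \<Rightarrow> 'a \<Rightarrow> real) \<Rightarrow> nat \<Rightarrow> 's pmf \<Rightarrow>
     ('s, 'a) param \<Rightarrow> ('s, 'a) param" where
  "stage_grad P r t q \<theta> =
     measure_pmf.expectation (mdp_trajectory (Suc t) P q (softmax \<theta>))
       (\<lambda>z. last_reward r z *\<^sub>R (\<Sum>y\<leftarrow>z. score \<theta> y))"

definition trunc_grad ::
    "real \<Rightarrow> ('s::finite \<Rightarrow> 'a::finite \<Rightarrow> 's pmf) \<Rightarrow> ('s \<Rightarrow> 'a \<Rightarrow> real) \<Rightarrow> nat \<Rightarrow> 's pmf \<Rightarrow>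
     ('s, 'a) param \<Rightarrow> ('s, 'a) param" where
  "trunc_grad \<gamma> P r T q \<theta> = (\<Sum>t<T. \<gamma> ^ t *\<^sub>R stage_grad P r t q \<theta>)"

definition policy_grad ::
    "real \<Rightarrow> ('s::finite \<Rightarrow> 'a::finite \<Rightarrow> 's pmf) \<Rightarrow> ('s \<Rightarrow> 'a \<Rightarrow> real) \<Rightarrow> 's pmf \<Rightarrow>
     ('s, 'a) param \<Rightarrow> ('s, 'a) param" where
  "policy_grad \<gamma> P r q \<theta> = (\<Sum>t. \<gamma> ^ t *\<^sub>R stage_grad P r t q \<theta>)"

definition discounted_value ::
    "real \<Rightarrow> ('s::finite \<Rightarrow> 'a::finite \<Rightarrow> 's pmf) \<Rightarrow> ('s \<Rightarrow> 'a \<Rightarrow> real) \<Rightarrow> 's pmf \<Rightarrow>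
     ('s, 'a) param \<Rightarrow> real" where
  "discounted_value \<gamma> P r q \<theta> = (\<Sum>t. \<gamma> ^ t * stage_reward P r t q \<theta>)"

lemma inner_sum_list_left: "(\<Sum>y\<leftarrow>z. f y) \<bullet> w = (\<Sum>y\<leftarrow>z. f y \<bullet> w)"
  by (induction z) (auto simp: inner_add_left)

lemma inner_stage_grad:
  "stage_grad P r t q \<theta> \<bullet> w =
     measure_pmf.expectation (mdp_trajectory (Suc t) P q (softmax \<theta>))
       (\<lambda>z. last_reward r z * (\<Sum>y\<leftarrow>z. score \<theta> y \<bullet> w))"
  by (simp add: stage_grad_def expectation_mdp_trajectory inner_sum_left inner_sum_list_left mult.assoc)

locale softmax_mdp =
  fixes \<gamma> :: real and P :: "'s::finite \<Rightarrow> 'a::finite \<Rightarrow> 's pmf" and r :: "'s \<Rightarrow> 'a \<Rightarrow> real"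
  assumes gamma_pos: "0 < \<gamma>" and gamma_less_1: "\<gamma> < 1"
    and reward_nonneg: "0 \<le> r s a" and reward_le_1: "r s a \<le> 1"
begin

lemma abs_last_reward_le: "\<bar>last_reward r z\<bar> \<le> 1"
  using reward_nonneg reward_le_1 by (simp add: last_reward_def)

lemma abs_last_reward_mult_le: "\<bar>x\<bar> \<le> C \<Longrightarrow> \<bar>last_reward r z * x\<bar> \<le> C"
  using mult_mono[OF abs_last_reward_le[of z], of "\<bar>x\<bar>" C] by (simp add: abs_mult)

lemma abs_stage_reward_le: "\<bar>stage_reward P r t q \<theta>\<bar> \<le> 1"
  unfolding stage_reward_def real_norm_def[symmetric]
  by (rule norm_expectation_mdp_trajectory_le) (simp add: abs_last_reward_le)

lemma norm_stage_grad_le: "norm (stage_grad P r t q \<theta>) \<le> 2 * (real t + 1)"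
  unfolding stage_grad_def
proof (rule norm_expectation_mdp_trajectory_le)
  fix z :: "('s \<times> 'a) list" assume z: "length z = Suc t"
  have "norm (\<Sum>y\<leftarrow>z. score \<theta> y) \<le> real (Suc t) * 2"
    using norm_sum_list_le[of "score \<theta>" 2 z, OF norm_score_le] z by simp
  then have "\<bar>last_reward r z\<bar> * norm (\<Sum>y\<leftarrow>z. score \<theta> y) \<le> 1 * (real (Suc t) * 2)"
    by (intro mult_mono abs_last_reward_le) auto
  then show "norm (last_reward r z *\<^sub>R (\<Sum>y\<leftarrow>z. score \<theta> y)) \<le> 2 * (real t + 1)"
    by simp
qed

text \<open>The first two derivatives, along the line through \<open>\<theta>\<close> in direction \<open>u\<close>, of the integrand
  of the \<open>w\<close>-component of the stage gradient, each including the likelihood-ratio term.\<close>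

definition grad_integrand1 :: "('s, 'a) param \<Rightarrow> ('s, 'a) param \<Rightarrow> ('s, 'a) param \<Rightarrow> ('s \<times> 'a) list \<Rightarrow> real" where
  "grad_integrand1 \<theta> u w z = last_reward r z *
     ((\<Sum>y\<leftarrow>z. score_deriv \<theta> u w (fst y)) + (\<Sum>y\<leftarrow>z. score \<theta> y \<bullet> w) * (\<Sum>y\<leftarrow>z. score \<theta> y \<bullet> u))"

definition grad_integrand2 :: "('s, 'a) param \<Rightarrow> ('s, 'a) param \<Rightarrow> ('s, 'a) param \<Rightarrow> ('s \<times> 'a) list \<Rightarrow> real" where
  "grad_integrand2 \<theta> u w z = last_reward r z *
     ((\<Sum>y\<leftarrow>z. score_deriv2 \<theta> u w (fst y))
      + ((\<Sum>y\<leftarrow>z. score_deriv \<theta> u w (fst y)) * (\<Sum>y\<leftarrow>z. score \<theta> y \<bullet> u)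
         + (\<Sum>y\<leftarrow>z. score \<theta> y \<bullet> w) * (\<Sum>y\<leftarrow>z. score_deriv \<theta> u u (fst y))))
     + grad_integrand1 \<theta> u w z * (\<Sum>y\<leftarrow>z. score \<theta> y \<bullet> u)"

definition stage_deriv1 :: "nat \<Rightarrow> 's pmf \<Rightarrow> ('s, 'a) param \<Rightarrow> ('s, 'a) param \<Rightarrow> ('s, 'a) param \<Rightarrow> real" where
  "stage_deriv1 t q \<theta> u w =
     measure_pmf.expectation (mdp_trajectory (Suc t) P q (softmax \<theta>)) (grad_integrand1 \<theta> u w)"

definition stage_deriv2 :: "nat \<Rightarrow> 's pmf \<Rightarrow> ('s, 'a) param \<Rightarrow> ('s, 'a) param \<Rightarrow> ('s, 'a) param \<Rightarrow> real" where
  "stage_deriv2 t q \<theta> u w =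
     measure_pmf.expectation (mdp_trajectory (Suc t) P q (softmax \<theta>)) (grad_integrand2 \<theta> u w)"

lemma DERIV_sum_list_score:
  fixes z :: "('s \<times> 'a) list"
  shows "((\<lambda>x. \<Sum>y\<leftarrow>z. score (\<theta> + x *\<^sub>R u) y \<bullet> w) has_real_derivative
     (\<Sum>y\<leftarrow>z. score_deriv (\<theta> + x *\<^sub>R u) u w (fst y))) (at x)"
proof (rule DERIV_sum_list)
  show "((\<lambda>x. score (\<theta> + x *\<^sub>R u) y \<bullet> w) has_real_derivative score_deriv (\<theta> + x *\<^sub>R u) u w (fst y)) (at x)"
    for y :: "'s \<times> 'a"
    using DERIV_score_line[of \<theta> u "fst y" "snd y" w x] by simp
qed

lemma DERIV_stage_reward:
  "((\<lambda>x. stage_reward P r t q (\<theta> + x *\<^sub>R u)) has_real_derivative stage_grad P r t q (\<theta> + x *\<^sub>R u) \<bullet> u) (at x)"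
  unfolding stage_reward_def inner_stage_grad
  using DERIV_expectation_mdp_trajectory[of "Suc t" "\<lambda>x z. last_reward r z" "\<lambda>z. 0" x P q \<theta> u]
  by simp

lemma DERIV_stage_grad:
  "((\<lambda>x. stage_grad P r t q (\<theta> + x *\<^sub>R u) \<bullet> w) has_real_derivative stage_deriv1 t q (\<theta> + x *\<^sub>R u) u w) (at x)"
  unfolding stage_deriv1_def inner_stage_grad
  by (rule DERIV_cong[OF DERIV_expectation_mdp_trajectory[OF DERIV_cmult[OF DERIV_sum_list_score]]])
     (simp add: grad_integrand1_def[abs_def] algebra_simps)

lemma DERIV_stage_deriv1:
  "((\<lambda>x. stage_deriv1 t q (\<theta> + x *\<^sub>R u) u w) has_real_derivative stage_deriv2 t q (\<theta> + x *\<^sub>R u) u w) (at x)"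
proof -
  have "((\<lambda>x. grad_integrand1 (\<theta> + x *\<^sub>R u) u w z) has_real_derivative
     last_reward r z *
     ((\<Sum>y\<leftarrow>z. score_deriv2 (\<theta> + x *\<^sub>R u) u w (fst y))
      + ((\<Sum>y\<leftarrow>z. score_deriv (\<theta> + x *\<^sub>R u) u w (fst y)) * (\<Sum>y\<leftarrow>z. score (\<theta> + x *\<^sub>R u) y \<bullet> u)
         + (\<Sum>y\<leftarrow>z. score (\<theta> + x *\<^sub>R u) y \<bullet> w) * (\<Sum>y\<leftarrow>z. score_deriv (\<theta> + x *\<^sub>R u) u u (fst y))))) (at x)" for z
    unfolding grad_integrand1_def
    by (rule DERIV_cong[OF DERIV_cmult[OF DERIV_add[OF DERIV_sum_list[OF DERIV_score_deriv_line]
          DERIV_mult[OF DERIV_sum_list_score DERIV_sum_list_score]]]]) (simp add: algebra_simps)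
  then show ?thesis
    unfolding stage_deriv1_def stage_deriv2_def grad_integrand2_def[abs_def]
    by (rule DERIV_expectation_mdp_trajectory)
qed

lemma abs_sum_list_score_le:
  assumes "length z = Suc t"
  shows "\<bar>\<Sum>y\<leftarrow>z. score \<theta> y \<bullet> w\<bar> \<le> (real t + 1) * (2 * norm w)"
    and "\<bar>\<Sum>y\<leftarrow>z. score_deriv \<theta> u w (fst y)\<bar> \<le> (real t + 1) * (2 * norm w * norm u)"
    and "\<bar>\<Sum>y\<leftarrow>z. score_deriv2 \<theta> u w (fst y)\<bar> \<le> (real t + 1) * (6 * norm w * (norm u)\<^sup>2)"
  using norm_sum_list_le[of "\<lambda>y. score \<theta> y \<bullet> w" "2 * norm w" z]
    norm_sum_list_le[of "\<lambda>y. score_deriv \<theta> u w (fst y)" "2 * norm w * norm u" z]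
    norm_sum_list_le[of "\<lambda>y. score_deriv2 \<theta> u w (fst y)" "6 * norm w * (norm u)\<^sup>2" z] assms
  by (simp_all add: abs_inner_score_le abs_score_deriv_le abs_score_deriv2_le add.commute)

text \<open>Two from the derivative of the scores, four from the product of two score sums; the
  first part is linear in \<open>t + 1\<close> and is raised to the square.\<close>

lemma abs_grad_integrand1_le:
  assumes "length z = Suc t"
  shows "\<bar>grad_integrand1 \<theta> u w z\<bar> \<le> 6 * (real t + 1)\<^sup>2 * (norm w * norm u)"
  unfolding grad_integrand1_def
proof (rule abs_last_reward_mult_le)
  note b = abs_sum_list_score_le[OF assms]
  have "\<bar>(\<Sum>y\<leftarrow>z. score \<theta> y \<bullet> w) * (\<Sum>y\<leftarrow>z. score \<theta> y \<bullet> u)\<bar>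
      \<le> ((real t + 1) * (2 * norm w)) * ((real t + 1) * (2 * norm u))"
    unfolding abs_mult by (intro mult_mono b) auto
  also have "\<dots> = 4 * (real t + 1)\<^sup>2 * (norm w * norm u)" by (simp add: power2_eq_square)
  finally have 1: "\<bar>(\<Sum>y\<leftarrow>z. score \<theta> y \<bullet> w) * (\<Sum>y\<leftarrow>z. score \<theta> y \<bullet> u)\<bar> \<le> 4 * (real t + 1)\<^sup>2 * (norm w * norm u)" .
  have "(real t + 1) * (2 * norm w * norm u) \<le> (real t + 1)\<^sup>2 * (2 * norm w * norm u)"
    by (intro mult_right_mono) (auto simp: power2_eq_square)
  with b(2)[of \<theta> u w] 1
  show "\<bar>(\<Sum>y\<leftarrow>z. score_deriv \<theta> u w (fst y)) + (\<Sum>y\<leftarrow>z. score \<theta> y \<bullet> w) * (\<Sum>y\<leftarrow>z. score \<theta> y \<bullet> u)\<bar>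
      \<le> 6 * (real t + 1)\<^sup>2 * (norm w * norm u)"
    by (simp add: abs_le_iff algebra_simps)
qed

text \<open>26 = 6 + 4 + 4 + 12, the 12 coming from the likelihood-ratio factor on
  \<open>grad_integrand1\<close>. Lower powers of the length are raised to the cube.\<close>

lemma abs_grad_integrand2_le:
  assumes "length z = Suc t"
  shows "\<bar>grad_integrand2 \<theta> u w z\<bar> \<le> 26 * (real t + 1) ^ 3 * (norm w * (norm u)\<^sup>2)"
proof -
  note b = abs_sum_list_score_le[OF assms]
  define n where "n = real t + 1"
  define X where "X = norm w * (norm u)\<^sup>2"
  have X0: "X \<ge> 0" by (simp add: X_def)
  have n1: "n \<ge> 1" by (simp add: n_def)
  have n3: "n * X \<le> n ^ 3 * X" "n ^ 2 * X \<le> n ^ 3 * X"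
    using n1 X0 power_increasing[of 1 3 n] power_increasing[of 2 3 n] by (auto intro: mult_right_mono)
  define S2 S1 D where "S2 = (\<Sum>y\<leftarrow>z. score_deriv2 \<theta> u w (fst y))"
    and "S1 = (\<Sum>y\<leftarrow>z. score_deriv \<theta> u w (fst y)) * (\<Sum>y\<leftarrow>z. score \<theta> y \<bullet> u)"
    and "D = (\<Sum>y\<leftarrow>z. score \<theta> y \<bullet> w) * (\<Sum>y\<leftarrow>z. score_deriv \<theta> u u (fst y))"
  have s2: "\<bar>S2\<bar> \<le> 6 * (n * X)"
    unfolding S2_def using b(3)[of \<theta> u w] by (simp add: n_def X_def algebra_simps)
  have "\<bar>S1\<bar> \<le> (n * (2 * norm w * norm u)) * (n * (2 * norm u))"
    unfolding S1_def abs_mult n_def by (intro mult_mono b) auto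
  then have s1: "\<bar>S1\<bar> \<le> 4 * (n ^ 2 * X)" by (simp add: power2_eq_square X_def algebra_simps)
  have "\<bar>D\<bar> \<le> (n * (2 * norm w)) * (n * (2 * norm u * norm u))"
    unfolding D_def abs_mult n_def by (intro mult_mono b) auto
  then have d: "\<bar>D\<bar> \<le> 4 * (n ^ 2 * X)" by (simp add: power2_eq_square X_def algebra_simps)
  have "\<bar>S2 + (S1 + D)\<bar> \<le> 14 * (n ^ 3 * X)"
    using s2 s1 d n3 by linarith
  then have 1: "\<bar>last_reward r z * (S2 + (S1 + D))\<bar> \<le> 14 * (n ^ 3 * X)"
    by (rule abs_last_reward_mult_le)
  have "\<bar>grad_integrand1 \<theta> u w z * (\<Sum>y\<leftarrow>z. score \<theta> y \<bullet> u)\<bar> \<le> (6 * n\<^sup>2 * (norm w * norm u)) * (n * (2 * norm u))"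
    unfolding abs_mult n_def by (intro mult_mono b abs_grad_integrand1_le assms) auto
  also have "\<dots> = 12 * (n ^ 3 * X)" by (simp add: power2_eq_square power3_eq_cube X_def)
  finally show ?thesis
    using 1 unfolding grad_integrand2_def S2_def[symmetric] S1_def[symmetric] D_def[symmetric] n_def X_def by linarith
qed

lemma abs_stage_deriv1_le: "\<bar>stage_deriv1 t q \<theta> u w\<bar> \<le> 6 * (real t + 1)\<^sup>2 * (norm w * norm u)"
  unfolding stage_deriv1_def real_norm_def[symmetric]
  by (rule norm_expectation_mdp_trajectory_le) (simp add: abs_grad_integrand1_le)

lemma abs_stage_deriv2_le: "\<bar>stage_deriv2 t q \<theta> u w\<bar> \<le> 26 * (real t + 1) ^ 3 * (norm w * (norm u)\<^sup>2)"
  unfolding stage_deriv2_def real_norm_def[symmetric]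
  by (rule norm_expectation_mdp_trajectory_le) (simp add: abs_grad_integrand2_le)

lemma stage_reward_lower_bound:
  "stage_reward P r t q \<theta> + stage_grad P r t q \<theta> \<bullet> u - 3 * (real t + 1)\<^sup>2 * (norm u)\<^sup>2
     \<le> stage_reward P r t q (\<theta> + u)"
proof -
  \<comment> \<open>Packs the stage reward and its two derivatives along the line into the sequence
    of functions that \<open>Maclaurin\<close> expects.\<close>
  define f where "f = (\<lambda>m x. if m = 0 then stage_reward P r t q (\<theta> + x *\<^sub>R u)
    else if m = Suc 0 then stage_grad P r t q (\<theta> + x *\<^sub>R u) \<bullet> u
    else stage_deriv1 t q (\<theta> + x *\<^sub>R u) u u)"
  have "\<exists>x>0. x < 1 \<and> f 0 1 = (\<Sum>m<2. f m 0 / fact m * 1 ^ m) + f 2 x / fact 2 * 1 ^ 2"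
    by (rule Maclaurin) (auto simp: f_def less_2_cases_iff DERIV_stage_reward DERIV_stage_grad)
  then obtain x where x: "f 0 1 = f 0 0 + f (Suc 0) 0 + f 2 x / 2"
    by (auto simp: numeral_2_eq_2)
  have "\<bar>f 2 x\<bar> \<le> 6 * (real t + 1)\<^sup>2 * (norm u)\<^sup>2"
    using abs_stage_deriv1_le[of t q "\<theta> + x *\<^sub>R u" u u] by (simp add: f_def power2_eq_square)
  with x show ?thesis by (simp add: f_def)
qed

text \<open>The mean value theorem is scalar, so the difference is tested against itself and one
  factor \<open>norm w\<close> is cancelled at the end.\<close>

lemma stage_grad_lipschitz:
  "norm (stage_grad P r t q \<theta>' - stage_grad P r t q \<theta>) \<le> 6 * (real t + 1)\<^sup>2 * norm (\<theta>' - \<theta>)"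
proof -
  define u w where "u = \<theta>' - \<theta>" and "w = stage_grad P r t q \<theta>' - stage_grad P r t q \<theta>"
  have "\<exists>x>0. x < 1 \<and> stage_grad P r t q (\<theta> + 1 *\<^sub>R u) \<bullet> w - stage_grad P r t q (\<theta> + 0 *\<^sub>R u) \<bullet> w
      = (1 - 0) * stage_deriv1 t q (\<theta> + x *\<^sub>R u) u w"
    by (rule MVT2) (auto simp: DERIV_stage_grad)
  then obtain x where "w \<bullet> w = stage_deriv1 t q (\<theta> + x *\<^sub>R u) u w"
    by (auto simp: u_def w_def inner_diff_left)
  then have "norm w * norm w \<le> norm w * (6 * (real t + 1)\<^sup>2 * norm u)"
    using abs_stage_deriv1_le[of t q "\<theta> + x *\<^sub>R u" u w]
    by (simp add: dot_square_norm power2_eq_square mult_ac)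
  then show ?thesis
    unfolding u_def[symmetric] w_def[symmetric]
    by (cases "norm w = 0") (simp, metis mult_le_cancel_left_pos norm_ge_zero order_le_less)
qed

text \<open>13 is half of the 26 in \<open>abs_stage_deriv2_le\<close>, since the second derivative
  of the squared norm along \<open>u\<close> is twice \<open>u \<bullet> u\<close>.\<close>

lemma stage_grad_convex:
  "convex_on UNIV (\<lambda>\<theta>. stage_grad P r t q \<theta> \<bullet> w + 13 * (real t + 1) ^ 3 * norm w * (norm \<theta>)\<^sup>2)"
proof (rule convex_on_lines)
  fix \<theta> u :: "('s, 'a) param"
  define C where "C = 13 * (real t + 1) ^ 3 * norm w"
  have n: "(norm (\<theta> + x *\<^sub>R u))\<^sup>2 = \<theta> \<bullet> \<theta> + 2 * x * (\<theta> \<bullet> u) + x\<^sup>2 * (u \<bullet> u)" for x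
    unfolding power2_norm_eq_inner
    by (simp add: inner_add_left inner_add_right inner_commute power2_eq_square algebra_simps)
  show "convex_on UNIV (\<lambda>x. stage_grad P r t q (\<theta> + x *\<^sub>R u) \<bullet> w
      + 13 * (real t + 1) ^ 3 * norm w * (norm (\<theta> + x *\<^sub>R u))\<^sup>2)"
    unfolding n C_def[symmetric]
  proof (rule f''_ge0_imp_convex)
    fix x
    show "((\<lambda>x. stage_grad P r t q (\<theta> + x *\<^sub>R u) \<bullet> w + C * (\<theta> \<bullet> \<theta> + 2 * x * (\<theta> \<bullet> u) + x\<^sup>2 * (u \<bullet> u)))
        has_real_derivative stage_deriv1 t q (\<theta> + x *\<^sub>R u) u w + C * (2 * (\<theta> \<bullet> u) + 2 * x * (u \<bullet> u))) (at x)"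
      by (auto intro!: derivative_eq_intros DERIV_stage_grad)
    show "((\<lambda>x. stage_deriv1 t q (\<theta> + x *\<^sub>R u) u w + C * (2 * (\<theta> \<bullet> u) + 2 * x * (u \<bullet> u)))
        has_real_derivative stage_deriv2 t q (\<theta> + x *\<^sub>R u) u w + C * (2 * (u \<bullet> u))) (at x)"
      by (auto intro!: derivative_eq_intros DERIV_stage_deriv1)
    show "0 \<le> stage_deriv2 t q (\<theta> + x *\<^sub>R u) u w + C * (2 * (u \<bullet> u))"
      using abs_stage_deriv2_le[of t q "\<theta> + x *\<^sub>R u" u w]
      by (simp add: C_def dot_square_norm algebra_simps abs_le_iff)
  qed simp
qed

end

section \<open>Discounted gradients and the estimator\<close>

lemma expectation_finite:
  fixes f :: "'x \<Rightarrow> 'v::{banach, second_countable_topology}"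
  assumes "finite (set_pmf p)"
  shows "measure_pmf.expectation p f = (\<Sum>x\<in>set_pmf p. pmf p x *\<^sub>R f x)"
  using assms by (intro integral_measure_pmf) auto

definition pmf_mean :: "'v::euclidean_space pmf \<Rightarrow> 'v" where
  "pmf_mean p = measure_pmf.expectation p (\<lambda>x. x)"

definition pmf_var :: "'v::euclidean_space pmf \<Rightarrow> real" where
  "pmf_var p = measure_pmf.expectation p (\<lambda>x. (norm (x - pmf_mean p))\<^sup>2)"

text \<open>Bias-variance decomposition: the cross term vanishes because deviations from the mean
  average to zero. It also serves averages over agents, through the uniform law.\<close>

lemma expectation_dist_sq:
  fixes f :: "'x \<Rightarrow> 'v::euclidean_space"
  assumes "finite (set_pmf p)"
  shows "measure_pmf.expectation p (\<lambda>x. (norm (f x - y))\<^sup>2) =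
    measure_pmf.expectation p (\<lambda>x. (norm (f x - measure_pmf.expectation p f))\<^sup>2)
      + (norm (measure_pmf.expectation p f - y))\<^sup>2"
proof -
  let ?S = "set_pmf p" and ?m = "measure_pmf.expectation p f"
  have s1: "(\<Sum>x\<in>?S. pmf p x) = 1" using assms by (intro sum_pmf_eq_1) auto
  have m: "?m = (\<Sum>x\<in>?S. pmf p x *\<^sub>R f x)" by (rule expectation_finite[OF assms])
  have m': "(\<Sum>x\<in>?S. pmf p x * (f x \<bullet> v)) = ?m \<bullet> v" for v
    unfolding m by (simp add: inner_sum_left)
  have "(norm (f x - y))\<^sup>2 = (norm (f x - ?m))\<^sup>2 + 2 * ((f x - ?m) \<bullet> (?m - y)) + (norm (?m - y))\<^sup>2" for x
    unfolding power2_norm_eq_inner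
    by (simp add: inner_diff_left inner_diff_right inner_commute algebra_simps)
  then have "(\<Sum>x\<in>?S. pmf p x * (norm (f x - y))\<^sup>2) =
      (\<Sum>x\<in>?S. pmf p x * (norm (f x - ?m))\<^sup>2) + 2 * (\<Sum>x\<in>?S. pmf p x * ((f x - ?m) \<bullet> (?m - y)))
      + (\<Sum>x\<in>?S. pmf p x) * (norm (?m - y))\<^sup>2"
    by (simp add: distrib_left sum.distrib sum_distrib_left sum_distrib_right mult_ac)
  moreover have "(\<Sum>x\<in>?S. pmf p x * ((f x - ?m) \<bullet> (?m - y))) = 0"
    by (simp add: inner_diff_left right_diff_distrib sum_subtractf m' sum_distrib_right[symmetric] s1)
  ultimately show ?thesis
    by (simp add: expectation_finite[OF assms, where f = "\<lambda>x. (_ x :: real)"] s1)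
qed

lemma pmf_var_eq:
  assumes "finite (set_pmf p)"
  shows "measure_pmf.expectation p (\<lambda>x. (norm (x - y))\<^sup>2) = pmf_var p + (norm (pmf_mean p - y))\<^sup>2"
  using expectation_dist_sq[OF assms, of "\<lambda>x. x" y] by (simp add: pmf_var_def pmf_mean_def)

lemma pmf_var_nonneg: "0 \<le> pmf_var p"
  unfolding pmf_var_def by (rule Bochner_Integration.integral_nonneg) simp

lemma convex_on_weighted_sum:
  fixes f :: "'i \<Rightarrow> 'v::real_vector \<Rightarrow> real"
  assumes "\<And>i. i \<in> I \<Longrightarrow> 0 \<le> c i" "\<And>i. i \<in> I \<Longrightarrow> convex_on UNIV (f i)"
  shows "convex_on UNIV (\<lambda>x. \<Sum>i\<in>I. c i * f i x)"
  using assms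
  by (induction I rule: infinite_finite_induct)
     (auto intro!: convex_on_add convex_on_cmul simp: convex_on_const)

context softmax_mdp
begin

lemma trunc_grad_lipschitz:
  "norm (trunc_grad \<gamma> P r T q \<theta>' - trunc_grad \<gamma> P r T q \<theta>) \<le> 12 / (1 - \<gamma>) ^ 3 * norm (\<theta>' - \<theta>)"
proof -
  have "norm (trunc_grad \<gamma> P r T q \<theta>' - trunc_grad \<gamma> P r T q \<theta>) =
      norm (\<Sum>t<T. \<gamma> ^ t *\<^sub>R (stage_grad P r t q \<theta>' - stage_grad P r t q \<theta>))"
    by (simp add: trunc_grad_def sum_subtractf scaleR_diff_right)
  also have "\<dots> \<le> (\<Sum>t<T. \<gamma> ^ t * (6 * (real t + 1)\<^sup>2 * norm (\<theta>' - \<theta>)))"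
  proof (intro order_trans[OF norm_sum] sum_mono)
    fix t
    show "norm (\<gamma> ^ t *\<^sub>R (stage_grad P r t q \<theta>' - stage_grad P r t q \<theta>))
        \<le> \<gamma> ^ t * (6 * (real t + 1)\<^sup>2 * norm (\<theta>' - \<theta>))"
      using mult_left_mono[OF stage_grad_lipschitz[of t q \<theta>' \<theta>], of "\<gamma> ^ t"] gamma_pos by simp
  qed
  also have "\<dots> = 6 * (\<Sum>t<T. \<gamma> ^ t * (real t + 1)\<^sup>2) * norm (\<theta>' - \<theta>)"
    by (simp add: sum_distrib_left sum_distrib_right mult_ac)
  also have "\<dots> \<le> 6 * (2 / (1 - \<gamma>) ^ 3) * norm (\<theta>' - \<theta>)"
    by (intro mult_right_mono mult_left_mono sum_geometric_le gamma_pos gamma_less_1) auto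
  finally show ?thesis by simp
qed

lemma trunc_grad_convex:
  "convex_on UNIV (\<lambda>\<theta>. trunc_grad \<gamma> P r T q \<theta> \<bullet> w
     + 13 * (\<Sum>t<T. \<gamma> ^ t * (real t + 1) ^ 3) * norm w * (norm \<theta>)\<^sup>2)"
proof -
  have "convex_on UNIV (\<lambda>\<theta>. \<Sum>t<T. \<gamma> ^ t *
      (stage_grad P r t q \<theta> \<bullet> w + 13 * (real t + 1) ^ 3 * norm w * (norm \<theta>)\<^sup>2))"
    by (rule convex_on_weighted_sum) (use gamma_pos in \<open>auto intro: stage_grad_convex\<close>)
  also have "(\<lambda>\<theta>. \<Sum>t<T. \<gamma> ^ t * (stage_grad P r t q \<theta> \<bullet> w + 13 * (real t + 1) ^ 3 * norm w * (norm \<theta>)\<^sup>2)) =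
      (\<lambda>\<theta>. trunc_grad \<gamma> P r T q \<theta> \<bullet> w + 13 * (\<Sum>t<T. \<gamma> ^ t * (real t + 1) ^ 3) * norm w * (norm \<theta>)\<^sup>2)"
    by (simp add: trunc_grad_def inner_sum_left distrib_left sum.distrib sum_distrib_left sum_distrib_right mult_ac)
  finally show ?thesis .
qed

text \<open>Adding a multiple of \<open>(norm \<theta>)\<^sup>2\<close> makes every component of the gradient convex, and Jensen's
  inequality then bounds the bias by a multiple of the variance.\<close>

lemma trunc_grad_mean_bias:
  assumes fin: "finite (set_pmf p)"
  shows "norm (measure_pmf.expectation p (trunc_grad \<gamma> P r T q) - trunc_grad \<gamma> P r T q (pmf_mean p))
    \<le> 78 / (1 - \<gamma>) ^ 4 * pmf_var p"
proof -
  let ?G = "trunc_grad \<gamma> P r T q" and ?m = "pmf_mean p"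
  \<comment> \<open>The sign is chosen so that Jensen's inequality bounds
    \<open>w \<bullet> w\<close> from above.\<close>
  define w where "w = ?G ?m - measure_pmf.expectation p ?G"
  define C where "C = 13 * (\<Sum>t<T. \<gamma> ^ t * (real t + 1) ^ 3)"
  have C: "C \<le> 78 / (1 - \<gamma>) ^ 4"
    using sum_geometric_le(4)[OF gamma_pos gamma_less_1, of T] by (simp add: C_def)
  have E: "measure_pmf.expectation p (\<lambda>x. ?G x \<bullet> w + C * norm w * (norm x)\<^sup>2) =
      measure_pmf.expectation p ?G \<bullet> w + C * norm w * measure_pmf.expectation p (\<lambda>x. (norm x)\<^sup>2)"
    by (simp add: expectation_finite[OF fin] inner_sum_left sum.distrib distrib_left sum_distrib_left mult_ac)
  have "?G ?m \<bullet> w + C * norm w * (norm ?m)\<^sup>2 \<le> measure_pmf.expectation p (\<lambda>x. ?G x \<bullet> w + C * norm w * (norm x)\<^sup>2)"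
    unfolding pmf_mean_def C_def by (rule jensen_pmf_finite[OF trunc_grad_convex fin])
  moreover have "measure_pmf.expectation p (\<lambda>x. (norm x)\<^sup>2) = pmf_var p + (norm ?m)\<^sup>2"
    using pmf_var_eq[OF fin, of 0] by simp
  ultimately have "w \<bullet> w \<le> C * norm w * pmf_var p"
    unfolding E by (simp add: w_def inner_diff_left algebra_simps)
  then have "norm w * norm w \<le> norm w * (C * pmf_var p)"
    by (simp add: dot_square_norm power2_eq_square mult_ac)
  moreover have "norm w = 0 \<Longrightarrow> norm w \<le> C * pmf_var p"
    using gamma_pos by (auto simp: C_def pmf_var_nonneg intro!: mult_nonneg_nonneg sum_nonneg)
  ultimately have "norm w \<le> C * pmf_var p"
    by (metis mult_le_cancel_left_pos norm_ge_zero order_le_less)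
  also have "\<dots> \<le> 78 / (1 - \<gamma>) ^ 4 * pmf_var p"
    by (intro mult_right_mono C pmf_var_nonneg)
  finally show ?thesis by (simp add: w_def norm_minus_commute)
qed

lemma stage_grad_term_le: "norm (\<gamma> ^ t *\<^sub>R stage_grad P r t q \<theta>) \<le> 2 * (\<gamma> ^ t * (real t + 1))"
  using mult_left_mono[OF norm_stage_grad_le[of t q \<theta>], of "\<gamma> ^ t"] gamma_pos by simp

lemma summable_stage_grad: "summable (\<lambda>t. \<gamma> ^ t *\<^sub>R stage_grad P r t q \<theta>)"
proof (rule norm_suminf_weighted_le(1)[OF stage_grad_term_le])
  show "(\<Sum>t<N. 2 * (\<gamma> ^ t * (real t + 1))) \<le> 2 * (1 / (1 - \<gamma>) ^ 2)" for N
    unfolding sum_distrib_left[symmetric]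
    by (intro mult_left_mono sum_geometric_le gamma_pos gamma_less_1) simp
qed

text \<open>The tail starts at stage \<open>T\<close>; writing its trajectory length
  \<open>t + T + 1\<close> as \<open>T + (t + 1)\<close> yields the two summands of the
  bound.\<close>

lemma policy_grad_bias:
  "norm (trunc_grad \<gamma> P r T q \<theta> - policy_grad \<gamma> P r q \<theta>) \<le> 2 * \<gamma> ^ T / (1 - \<gamma>) * (real T + 1 / (1 - \<gamma>))"
proof -
  have "policy_grad \<gamma> P r q \<theta> - trunc_grad \<gamma> P r T q \<theta> =
      (\<Sum>t. \<gamma> ^ (t + T) *\<^sub>R stage_grad P r (t + T) q \<theta>)"
    unfolding policy_grad_def trunc_grad_def
    by (rule suminf_minus_initial_segment[OF summable_stage_grad, symmetric])
  also have "norm \<dots> \<le> 2 * \<gamma> ^ T / (1 - \<gamma>) * (real T + 1 / (1 - \<gamma>))"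
  proof (rule norm_suminf_weighted_le(2))
    show "norm (\<gamma> ^ (t + T) *\<^sub>R stage_grad P r (t + T) q \<theta>)
        \<le> 2 * \<gamma> ^ T * (real T * \<gamma> ^ t + \<gamma> ^ t * (real t + 1))" for t
      using stage_grad_term_le[of "t + T" q \<theta>] by (simp add: power_add algebra_simps)
  next
    fix N
    have "(\<Sum>t<N. 2 * \<gamma> ^ T * (real T * \<gamma> ^ t + \<gamma> ^ t * (real t + 1))) =
        2 * \<gamma> ^ T * (real T * (\<Sum>t<N. \<gamma> ^ t) + (\<Sum>t<N. \<gamma> ^ t * (real t + 1)))"
      by (simp only: sum_distrib_left[symmetric] sum.distrib)
    also have "\<dots> \<le> 2 * \<gamma> ^ T * (real T * (1 / (1 - \<gamma>)) + 1 / (1 - \<gamma>) ^ 2)"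
      using gamma_pos
      by (intro mult_left_mono add_mono sum_geometric_le gamma_pos gamma_less_1) auto
    also have "\<dots> = 2 * \<gamma> ^ T / (1 - \<gamma>) * (real T + 1 / (1 - \<gamma>))"
    proof -
      have "c * (x * (1 / d) + 1 / d\<^sup>2) = c / d * (x + 1 / d)" for c x d :: real
        by (cases "d = 0") (simp_all add: field_simps power2_eq_square)
      then show ?thesis .
    qed
    finally show "(\<Sum>t<N. 2 * \<gamma> ^ T * (real T * \<gamma> ^ t + \<gamma> ^ t * (real t + 1)))
        \<le> 2 * \<gamma> ^ T / (1 - \<gamma>) * (real T + 1 / (1 - \<gamma>))" .
  qed
  finally show ?thesis by (simp add: norm_minus_commute)
qed

section \<open>Series form and quadratic lower bound of the objective\<close>

lemma stage_reward_term_le: "norm (\<gamma> ^ t * stage_reward P r t q \<theta>) \<le> \<gamma> ^ t"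
  using mult_left_mono[OF abs_stage_reward_le[of t q \<theta>], of "\<gamma> ^ t"] gamma_pos by (simp add: abs_mult)

lemma summable_stage_reward: "summable (\<lambda>t. \<gamma> ^ t * stage_reward P r t q \<theta>)"
  using sum_geometric_le(1)[OF gamma_pos gamma_less_1]
  by (rule norm_suminf_weighted_le(1)[OF stage_reward_term_le])

lemma abs_discounted_value_le: "\<bar>discounted_value \<gamma> P r q \<theta>\<bar> \<le> 1 / (1 - \<gamma>)"
  unfolding discounted_value_def real_norm_def[symmetric]
  by (rule norm_suminf_weighted_le(2)[OF stage_reward_term_le sum_geometric_le(1)[OF gamma_pos gamma_less_1]])

text \<open>The stage bounds are added up. The constant is 3 times the factor 2 in the sum of
  quadratic weights, half the constant of \<open>trunc_grad_lipschitz\<close>.\<close>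

lemma discounted_value_lower_bound:
  "discounted_value \<gamma> P r q \<theta> + policy_grad \<gamma> P r q \<theta> \<bullet> u - 6 / (1 - \<gamma>) ^ 3 * (norm u)\<^sup>2
     \<le> discounted_value \<gamma> P r q (\<theta> + u)"
proof -
  let ?b = "\<lambda>t. 3 * (norm u)\<^sup>2 * (\<gamma> ^ t * (real t + 1)\<^sup>2)"
  have bound: "(\<Sum>t<N. ?b t) \<le> 6 / (1 - \<gamma>) ^ 3 * (norm u)\<^sup>2" for N
  proof -
    have "(\<Sum>t<N. ?b t) \<le> 3 * (norm u)\<^sup>2 * (2 / (1 - \<gamma>) ^ 3)"
      unfolding sum_distrib_left[symmetric]
      by (intro mult_left_mono sum_geometric_le gamma_pos gamma_less_1) auto
    then show ?thesis by simp
  qed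
  have sb: "summable ?b"
    by (rule summableI_nonneg_bounded[OF _ bound]) (use gamma_pos in auto)
  have sg: "(\<lambda>t. \<gamma> ^ t * (stage_grad P r t q \<theta> \<bullet> u)) sums (policy_grad \<gamma> P r q \<theta> \<bullet> u)"
    using bounded_linear.sums[OF bounded_linear_inner_left summable_sums[OF summable_stage_grad], of q \<theta> u]
    by (simp add: policy_grad_def)
  have sr: "(\<lambda>t. \<gamma> ^ t * stage_reward P r t q \<theta>') sums discounted_value \<gamma> P r q \<theta>'" for \<theta>'
    unfolding discounted_value_def by (rule summable_sums[OF summable_stage_reward])
  have "discounted_value \<gamma> P r q \<theta> + policy_grad \<gamma> P r q \<theta> \<bullet> u - suminf ?b \<le> discounted_value \<gamma> P r q (\<theta> + u)"
  proof (rule sums_le[OF _ sums_diff[OF sums_add[OF sr sg] summable_sums[OF sb]] sr])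
    fix t
    show "\<gamma> ^ t * stage_reward P r t q \<theta> + \<gamma> ^ t * (stage_grad P r t q \<theta> \<bullet> u) - ?b t
        \<le> \<gamma> ^ t * stage_reward P r t q (\<theta> + u)"
      using mult_left_mono[OF stage_reward_lower_bound[of t q \<theta> u], of "\<gamma> ^ t"] gamma_pos
      by (simp add: algebra_simps)
  qed
  moreover have "suminf ?b \<le> 6 / (1 - \<gamma>) ^ 3 * (norm u)\<^sup>2"
    by (rule suminf_le_const[OF sb bound])
  ultimately show ?thesis by linarith
qed

text \<open>A geometric majorant allows the exchange of integral and series; each term then depends
  on one coordinate, whose law is that of the last entry of a prefix.\<close>

lemma expected_return_eq:
  "expected_return \<gamma> P r q \<pi> =
     (\<Sum>t. \<gamma> ^ t * measure_pmf.expectation (mdp_trajectory (Suc t) P q \<pi>) (last_reward r))"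
proof -
  let ?M = "mdp_process P q \<pi>" and ?f = "\<lambda>t \<omega>. \<gamma> ^ t * r (fst (\<omega> t)) (snd (\<omega> t))"
  have b: "\<bar>\<gamma> ^ t * r s a\<bar> \<le> \<gamma> ^ t" for t s a
    using reward_nonneg reward_le_1 gamma_pos by (simp add: abs_mult mult_left_le)
  have sum_g: "summable (\<lambda>t. \<gamma> ^ t)" using gamma_pos gamma_less_1 by (intro summable_geometric) simp
  have int: "integrable ?M (?f t)" for t
    unfolding mdp_process_def by (rule integrable_markov_chain_component[where C = "\<gamma> ^ t"]) (rule b)
  have ret: "expected_return \<gamma> P r q \<pi> = (\<Sum>t. \<integral>\<omega>. ?f t \<omega> \<partial>?M)"
    unfolding expected_return_def
  proof (rule integral_suminf[OF int])
    show "AE \<omega> in ?M. summable (\<lambda>t. norm (?f t \<omega>))"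
      using b by (intro AE_I2 summable_comparison_test'[OF sum_g]) simp
    interpret prob_space ?M unfolding mdp_process_def by (rule prob_space_markov_chain)
    show "summable (\<lambda>t. \<integral>\<omega>. norm (?f t \<omega>) \<partial>?M)"
    proof (rule summable_comparison_test'[OF sum_g])
      fix t
      have "(\<integral>\<omega>. norm (?f t \<omega>) \<partial>?M) \<le> (\<integral>\<omega>. \<gamma> ^ t \<partial>?M)"
        using b by (intro integral_mono integrable_norm int) auto
      then show "norm (\<integral>\<omega>. norm (?f t \<omega>) \<partial>?M) \<le> \<gamma> ^ t" by (simp add: prob_space)
    qed
  qed
  have "(\<integral>\<omega>. ?f t \<omega> \<partial>?M) = \<gamma> ^ t * measure_pmf.expectation (mdp_trajectory (Suc t) P q \<pi>) (last_reward r)" for t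
  proof -
    have "(\<integral>\<omega>. ?f t \<omega> \<partial>?M) = measure_pmf.expectation
        (map_pmf last (mdp_trajectory (Suc t) P q \<pi>)) (\<lambda>y. \<gamma> ^ t * r (fst y) (snd y))"
      unfolding mdp_process_def mdp_trajectory_def map_last_chain_prefix
      by (rule integral_markov_chain_component)
    then show ?thesis by (simp add: last_reward_def[abs_def])
  qed
  then show ?thesis by (simp only: ret)
qed

lemma expected_return_softmax: "expected_return \<gamma> P r q (softmax \<theta>) = discounted_value \<gamma> P r q \<theta>"
  by (simp only: expected_return_eq discounted_value_def stage_reward_def)

end

definition traj_grad ::
    "real \<Rightarrow> ('s::finite \<Rightarrow> 'a::finite \<Rightarrow> real) \<Rightarrow> nat \<Rightarrow> ('s \<times> 'a) list \<Rightarrow> ('s, 'a) param \<Rightarrow> ('s, 'a) param" where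
  "traj_grad \<gamma> r T z \<theta> =
     (\<Sum>t<T. (\<gamma> ^ t * r (fst (z ! t)) (snd (z ! t))) *\<^sub>R (\<Sum>l\<le>t. score \<theta> (z ! l)))"

text \<open>In this form the summand of index \<open>t\<close> is a function of the prefix of length
  \<open>t + 1\<close> alone, namely the integrand of \<open>stage_grad\<close>.\<close>

lemma traj_grad_eq:
  assumes "length z = T"
  shows "traj_grad \<gamma> r T z \<theta> =
    (\<Sum>t<T. \<gamma> ^ t *\<^sub>R (last_reward r (take (Suc t) z) *\<^sub>R (\<Sum>y\<leftarrow>take (Suc t) z. score \<theta> y)))"
  unfolding traj_grad_def
proof (rule sum.cong[OF refl])
  fix t assume "t \<in> {..<T}"
  then have t: "t < length z" using assms by simp
  have "last (take (Suc t) z) = z ! t" using t by (simp add: take_Suc_conv_app_nth)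
  moreover have "(\<Sum>y\<leftarrow>take (Suc t) z. score \<theta> y) = (\<Sum>l\<le>t. score \<theta> (z ! l))"
  proof -
    have "length (take (Suc t) z) = Suc t" using t by simp
    then show ?thesis
      unfolding sum_list_sum_nth by (simp add: atLeast0LessThan lessThan_Suc_atMost del: length_take)
  qed
  ultimately show "(\<gamma> ^ t * r (fst (z ! t)) (snd (z ! t))) *\<^sub>R (\<Sum>l\<le>t. score \<theta> (z ! l)) =
      \<gamma> ^ t *\<^sub>R (last_reward r (take (Suc t) z) *\<^sub>R (\<Sum>y\<leftarrow>take (Suc t) z. score \<theta> y))"
    by (simp add: last_reward_def)
qed

context softmax_mdp
begin

lemma norm_traj_grad_le: "norm (traj_grad \<gamma> r T z \<theta>) \<le> 2 / (1 - \<gamma>)\<^sup>2"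
proof -
  have "norm (traj_grad \<gamma> r T z \<theta>) \<le> (\<Sum>t<T. 2 * (\<gamma> ^ t * (real t + 1)))"
    unfolding traj_grad_def
  proof (intro order_trans[OF norm_sum] sum_mono)
    fix t
    have "norm (\<Sum>l\<le>t. score \<theta> (z ! l)) \<le> (\<Sum>l\<le>t. 2)"
      by (intro order_trans[OF norm_sum] sum_mono norm_score_le)
    moreover have "\<bar>\<gamma> ^ t * r (fst (z ! t)) (snd (z ! t))\<bar> \<le> \<gamma> ^ t"
      using reward_nonneg reward_le_1 gamma_pos by (simp add: abs_mult mult_left_le)
    ultimately have "\<bar>\<gamma> ^ t * r (fst (z ! t)) (snd (z ! t))\<bar> * norm (\<Sum>l\<le>t. score \<theta> (z ! l)) \<le> \<gamma> ^ t * (2 * (real t + 1))"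
      by (intro mult_mono) (use gamma_pos in auto)
    then show "norm ((\<gamma> ^ t * r (fst (z ! t)) (snd (z ! t))) *\<^sub>R (\<Sum>l\<le>t. score \<theta> (z ! l))) \<le> 2 * (\<gamma> ^ t * (real t + 1))"
      by (simp add: algebra_simps)
  qed
  also have "\<dots> \<le> 2 * (1 / (1 - \<gamma>)\<^sup>2)"
    unfolding sum_distrib_left[symmetric]
    by (intro mult_left_mono sum_geometric_le gamma_pos gamma_less_1) auto
  finally show ?thesis by simp
qed

text \<open>By \<open>map_take_chain_prefix\<close> a prefix is distributed as a trajectory of its
  own length, so each summand averages to a stage gradient. Against \<open>policy_grad\<close>, only
  the tail beyond \<open>T\<close> is lost.\<close>

lemma expectation_traj_grad:
  "measure_pmf.expectation (mdp_trajectory T P q (softmax \<theta>)) (\<lambda>z. traj_grad \<gamma> r T z \<theta>) = trunc_grad \<gamma> P r T q \<theta>"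
proof -
  let ?D = "mdp_trajectory T P q (softmax \<theta>)" and ?h = "\<lambda>z. last_reward r z *\<^sub>R (\<Sum>y\<leftarrow>z. score \<theta> y)"
  have "measure_pmf.expectation ?D (\<lambda>z. traj_grad \<gamma> r T z \<theta>) =
      (\<Sum>z | length z = T. pmf ?D z *\<^sub>R (\<Sum>t<T. \<gamma> ^ t *\<^sub>R ?h (take (Suc t) z)))"
    unfolding expectation_mdp_trajectory by (intro sum.cong refl) (simp add: traj_grad_eq)
  also have "\<dots> = (\<Sum>t<T. \<gamma> ^ t *\<^sub>R measure_pmf.expectation ?D (\<lambda>z. ?h (take (Suc t) z)))"
    unfolding expectation_mdp_trajectory scaleR_sum_right
    by (subst sum.swap) (simp add: mult_ac)
  also have "\<dots> = (\<Sum>t<T. \<gamma> ^ t *\<^sub>R stage_grad P r t q \<theta>)"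
  proof (intro sum.cong refl arg_cong2[where f = scaleR])
    fix t assume "t \<in> {..<T}"
    then have "map_pmf (take (Suc t)) ?D = mdp_trajectory (Suc t) P q (softmax \<theta>)"
      unfolding mdp_trajectory_def by (intro map_take_chain_prefix) auto
    then show "measure_pmf.expectation ?D (\<lambda>z. ?h (take (Suc t) z)) = stage_grad P r t q \<theta>"
      unfolding stage_grad_def by (simp only: integral_map_pmf flip: \<open>map_pmf (take (Suc t)) ?D = _\<close>)
  qed
  finally show ?thesis by (simp add: trunc_grad_def)
qed

end

section \<open>Occupancies and the policy gradient theorem\<close>

abbreviation state_law :: "nat \<Rightarrow> ('s \<Rightarrow> 'a \<Rightarrow> 's pmf) \<Rightarrow> 's pmf \<Rightarrow> ('s \<Rightarrow> 'a pmf) \<Rightarrow> 's pmf" where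
  "state_law t P q \<pi> \<equiv> chain_marginal t q (\<lambda>s. bind_pmf (\<pi> s) (P s))"

text \<open>The states form a Markov chain by themselves, with the kernel averaged over the policy;
  occupancies can be computed from it.\<close>

lemma chain_marginal_state_action:
  "chain_marginal t (state_action q \<pi>) (\<lambda>(s, a). state_action (P s a) \<pi>) = state_action (state_law t P q \<pi>) \<pi>"
  by (induction t)
     (simp_all add: state_action_def map_pmf_def bind_assoc_pmf bind_return_pmf)

lemma map_fst_state_action: "map_pmf fst (state_action q \<pi>) = q"
  by (simp add: state_action_def map_bind_pmf pmf.map_comp o_def map_pmf_const bind_return_pmf')

lemma occupancy_eq:
  "occupancy \<gamma> P q \<pi> s = (1 - \<gamma>) * (\<Sum>t. \<gamma> ^ t * pmf (state_law t P q \<pi>) s)"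
proof -
  have "\<P>(\<omega> in mdp_process P q \<pi>. fst (\<omega> t) = s) = pmf (state_law t P q \<pi>) s" for t
  proof -
    let ?M = "mdp_process P q \<pi>" and ?S = "state_action (state_law t P q \<pi>) \<pi>"
    have m: "(\<lambda>\<omega>. \<omega> t) \<in> measurable ?M (count_space UNIV)"
      unfolding mdp_process_def by (rule measurable_markov_chain_component)
    have d: "distr ?M (count_space UNIV) (\<lambda>\<omega>. \<omega> t) = measure_pmf ?S"
      unfolding mdp_process_def by (simp only: distr_markov_chain_component chain_marginal_state_action)
    have "\<P>(\<omega> in ?M. fst (\<omega> t) = s) = measure (distr ?M (count_space UNIV) (\<lambda>\<omega>. \<omega> t)) (fst -` {s})"
      using m by (subst measure_distr) (auto simp: vimage_def Int_def conj_commute)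
    also have "\<dots> = measure (measure_pmf (map_pmf fst ?S)) {s}"
      by (simp only: d measure_map_pmf)
    finally show ?thesis
      by (simp only: map_fst_state_action measure_pmf_single)
  qed
  then show ?thesis by (simp only: occupancy_def)
qed

lemma pmf_bind_finite:
  fixes p :: "'x::finite pmf"
  shows "pmf (bind_pmf p f) y = (\<Sum>x\<in>UNIV. pmf p x * pmf (f x) y)"
  by (simp add: pmf_bind integral_measure_pmf_real[of UNIV] mult.commute)

lemma sum_bind_finite:
  fixes p :: "'x::finite pmf" and f :: "'x \<Rightarrow> 'y::finite pmf" and g :: "'y \<Rightarrow> real"
  shows "(\<Sum>y\<in>UNIV. pmf (bind_pmf p f) y * g y) = (\<Sum>x\<in>UNIV. pmf p x * (\<Sum>y\<in>UNIV. pmf (f x) y * g y))"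
proof -
  have "(\<Sum>y\<in>UNIV. pmf (bind_pmf p f) y * g y) = (\<Sum>y\<in>UNIV. \<Sum>x\<in>UNIV. pmf p x * (pmf (f x) y * g y))"
    by (simp add: pmf_bind_finite sum_distrib_right mult.assoc)
  also have "\<dots> = (\<Sum>x\<in>UNIV. \<Sum>y\<in>UNIV. pmf p x * (pmf (f x) y * g y))" by (rule sum.swap)
  finally show ?thesis by (simp add: sum_distrib_left)
qed

lemma sum_return_finite:
  fixes g :: "'x::finite \<Rightarrow> real"
  shows "(\<Sum>y\<in>UNIV. pmf (return_pmf x) y * g y) = g x"
proof -
  have "(\<Sum>y\<in>UNIV. pmf (return_pmf x) y * g y) = (\<Sum>y\<in>UNIV. if y = x then g y else 0)"
    by (intro sum.cong) (auto simp: indicator_def)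
  then show ?thesis by simp
qed

lemma expectation_mdp_trajectory_Cons:
  fixes P :: "'s::finite \<Rightarrow> 'a::finite \<Rightarrow> 's pmf" and f :: "_ \<Rightarrow> real"
  shows "measure_pmf.expectation (mdp_trajectory (Suc n) P q \<pi>) f =
    (\<Sum>s\<in>UNIV. pmf q s * (\<Sum>a\<in>UNIV. pmf (\<pi> s) a *
       measure_pmf.expectation (mdp_trajectory n P (P s a) \<pi>) (\<lambda>z. f ((s, a) # z))))"
  unfolding expectation_mdp_trajectory real_scaleR_def sum_lists_length_Suc pmf_mdp_trajectory_Cons
  by (simp add: sum_distrib_left mult.assoc)

text \<open>The common core of the performance difference and policy gradient formulas: the solution
  of a Bellman equation is an occupancy average of its cost \<open>c\<close>. The equation itself
  makes \<open>F\<close> linear in \<open>q\<close>, hence bounded as there are finitely many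
  states, so the remainder of the unrolled recursion vanishes.\<close>

lemma occupancy_unroll:
  fixes F :: "'s::finite pmf \<Rightarrow> real" and c :: "'s \<Rightarrow> 'a::finite \<Rightarrow> real"
  assumes g: "0 < \<gamma>" "\<gamma> < 1"
    and F: "\<And>q. F q = (\<Sum>s\<in>UNIV. pmf q s * (\<Sum>a\<in>UNIV. pmf (\<pi> s) a * (c s a + \<gamma> * F (P s a))))"
  shows "(1 - \<gamma>) * F q = (\<Sum>s\<in>UNIV. occupancy \<gamma> P q \<pi> s * (\<Sum>a\<in>UNIV. pmf (\<pi> s) a * c s a))"
proof -
  define X where "X s = F (return_pmf s)" for s
  define b where "b s = (\<Sum>a\<in>UNIV. pmf (\<pi> s) a * c s a)" for s
  let ?k = "\<lambda>s. bind_pmf (\<pi> s) (P s)"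
  have X': "X s = (\<Sum>a\<in>UNIV. pmf (\<pi> s) a * (c s a + \<gamma> * F (P s a)))" for s
    unfolding X_def by (subst F) (rule sum_return_finite)
  have FX: "F q = (\<Sum>s\<in>UNIV. pmf q s * X s)" for q
    unfolding X' by (rule F)
  have X: "X s = b s + \<gamma> * (\<Sum>s'\<in>UNIV. pmf (?k s) s' * X s')" for s
  proof -
    have "(\<Sum>s'\<in>UNIV. pmf (?k s) s' * X s') = (\<Sum>a\<in>UNIV. pmf (\<pi> s) a * F (P s a))"
      by (simp only: sum_bind_finite FX[of "P s _"])
    then show ?thesis
      unfolding X'[of s] b_def by (simp add: distrib_left sum.distrib sum_distrib_left mult_ac)
  qed
  define e where "e t f = (\<Sum>s\<in>UNIV. pmf (state_law t P q \<pi>) s * f s)" for t and f :: "'s \<Rightarrow> real"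
  have eX: "e t X = e t b + \<gamma> * e (Suc t) X" for t
  proof -
    have "e t X = (\<Sum>s\<in>UNIV. pmf (state_law t P q \<pi>) s * (b s + \<gamma> * (\<Sum>s'\<in>UNIV. pmf (?k s) s' * X s')))"
      unfolding e_def by (intro sum.cong refl arg_cong2[where f = "(*)"] X)
    also have "\<dots> = e t b + \<gamma> * (\<Sum>s\<in>UNIV. pmf (state_law t P q \<pi>) s * (\<Sum>s'\<in>UNIV. pmf (?k s) s' * X s'))"
      unfolding e_def by (simp add: distrib_left sum.distrib sum_distrib_left mult_ac)
    also have "(\<Sum>s\<in>UNIV. pmf (state_law t P q \<pi>) s * (\<Sum>s'\<in>UNIV. pmf (?k s) s' * X s')) = e (Suc t) X"
      unfolding e_def chain_marginal.simps by (rule sum_bind_finite[symmetric])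
    finally show ?thesis .
  qed
  have partial: "(\<Sum>t<N. \<gamma> ^ t * e t b) = F q - \<gamma> ^ N * e N X" for N
  proof (induction N)
    case 0
    show ?case by (simp add: e_def FX)
  next
    case (Suc N)
    then show ?case using eX[of N] by (simp add: algebra_simps)
  qed
  have "(\<lambda>N. \<gamma> ^ N * e N X) \<longlonglongrightarrow> 0"
  proof (rule Lim_null_comparison)
    define C where "C = (\<Sum>s\<in>UNIV. \<bar>X s\<bar>)"
    have "\<bar>e N X\<bar> \<le> C" for N
      unfolding e_def by (rule abs_pmf_sum_le) (auto simp: C_def intro: member_le_sum)
    then show "\<forall>\<^sub>F N in sequentially. norm (\<gamma> ^ N * e N X) \<le> \<gamma> ^ N * C"
      using g by (intro always_eventually allI) (simp add: abs_mult mult_left_mono)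
    show "(\<lambda>N. \<gamma> ^ N * C) \<longlonglongrightarrow> 0"
      using g by (intro tendsto_mult_left_zero LIMSEQ_realpow_zero) auto
  qed
  then have "(\<lambda>N. F q - \<gamma> ^ N * e N X) \<longlonglongrightarrow> F q - 0" by (intro tendsto_diff tendsto_const)
  then have S: "(\<lambda>t. \<gamma> ^ t * e t b) sums F q"
    unfolding sums_def partial by simp
  have sm: "summable (\<lambda>t. \<gamma> ^ t * pmf (state_law t P q \<pi>) s)" for s
    using g by (intro summable_comparison_test'[OF summable_geometric[of \<gamma>]])
       (auto simp: abs_mult pmf_le_1 mult_left_le)
  have "(\<lambda>t. \<Sum>s\<in>UNIV. b s * (\<gamma> ^ t * pmf (state_law t P q \<pi>) s)) sums
      (\<Sum>s\<in>UNIV. b s * (\<Sum>t. \<gamma> ^ t * pmf (state_law t P q \<pi>) s))"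
    by (intro sums_sum sums_mult summable_sums sm)
  also have "(\<lambda>t. \<Sum>s\<in>UNIV. b s * (\<gamma> ^ t * pmf (state_law t P q \<pi>) s)) = (\<lambda>t. \<gamma> ^ t * e t b)"
    by (simp add: e_def sum_distrib_left mult_ac)
  finally have "F q = (\<Sum>s\<in>UNIV. b s * (\<Sum>t. \<gamma> ^ t * pmf (state_law t P q \<pi>) s))"
    using S sums_unique2 by blast
  then show ?thesis
    unfolding occupancy_eq b_def[symmetric] by (simp add: sum_distrib_left mult_ac)
qed

text \<open>Passes from a recursion between stages to a Bellman equation for their discounted sum.
  \<open>D\<close> collects what the first step contributes to later stages: nothing for returns,
  the first score times a later reward for gradients.\<close>

lemma discounted_sum_unroll:
  fixes F :: "nat \<Rightarrow> 's::finite pmf \<Rightarrow> real" and c0 :: "'s \<Rightarrow> 'a::finite \<Rightarrow> real"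
  assumes F0: "\<And>q. F 0 q = (\<Sum>s\<in>UNIV. pmf q s * (\<Sum>a\<in>UNIV. pmf (\<pi> s) a * c0 s a))"
    and FS: "\<And>t q. F (Suc t) q = (\<Sum>s\<in>UNIV. pmf q s * (\<Sum>a\<in>UNIV. pmf (\<pi> s) a * (D t s a + F t (P s a))))"
    and D: "\<And>s a. (\<lambda>t. \<gamma> ^ t * D t s a) sums d s a"
    and f: "\<And>q. (\<lambda>t. \<gamma> ^ t * F t q) sums f q"
  shows "f q = (\<Sum>s\<in>UNIV. pmf q s * (\<Sum>a\<in>UNIV. pmf (\<pi> s) a * (c0 s a + \<gamma> * d s a + \<gamma> * f (P s a))))"
proof -
  have "(\<lambda>t. \<Sum>s\<in>UNIV. pmf q s * (\<Sum>a\<in>UNIV. pmf (\<pi> s) a * (\<gamma> * (\<gamma> ^ t * D t s a + \<gamma> ^ t * F t (P s a))))) sums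
      (\<Sum>s\<in>UNIV. pmf q s * (\<Sum>a\<in>UNIV. pmf (\<pi> s) a * (\<gamma> * (d s a + f (P s a)))))"
    by (intro sums_sum sums_mult sums_add D f)
  also have "(\<lambda>t. \<Sum>s\<in>UNIV. pmf q s * (\<Sum>a\<in>UNIV. pmf (\<pi> s) a * (\<gamma> * (\<gamma> ^ t * D t s a + \<gamma> ^ t * F t (P s a))))) =
      (\<lambda>t. \<gamma> ^ Suc t * F (Suc t) q)"
    by (simp add: FS sum_distrib_left algebra_simps)
  finally have "(\<lambda>t. \<gamma> ^ t * F t q) sums
      ((\<Sum>s\<in>UNIV. pmf q s * (\<Sum>a\<in>UNIV. pmf (\<pi> s) a * (\<gamma> * (d s a + f (P s a))))) + \<gamma> ^ 0 * F 0 q)"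
    by (rule sums_Suc)
  from sums_unique2[OF f this] show ?thesis
    by (simp add: F0 sum.distrib distrib_left add_ac)
qed

context softmax_mdp
begin

abbreviation (input) ret :: "('s \<Rightarrow> 'a pmf) \<Rightarrow> 's pmf \<Rightarrow> real" where
  "ret \<pi> q \<equiv> expected_return \<gamma> P r q \<pi>"

definition action_value :: "('s \<Rightarrow> 'a pmf) \<Rightarrow> 's \<Rightarrow> 'a \<Rightarrow> real" where
  "action_value \<pi> s a = r s a + \<gamma> * ret \<pi> (P s a)"

lemma last_reward_singleton: "last_reward r [(s, a)] = r s a"
  by (simp add: last_reward_def)

lemma last_reward_Cons: "length z = Suc n \<Longrightarrow> last_reward r (y # z) = last_reward r z"
  by (cases z) (auto simp: last_reward_def)

lemma expectation_mdp_trajectory_0: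
  "measure_pmf.expectation (mdp_trajectory 0 P q \<pi>) (f :: _ \<Rightarrow> real) = f []"
  by (simp add: mdp_trajectory_def)

lemma expectation_mdp_trajectory_cong:
  fixes f g :: "('s \<times> 'a) list \<Rightarrow> real"
  assumes "\<And>z. length z = n \<Longrightarrow> f z = g z"
  shows "measure_pmf.expectation (mdp_trajectory n P q \<pi>) f = measure_pmf.expectation (mdp_trajectory n P q \<pi>) g"
  unfolding expectation_mdp_trajectory using assms by (intro sum.cong) auto

lemma sums_expected_return:
  "(\<lambda>t. \<gamma> ^ t * measure_pmf.expectation (mdp_trajectory (Suc t) P q \<pi>) (last_reward r)) sums ret \<pi> q"
proof -
  have "norm (\<gamma> ^ t * measure_pmf.expectation (mdp_trajectory (Suc t) P q \<pi>) (last_reward r)) \<le> \<gamma> ^ t" for t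
    using mult_left_mono[OF norm_expectation_mdp_trajectory_le[of "Suc t" "last_reward r" 1 P q \<pi>], of "\<gamma> ^ t"]
      gamma_pos abs_last_reward_le by (simp add: abs_mult)
  from norm_suminf_weighted_le(1)[OF this sum_geometric_le(1)[OF gamma_pos gamma_less_1]]
  show ?thesis unfolding expected_return_eq by (rule summable_sums)
qed

lemma expected_return_unroll:
  "ret \<pi> q = (\<Sum>s\<in>UNIV. pmf q s * (\<Sum>a\<in>UNIV. pmf (\<pi> s) a * action_value \<pi> s a))"
proof -
  have "ret \<pi> q = (\<Sum>s\<in>UNIV. pmf q s * (\<Sum>a\<in>UNIV. pmf (\<pi> s) a * (r s a + \<gamma> * 0 + \<gamma> * ret \<pi> (P s a))))"
  proof (rule discounted_sum_unroll[where D = "\<lambda>_ _ _. 0" and \<gamma> = \<gamma> and f = "ret \<pi>",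
        OF _ _ _ sums_expected_return])
    show "measure_pmf.expectation (mdp_trajectory (Suc 0) P q \<pi>) (last_reward r) =
        (\<Sum>s\<in>UNIV. pmf q s * (\<Sum>a\<in>UNIV. pmf (\<pi> s) a * r s a))" for q
      by (simp only: expectation_mdp_trajectory_Cons expectation_mdp_trajectory_0 last_reward_singleton)
    show "measure_pmf.expectation (mdp_trajectory (Suc (Suc t)) P q \<pi>) (last_reward r) =
        (\<Sum>s\<in>UNIV. pmf q s * (\<Sum>a\<in>UNIV. pmf (\<pi> s) a *
          (0 + measure_pmf.expectation (mdp_trajectory (Suc t) P (P s a) \<pi>) (last_reward r))))" for t q
      unfolding expectation_mdp_trajectory_Cons[of "Suc t"] add_0
      by (intro sum.cong refl arg_cong2[where f = "(*)"] expectation_mdp_trajectory_cong last_reward_Cons)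
  qed simp
  then show ?thesis by (simp add: action_value_def)
qed

text \<open>The first score multiplies the reward of every stage, which adds up to the action value;
  the remaining scores give the gradient started from \<open>P s a\<close>.\<close>

lemma policy_grad_unroll:
  fixes \<theta> w :: "('s, 'a) param"
  defines "\<pi> \<equiv> softmax \<theta>"
  shows "policy_grad \<gamma> P r q \<theta> \<bullet> w = (\<Sum>s\<in>UNIV. pmf q s * (\<Sum>a\<in>UNIV. pmf (\<pi> s) a *
    ((score \<theta> (s, a) \<bullet> w) * action_value \<pi> s a + \<gamma> * (policy_grad \<gamma> P r (P s a) \<theta> \<bullet> w))))"
proof -
  have f: "(\<lambda>t. \<gamma> ^ t * (stage_grad P r t q \<theta> \<bullet> w)) sums (policy_grad \<gamma> P r q \<theta> \<bullet> w)" for q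
    using bounded_linear.sums[OF bounded_linear_inner_left summable_sums[OF summable_stage_grad], of q \<theta> w]
    by (simp add: policy_grad_def)
  have "policy_grad \<gamma> P r q \<theta> \<bullet> w = (\<Sum>s\<in>UNIV. pmf q s * (\<Sum>a\<in>UNIV. pmf (\<pi> s) a *
      (r s a * (score \<theta> (s, a) \<bullet> w) + \<gamma> * ((score \<theta> (s, a) \<bullet> w) * ret \<pi> (P s a))
        + \<gamma> * (policy_grad \<gamma> P r (P s a) \<theta> \<bullet> w))))"
  proof (rule discounted_sum_unroll[where \<gamma> = \<gamma> and f = "\<lambda>q. policy_grad \<gamma> P r q \<theta> \<bullet> w"
        and D = "\<lambda>t s a. (score \<theta> (s, a) \<bullet> w) * measure_pmf.expectation (mdp_trajectory (Suc t) P (P s a) \<pi>) (last_reward r)",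
        OF _ _ _ f])
    show "stage_grad P r 0 q \<theta> \<bullet> w = (\<Sum>s\<in>UNIV. pmf q s * (\<Sum>a\<in>UNIV. pmf (\<pi> s) a * (r s a * (score \<theta> (s, a) \<bullet> w))))" for q
      unfolding inner_stage_grad expectation_mdp_trajectory_Cons expectation_mdp_trajectory_0 \<pi>_def
      by (simp add: last_reward_singleton)
    show "(\<lambda>t. \<gamma> ^ t * ((score \<theta> (s, a) \<bullet> w) * measure_pmf.expectation (mdp_trajectory (Suc t) P (P s a) \<pi>) (last_reward r)))
        sums ((score \<theta> (s, a) \<bullet> w) * ret \<pi> (P s a))" for s a
      using sums_mult[OF sums_expected_return, of "score \<theta> (s, a) \<bullet> w" "P s a" \<pi>] by (simp add: mult_ac)
    fix t q
    have "measure_pmf.expectation (mdp_trajectory (Suc t) P (P s a) \<pi>)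
          (\<lambda>z. last_reward r ((s, a) # z) * (\<Sum>y\<leftarrow>(s, a) # z. score \<theta> y \<bullet> w)) =
        (score \<theta> (s, a) \<bullet> w) * measure_pmf.expectation (mdp_trajectory (Suc t) P (P s a) \<pi>) (last_reward r)
          + stage_grad P r t (P s a) \<theta> \<bullet> w" for s a
    proof -
      have "measure_pmf.expectation (mdp_trajectory (Suc t) P (P s a) \<pi>)
          (\<lambda>z. last_reward r ((s, a) # z) * (\<Sum>y\<leftarrow>(s, a) # z. score \<theta> y \<bullet> w)) =
        measure_pmf.expectation (mdp_trajectory (Suc t) P (P s a) \<pi>)
          (\<lambda>z. (score \<theta> (s, a) \<bullet> w) * last_reward r z + last_reward r z * (\<Sum>y\<leftarrow>z. score \<theta> y \<bullet> w))"
        by (rule expectation_mdp_trajectory_cong) (simp add: last_reward_Cons algebra_simps)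
      also have "\<dots> = (score \<theta> (s, a) \<bullet> w) * measure_pmf.expectation (mdp_trajectory (Suc t) P (P s a) \<pi>) (last_reward r)
          + stage_grad P r t (P s a) \<theta> \<bullet> w"
        unfolding inner_stage_grad expectation_mdp_trajectory \<pi>_def
        by (simp add: distrib_left sum.distrib sum_distrib_left mult_ac)
      finally show ?thesis .
    qed
    then show "stage_grad P r (Suc t) q \<theta> \<bullet> w = (\<Sum>s\<in>UNIV. pmf q s * (\<Sum>a\<in>UNIV. pmf (\<pi> s) a *
        ((score \<theta> (s, a) \<bullet> w) * measure_pmf.expectation (mdp_trajectory (Suc t) P (P s a) \<pi>) (last_reward r)
          + stage_grad P r t (P s a) \<theta> \<bullet> w)))"
      unfolding inner_stage_grad[of _ _ "Suc t"] expectation_mdp_trajectory_Cons[of "Suc t"] \<pi>_def by simp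
  qed
  then show ?thesis by (simp add: action_value_def algebra_simps)
qed

lemma expected_return_state:
  "ret \<pi> (return_pmf s) = (\<Sum>a\<in>UNIV. pmf (\<pi> s) a * action_value \<pi> s a)"
  by (subst expected_return_unroll) (rule sum_return_finite)

lemma expected_return_linear: "ret \<pi> q = (\<Sum>s\<in>UNIV. pmf q s * ret \<pi> (return_pmf s))"
  unfolding expected_return_state by (rule expected_return_unroll)

definition advantage :: "('s \<Rightarrow> 'a pmf) \<Rightarrow> 's \<Rightarrow> 'a \<Rightarrow> real" where
  "advantage \<pi> s a = action_value \<pi> s a - ret \<pi> (return_pmf s)"

text \<open>The difference of the two returns solves the recursion of
  \<open>occupancy_unroll\<close> under \<open>\<pi>'\<close>, with the advantage of
  \<open>\<pi>\<close> as its cost.\<close>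

lemma performance_difference:
  "(1 - \<gamma>) * (ret \<pi>' q - ret \<pi> q) =
     (\<Sum>s\<in>UNIV. occupancy \<gamma> P q \<pi>' s * (\<Sum>a\<in>UNIV. pmf (\<pi>' s) a * advantage \<pi> s a))"
proof (rule occupancy_unroll[OF gamma_pos gamma_less_1])
  fix q
  have "ret \<pi> q = (\<Sum>s\<in>UNIV. pmf q s * (\<Sum>a\<in>UNIV. pmf (\<pi>' s) a * ret \<pi> (return_pmf s)))"
    by (subst expected_return_linear) (simp add: sum_distrib_right[symmetric] sum_pmf_finite_UNIV)
  have eq: "action_value \<pi>' s a - ret \<pi> (return_pmf s) =
      advantage \<pi> s a + \<gamma> * (ret \<pi>' (P s a) - ret \<pi> (P s a))" for s a
    by (simp add: advantage_def action_value_def algebra_simps)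
  show "ret \<pi>' q - ret \<pi> q = (\<Sum>s\<in>UNIV. pmf q s * (\<Sum>a\<in>UNIV. pmf (\<pi>' s) a *
      (advantage \<pi> s a + \<gamma> * (ret \<pi>' (P s a) - ret \<pi> (P s a)))))"
    unfolding expected_return_unroll[of q \<pi>'] \<open>ret \<pi> q = _\<close>
    by (simp only: sum_subtractf[symmetric] right_diff_distrib[symmetric] eq)
qed

text \<open>\<open>occupancy_unroll\<close> is applied to \<open>policy_grad_unroll\<close>; the
  centring of the score is then moved from \<open>w\<close> to the action value, which becomes the
  advantage.\<close>

lemma policy_gradient_theorem:
  "(1 - \<gamma>) * (policy_grad \<gamma> P r q \<theta> \<bullet> w) =
     (\<Sum>s\<in>UNIV. occupancy \<gamma> P q (softmax \<theta>) s *
       (\<Sum>a\<in>UNIV. pmf (softmax \<theta> s) a * (w $ (s, a) * advantage (softmax \<theta>) s a)))"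
proof -
  let ?\<pi> = "softmax \<theta>"
  have "(\<Sum>a\<in>UNIV. pmf (?\<pi> s) a * ((score \<theta> (s, a) \<bullet> w) * action_value ?\<pi> s a)) =
      (\<Sum>a\<in>UNIV. pmf (?\<pi> s) a * (w $ (s, a) * advantage ?\<pi> s a))" for s
  proof -
    let ?m = "\<Sum>a\<in>UNIV. pmf (?\<pi> s) a * w $ (s, a)" and ?V = "ret ?\<pi> (return_pmf s)"
    have "(\<Sum>a\<in>UNIV. pmf (?\<pi> s) a * ((score \<theta> (s, a) \<bullet> w) * action_value ?\<pi> s a)) =
        (\<Sum>a\<in>UNIV. pmf (?\<pi> s) a * (w $ (s, a) * action_value ?\<pi> s a)) - ?m * ?V"
      unfolding inner_score expected_return_state
      by (simp add: algebra_simps sum_subtractf sum_distrib_left)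
    also have "\<dots> = (\<Sum>a\<in>UNIV. pmf (?\<pi> s) a * (w $ (s, a) * advantage ?\<pi> s a))"
      unfolding advantage_def by (simp add: algebra_simps sum_subtractf sum_distrib_left)
    finally show ?thesis .
  qed
  then show ?thesis
    using occupancy_unroll[OF gamma_pos gamma_less_1 policy_grad_unroll[of _ \<theta> w], of q] by simp
qed

end

section \<open>Gradient domination and heterogeneity\<close>

text \<open>The term of time 0 alone. With \<rho> positive it keeps the occupancy ratios well
  defined and positive.\<close>

lemma occupancy_lower_bound:
  assumes "0 < \<gamma>" "\<gamma> < 1"
  shows "(1 - \<gamma>) * pmf q s \<le> occupancy \<gamma> P q \<pi> s"
proof -
  have "summable (\<lambda>t. \<gamma> ^ t * pmf (state_law t P q \<pi>) s)"
    using assms by (intro summable_comparison_test'[OF summable_geometric[of \<gamma>]])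
       (auto simp: abs_mult pmf_le_1 mult_left_le)
  from sum_le_suminf[OF this, of "{0}"] have "pmf q s \<le> (\<Sum>t. \<gamma> ^ t * pmf (state_law t P q \<pi>) s)"
    using assms by simp
  then show ?thesis
    unfolding occupancy_eq using assms by (intro mult_left_mono) auto
qed

lemma local_mu_nonneg: "0 \<le> local_mu \<gamma> P \<rho> k \<theta>"
proof -
  have "0 \<le> Min (range (\<lambda>s. (pmf (softmax \<theta> s) (k s))\<^sup>2))" by (subst Min_ge_iff) auto
  then show ?thesis
    unfolding local_mu_def by (intro mult_nonneg_nonneg) (auto simp: power_int_def)
qed

context softmax_mdp
begin

lemma local_objective_eq: "local_objective \<gamma> P r q \<theta> = discounted_value \<gamma> P r q \<theta>"
  by (simp add: local_objective_def expected_return_softmax)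

lemma local_objective_le_optimum: "local_objective \<gamma> P r q \<theta> \<le> local_optimum \<gamma> P r q"
  unfolding local_optimum_def
proof (rule cSUP_upper)
  have "local_objective \<gamma> P r q \<theta>' \<le> 1 / (1 - \<gamma>)" for \<theta>'
    using abs_discounted_value_le[of q \<theta>'] by (simp add: local_objective_eq)
  then show "bdd_above (range (local_objective \<gamma> P r q))" by (auto intro!: bdd_aboveI[where M = "1 / (1 - \<gamma>)"])
qed simp

text \<open>\<open>optimal_policy\<close> compares returns from single states; linearity in the
  initial law carries this over to \<open>q\<close>.\<close>

lemma local_optimum_le:
  assumes "optimal_policy \<gamma> P r \<pi>"
  shows "local_optimum \<gamma> P r q \<le> ret \<pi> q"
  unfolding local_optimum_def
proof (rule cSUP_least)
  fix \<theta> :: "('s, 'a) param"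
  show "local_objective \<gamma> P r q \<theta> \<le> ret \<pi> q"
    unfolding local_objective_def expected_return_linear[of q] using assms
    by (intro sum_mono mult_left_mono) (auto simp: optimal_policy_def)
qed simp

lemma sum_det_policy:
  fixes f :: "'a \<Rightarrow> real"
  shows "(\<Sum>a\<in>UNIV. pmf (det_policy k s) a * f a) = f (k s)"
  unfolding det_policy_def by (rule sum_return_finite)

text \<open>The policy gradient is tested against the direction that pushes each optimal action by the
  sign of its advantage; the performance difference is bounded by the same sum, up to the ratio of
  occupancies and the probability of the optimal action.\<close>

lemma policy_grad_lojasiewicz:
  assumes opt: "optimal_policy \<gamma> P r (det_policy k)" and pos: "\<And>s. 0 < pmf \<rho> s"
  shows "2 * local_mu \<gamma> P \<rho> k \<theta> * (local_optimum \<gamma> P r \<rho> - local_objective \<gamma> P r \<rho> \<theta>)\<^sup>2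
    \<le> (norm (policy_grad \<gamma> P r \<rho> \<theta>))\<^sup>2"
proof -
  let ?\<pi> = "softmax \<theta>" and ?g = "policy_grad \<gamma> P r \<rho> \<theta>"
  define A where "A s = advantage ?\<pi> s (k s)" for s
  define w :: "('s, 'a) param" where "w = (\<chi> i. if snd i = k (fst i) then sgn (A (fst i)) else 0)"
  define d ds where "d s = occupancy \<gamma> P \<rho> ?\<pi> s" and "ds s = occupancy \<gamma> P \<rho> (det_policy k) s" for s
  define m X \<delta> where "m = Min (range (\<lambda>s. (pmf (?\<pi> s) (k s))\<^sup>2))" and "X = Max (range (\<lambda>s. ds s / d s))"
    and "\<delta> = local_optimum \<gamma> P r \<rho> - local_objective \<gamma> P r \<rho> \<theta>"
  have d_pos: "d s > 0" "ds s > 0" for s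
    using occupancy_lower_bound[OF gamma_pos gamma_less_1, of \<rho> s P] pos[of s] gamma_less_1
    unfolding d_def ds_def by (meson diff_gt_0_iff_gt less_le_trans mult_pos_pos)+
  have ds_le: "ds s \<le> X * d s" for s
  proof -
    have "ds s / d s \<le> X" unfolding X_def by (rule Max_ge) auto
    then show ?thesis using d_pos[of s] by (simp add: pos_divide_le_eq)
  qed
  have X_pos: "X > 0"
  proof -
    have "ds undefined / d undefined \<le> X" unfolding X_def by (rule Max_ge) auto
    moreover have "ds undefined / d undefined > 0" using d_pos by simp
    ultimately show ?thesis by linarith
  qed
  have m0: "0 \<le> m" unfolding m_def by (subst Min_ge_iff) auto
  have m_le: "sqrt m \<le> pmf (?\<pi> s) (k s)" for s
  proof -
    have "m \<le> (pmf (?\<pi> s) (k s))\<^sup>2" unfolding m_def by (rule Min_le) auto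
    then show ?thesis by (intro real_le_lsqrt) (auto simp: m0)
  qed
  have \<delta>0: "0 \<le> \<delta>" using local_objective_le_optimum[of \<rho> \<theta>] by (simp add: \<delta>_def)
  have "(1 - \<gamma>) * \<delta> \<le> (1 - \<gamma>) * (ret (det_policy k) \<rho> - ret ?\<pi> \<rho>)"
    using local_optimum_le[OF opt, of \<rho>] gamma_less_1
    by (intro mult_left_mono) (auto simp: \<delta>_def local_objective_def)
  also have "\<dots> = (\<Sum>s\<in>UNIV. ds s * A s)"
    unfolding performance_difference sum_det_policy ds_def A_def ..
  finally have 1: "(1 - \<gamma>) * \<delta> \<le> (\<Sum>s\<in>UNIV. ds s * A s)" .
  have wA: "(\<Sum>a\<in>UNIV. pmf (?\<pi> s) a * (w $ (s, a) * advantage ?\<pi> s a)) = pmf (?\<pi> s) (k s) * \<bar>A s\<bar>" for s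
  proof -
    have "(\<Sum>a\<in>UNIV. pmf (?\<pi> s) a * (w $ (s, a) * advantage ?\<pi> s a)) =
        (\<Sum>a\<in>UNIV. if a = k s then pmf (?\<pi> s) (k s) * \<bar>A s\<bar> else 0)"
      by (intro sum.cong) (auto simp: w_def A_def abs_sgn)
    then show ?thesis by simp
  qed
  have 2: "(1 - \<gamma>) * (?g \<bullet> w) = (\<Sum>s\<in>UNIV. d s * (pmf (?\<pi> s) (k s) * \<bar>A s\<bar>))"
    unfolding policy_gradient_theorem wA d_def ..
  have "sqrt m * ((1 - \<gamma>) * \<delta>) \<le> sqrt m * (\<Sum>s\<in>UNIV. ds s * A s)"
    by (intro mult_left_mono 1) (simp add: m0)
  also have "\<dots> \<le> (\<Sum>s\<in>UNIV. X * (d s * (pmf (?\<pi> s) (k s) * \<bar>A s\<bar>)))"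
    unfolding sum_distrib_left
  proof (rule sum_mono)
    fix s
    have "sqrt m * (ds s * A s) \<le> sqrt m * (ds s * \<bar>A s\<bar>)"
      using d_pos[of s] m0 by (intro mult_left_mono) auto
    also have "\<dots> \<le> pmf (?\<pi> s) (k s) * (X * d s * \<bar>A s\<bar>)"
      using ds_le[of s] m_le[of s] d_pos[of s] m0 X_pos by (intro mult_mono) auto
    finally show "sqrt m * (ds s * A s) \<le> X * (d s * (pmf (?\<pi> s) (k s) * \<bar>A s\<bar>))"
      by (simp add: mult_ac)
  qed
  also have "\<dots> = X * ((1 - \<gamma>) * (?g \<bullet> w))"
    by (simp only: sum_distrib_left[symmetric] 2)
  finally have "(1 - \<gamma>) * (sqrt m * \<delta>) \<le> (1 - \<gamma>) * (X * (?g \<bullet> w))" by (simp add: mult_ac)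
  then have "sqrt m * \<delta> \<le> X * (?g \<bullet> w)" using gamma_less_1 by simp
  also have "\<dots> \<le> X * (norm ?g * sqrt (real CARD('s)))"
  proof (intro mult_left_mono order_trans[OF norm_cauchy_schwarz])
    \<comment> \<open>At most one entry of \<open>w\<close> per state is nonzero, and its modulus is
      1; this is the origin of the factor \<open>CARD('s)\<close> in
      \<open>local_mu\<close>.\<close>
    have "w \<bullet> w = (\<Sum>s\<in>UNIV. \<Sum>a\<in>UNIV. w $ (s, a) * w $ (s, a))"
      by (simp add: inner_vec_def sum.cartesian_product)
    also have "\<dots> \<le> (\<Sum>s\<in>(UNIV::'s set). 1)"
    proof (rule sum_mono)
      fix s
      have "(\<Sum>a\<in>UNIV. w $ (s, a) * w $ (s, a)) = (\<Sum>a\<in>UNIV. if a = k s then (sgn (A s))\<^sup>2 else 0)"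
        by (intro sum.cong) (auto simp: w_def power2_eq_square)
      also have "\<dots> \<le> 1" by (simp add: sgn_real_def)
      finally show "(\<Sum>a\<in>UNIV. w $ (s, a) * w $ (s, a)) \<le> 1" .
    qed
    finally show "norm w \<le> sqrt (real CARD('s))" by (simp add: norm_eq_sqrt_inner)
  qed (use X_pos in auto)
  finally have "(sqrt m * \<delta>)\<^sup>2 \<le> (X * (norm ?g * sqrt (real CARD('s))))\<^sup>2"
    by (rule power_mono) (use m0 \<delta>0 in auto)
  then have "m * \<delta>\<^sup>2 \<le> X\<^sup>2 * ((norm ?g)\<^sup>2 * real CARD('s))"
    using m0 by (simp add: power_mult_distrib)
  then have "m * \<delta>\<^sup>2 / (X\<^sup>2 * real CARD('s)) \<le> (norm ?g)\<^sup>2"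
    using X_pos by (subst pos_divide_le_eq) (auto simp: mult_ac)
  moreover have "2 * local_mu \<gamma> P \<rho> k \<theta> * \<delta>\<^sup>2 = m * \<delta>\<^sup>2 / (X\<^sup>2 * real CARD('s))"
    unfolding local_mu_def m_def[symmetric] d_def[symmetric] ds_def[symmetric] X_def[symmetric]
    by (simp add: power_int_def field_simps)
  ultimately show ?thesis by (simp add: \<delta>_def)
qed

end

text \<open>The first pair is exchanged first, then the tail: each of the \<open>n\<close>
  transitions costs \<epsilon> and the initial laws cost their own distance. Two initial laws are
  needed because the tails start from \<open>P s a\<close> and \<open>P' s a\<close>.\<close>

lemma mdp_trajectory_l1_dist:
  fixes P P' :: "'s::finite \<Rightarrow> 'a::finite \<Rightarrow> 's pmf"
  assumes P: "\<And>s a. (\<Sum>s'\<in>UNIV. \<bar>pmf (P s a) s' - pmf (P' s a) s'\<bar>) \<le> \<epsilon>"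
  shows "(\<Sum>z | length z = Suc n. \<bar>pmf (mdp_trajectory (Suc n) P q \<pi>) z - pmf (mdp_trajectory (Suc n) P' q' \<pi>) z\<bar>)
    \<le> (\<Sum>s\<in>UNIV. \<bar>pmf q s - pmf q' s\<bar>) + real n * \<epsilon>"
proof (induction n arbitrary: q q')
  case 0
  have "\<bar>pmf q s * pmf (\<pi> s) a - pmf q' s * pmf (\<pi> s) a\<bar> = pmf (\<pi> s) a * \<bar>pmf q s - pmf q' s\<bar>" for s a
    by (simp add: left_diff_distrib[symmetric] abs_mult mult.commute)
  moreover have "{z :: ('s \<times> 'a) list. length z = 0} = {[]}" by auto
  ultimately show ?case
    unfolding sum_lists_length_Suc pmf_mdp_trajectory_Cons
    by (simp add: pmf_mdp_trajectory_Nil sum_distrib_right[symmetric] sum_pmf_finite_UNIV)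
next
  case (Suc n)
  let ?D = "\<lambda>s. \<bar>pmf q s - pmf q' s\<bar>"
  let ?p = "\<lambda>s a. mdp_trajectory (Suc n) P (P s a) \<pi>" and ?p' = "\<lambda>s a. mdp_trajectory (Suc n) P' (P' s a) \<pi>"
  have step: "(\<Sum>z | length z = Suc n. \<bar>pmf q s * pmf (\<pi> s) a * pmf (?p s a) z - pmf q' s * pmf (\<pi> s) a * pmf (?p' s a) z\<bar>)
      \<le> pmf (\<pi> s) a * (?D s + pmf q' s * (real (Suc n) * \<epsilon>))" for s a
  proof -
    have "\<bar>pmf q s * pmf (\<pi> s) a * pmf (?p s a) z - pmf q' s * pmf (\<pi> s) a * pmf (?p' s a) z\<bar>
        \<le> pmf (\<pi> s) a * (?D s * pmf (?p s a) z + pmf q' s * \<bar>pmf (?p s a) z - pmf (?p' s a) z\<bar>)" for z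
    proof -
      have "pmf q s * pmf (\<pi> s) a * pmf (?p s a) z - pmf q' s * pmf (\<pi> s) a * pmf (?p' s a) z =
          pmf (\<pi> s) a * ((pmf q s - pmf q' s) * pmf (?p s a) z + pmf q' s * (pmf (?p s a) z - pmf (?p' s a) z))"
        by (simp add: algebra_simps)
      then show ?thesis
        by (simp only: abs_mult abs_of_nonneg[OF pmf_nonneg])
           (auto intro!: mult_left_mono order_trans[OF abs_triangle_ineq] simp: abs_mult)
    qed
    then have "(\<Sum>z | length z = Suc n. \<bar>pmf q s * pmf (\<pi> s) a * pmf (?p s a) z - pmf q' s * pmf (\<pi> s) a * pmf (?p' s a) z\<bar>)
        \<le> (\<Sum>z | length z = Suc n. pmf (\<pi> s) a * (?D s * pmf (?p s a) z + pmf q' s * \<bar>pmf (?p s a) z - pmf (?p' s a) z\<bar>))"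
      by (rule sum_mono)
    also have "\<dots> = pmf (\<pi> s) a * (?D s + pmf q' s * (\<Sum>z | length z = Suc n. \<bar>pmf (?p s a) z - pmf (?p' s a) z\<bar>))"
      by (simp only: sum_distrib_left[symmetric] sum.distrib sum_pmf_mdp_trajectory mult_1_right)
    also have "\<dots> \<le> pmf (\<pi> s) a * (?D s + pmf q' s * (real (Suc n) * \<epsilon>))"
    proof (intro mult_left_mono add_left_mono)
      show "(\<Sum>z | length z = Suc n. \<bar>pmf (?p s a) z - pmf (?p' s a) z\<bar>) \<le> real (Suc n) * \<epsilon>"
        using Suc.IH[of "P s a" "P' s a"] P[of s a] by (simp add: algebra_simps)
    qed auto
    finally show ?thesis .
  qed
  have "(\<Sum>z | length z = Suc (Suc n). \<bar>pmf (mdp_trajectory (Suc (Suc n)) P q \<pi>) z - pmf (mdp_trajectory (Suc (Suc n)) P' q' \<pi>) z\<bar>)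
      \<le> (\<Sum>s\<in>UNIV. \<Sum>a\<in>UNIV. pmf (\<pi> s) a * (?D s + pmf q' s * (real (Suc n) * \<epsilon>)))"
    unfolding sum_lists_length_Suc[where n = "Suc n"] pmf_mdp_trajectory_Cons[where n = "Suc n"]
    by (intro sum_mono step)
  also have "\<dots> = (\<Sum>s\<in>UNIV. ?D s) + real (Suc n) * \<epsilon>"
    by (simp add: sum_distrib_right[symmetric] sum_pmf_finite_UNIV sum.distrib)
  finally show ?case .
qed

text \<open>A trajectory of \<open>t + 1\<close> pairs has \<open>t\<close> transitions, whence the
  factor at \<epsilon>; the outer factor bounds the total score.\<close>

lemma stage_grad_heterogeneity:
  fixes P P' :: "'s::finite \<Rightarrow> 'a::finite \<Rightarrow> 's pmf"
  assumes P: "\<And>s a. (\<Sum>s'\<in>UNIV. \<bar>pmf (P s a) s' - pmf (P' s a) s'\<bar>) \<le> \<epsilon>"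
    and r: "\<And>s a. \<bar>r s a\<bar> \<le> 1" "\<And>s a. \<bar>r s a - r' s a\<bar> \<le> \<delta>"
  shows "norm (stage_grad P r t q \<theta> - stage_grad P' r' t q \<theta>) \<le> 2 * (real t + 1) * (real t * \<epsilon> + \<delta>)"
proof -
  let ?p = "pmf (mdp_trajectory (Suc t) P q (softmax \<theta>))" and ?p' = "pmf (mdp_trajectory (Suc t) P' q (softmax \<theta>))"
  let ?S = "\<lambda>z. \<Sum>y\<leftarrow>z. score \<theta> y"
  have "norm ((?p z * last_reward r z - ?p' z * last_reward r' z) *\<^sub>R ?S z)
      \<le> (\<bar>?p z - ?p' z\<bar> + ?p' z * \<delta>) * (2 * (real t + 1))" if "length z = Suc t" for z
  proof -
    have "norm (?S z) \<le> 2 * (real t + 1)"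
      using norm_sum_list_le[of "score \<theta>" 2 z, OF norm_score_le] that by simp
    moreover have "\<bar>?p z * last_reward r z - ?p' z * last_reward r' z\<bar> \<le> \<bar>?p z - ?p' z\<bar> + ?p' z * \<delta>"
    proof -
      have "?p z * last_reward r z - ?p' z * last_reward r' z =
          (?p z - ?p' z) * last_reward r z + ?p' z * (last_reward r z - last_reward r' z)"
        by (simp add: algebra_simps)
      also have "\<bar>\<dots>\<bar> \<le> \<bar>?p z - ?p' z\<bar> * \<bar>last_reward r z\<bar> + ?p' z * \<bar>last_reward r z - last_reward r' z\<bar>"
        by (rule order_trans[OF abs_triangle_ineq]) (simp add: abs_mult)
      also have "\<dots> \<le> \<bar>?p z - ?p' z\<bar> * 1 + ?p' z * \<delta>"
        by (intro add_mono mult_left_mono) (auto simp: last_reward_def r)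
      finally show ?thesis by simp
    qed
    ultimately show ?thesis unfolding norm_scaleR by (intro mult_mono) auto
  qed
  then have "norm (\<Sum>z | length z = Suc t. (?p z * last_reward r z - ?p' z * last_reward r' z) *\<^sub>R ?S z)
      \<le> (\<Sum>z | length z = Suc t. (\<bar>?p z - ?p' z\<bar> + ?p' z * \<delta>) * (2 * (real t + 1)))"
    by (intro order_trans[OF norm_sum] sum_mono) simp
  also have "\<dots> = ((\<Sum>z | length z = Suc t. \<bar>?p z - ?p' z\<bar>) + \<delta>) * (2 * (real t + 1))"
    by (simp only: sum_distrib_right[symmetric] sum.distrib sum_pmf_mdp_trajectory mult_1_left)
  also have "\<dots> \<le> (real t * \<epsilon> + \<delta>) * (2 * (real t + 1))"
    using mdp_trajectory_l1_dist[where P = P and P' = P' and n = t and q = q and q' = q and \<pi> = "softmax \<theta>", OF P]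
    by (intro mult_right_mono add_right_mono) auto
  finally show ?thesis
    by (simp add: stage_grad_def expectation_mdp_trajectory scaleR_left_diff_distrib sum_subtractf mult_ac)
qed

lemma policy_grad_heterogeneity:
  fixes P P' :: "'s::finite \<Rightarrow> 'a::finite \<Rightarrow> 's pmf"
  assumes M: "softmax_mdp \<gamma> r" "softmax_mdp \<gamma> r'"
    and P: "\<And>s a. (\<Sum>s'\<in>UNIV. \<bar>pmf (P s a) s' - pmf (P' s a) s'\<bar>) \<le> \<epsilon>"
    and r: "\<And>s a. \<bar>r s a - r' s a\<bar> \<le> \<delta>"
  shows "norm (policy_grad \<gamma> P r q \<theta> - policy_grad \<gamma> P' r' q \<theta>)
    \<le> 4 * \<epsilon> / (1 - \<gamma>) ^ 3 + 2 * \<delta> / (1 - \<gamma>) ^ 2"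
proof -
  interpret M: softmax_mdp \<gamma> P r by (rule M)
  interpret M': softmax_mdp \<gamma> P' r' by (rule M)
  have e0: "0 \<le> \<epsilon>" using P[of undefined undefined] by (rule order_trans[rotated]) (simp add: sum_nonneg)
  have d0: "0 \<le> \<delta>" using r[of undefined undefined] by linarith
  have r1: "\<bar>r s a\<bar> \<le> 1" for s a using M.reward_nonneg M.reward_le_1 by simp
  have "policy_grad \<gamma> P r q \<theta> - policy_grad \<gamma> P' r' q \<theta> =
      (\<Sum>t. \<gamma> ^ t *\<^sub>R (stage_grad P r t q \<theta> - stage_grad P' r' t q \<theta>))"
    unfolding policy_grad_def
    by (simp add: suminf_diff[OF M.summable_stage_grad M'.summable_stage_grad] scaleR_diff_right)
  also have "norm \<dots> \<le> 4 * \<epsilon> / (1 - \<gamma>) ^ 3 + 2 * \<delta> / (1 - \<gamma>) ^ 2"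
  proof (rule norm_suminf_weighted_le(2))
    show "norm (\<gamma> ^ t *\<^sub>R (stage_grad P r t q \<theta> - stage_grad P' r' t q \<theta>))
        \<le> 2 * \<epsilon> * (\<gamma> ^ t * ((real t + 1) * real t)) + 2 * \<delta> * (\<gamma> ^ t * (real t + 1))" for t
    proof -
      have "norm (stage_grad P r t q \<theta> - stage_grad P' r' t q \<theta>) \<le> 2 * (real t + 1) * (real t * \<epsilon> + \<delta>)"
        by (rule stage_grad_heterogeneity) (fact P r1 r)+
      then have "\<bar>\<gamma> ^ t\<bar> * norm (stage_grad P r t q \<theta> - stage_grad P' r' t q \<theta>)
          \<le> \<gamma> ^ t * (2 * (real t + 1) * (real t * \<epsilon> + \<delta>))"
        using M.gamma_pos by (simp add: mult_left_mono)
      then show ?thesis unfolding norm_scaleR by (simp add: algebra_simps)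
    qed
    show "(\<Sum>t<N. 2 * \<epsilon> * (\<gamma> ^ t * ((real t + 1) * real t)) + 2 * \<delta> * (\<gamma> ^ t * (real t + 1)))
        \<le> 4 * \<epsilon> / (1 - \<gamma>) ^ 3 + 2 * \<delta> / (1 - \<gamma>) ^ 2" for N
    proof -
      have "(\<Sum>t<N. 2 * \<epsilon> * (\<gamma> ^ t * ((real t + 1) * real t)) + 2 * \<delta> * (\<gamma> ^ t * (real t + 1)))
          \<le> 2 * \<epsilon> * (2 / (1 - \<gamma>) ^ 3) + 2 * \<delta> * (1 / (1 - \<gamma>) ^ 2)"
        unfolding sum.distrib sum_distrib_left[symmetric] using e0 d0
        by (intro add_mono mult_left_mono sum_geometric_le M.gamma_pos M.gamma_less_1) auto
      then show ?thesis by simp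
    qed
  qed
  finally show ?thesis .
qed

section \<open>Mean and variance of the iterates\<close>

lemma expectation_bind_finite:
  fixes f :: "'y \<Rightarrow> 'v::{banach, second_countable_topology}"
  assumes "finite (set_pmf p)" "\<And>x. x \<in> set_pmf p \<Longrightarrow> finite (set_pmf (k x))"
  shows "measure_pmf.expectation (bind_pmf p k) f = measure_pmf.expectation p (\<lambda>x. measure_pmf.expectation (k x) f)"
  unfolding expectation_finite[OF assms(1)]
  by (rule pmf_expectation_bind) (use assms in auto)

lemma expectation_add_finite:
  fixes f g :: "'x \<Rightarrow> 'v::{banach, second_countable_topology}"
  assumes "finite (set_pmf p)"
  shows "measure_pmf.expectation p (\<lambda>x. f x + g x) = measure_pmf.expectation p f + measure_pmf.expectation p g"
  by (intro Bochner_Integration.integral_add integrable_measure_pmf_finite assms)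

lemma expectation_mono_finite:
  fixes f g :: "'x \<Rightarrow> real"
  assumes "finite (set_pmf p)" "\<And>x. x \<in> set_pmf p \<Longrightarrow> f x \<le> g x"
  shows "measure_pmf.expectation p f \<le> measure_pmf.expectation p g"
  unfolding expectation_finite[OF assms(1)] by (intro sum_mono) (auto intro!: mult_left_mono assms)

lemma pmf_mean_bind:
  assumes "finite (set_pmf p)" "\<And>x. x \<in> set_pmf p \<Longrightarrow> finite (set_pmf (k x))"
  shows "pmf_mean (bind_pmf p k) = measure_pmf.expectation p (\<lambda>x. pmf_mean (k x))"
  unfolding pmf_mean_def by (rule expectation_bind_finite[OF assms])

text \<open>The law of total variance.\<close>

lemma pmf_var_bind:
  assumes p: "finite (set_pmf p)" and k: "\<And>x. x \<in> set_pmf p \<Longrightarrow> finite (set_pmf (k x))"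
  shows "pmf_var (bind_pmf p k) = measure_pmf.expectation p (\<lambda>x. pmf_var (k x))
    + measure_pmf.expectation p (\<lambda>x. (norm (pmf_mean (k x) - pmf_mean (bind_pmf p k)))\<^sup>2)"
proof -
  let ?M = "pmf_mean (bind_pmf p k)"
  have "pmf_var (bind_pmf p k) = measure_pmf.expectation p (\<lambda>x. measure_pmf.expectation (k x) (\<lambda>y. (norm (y - ?M))\<^sup>2))"
    unfolding pmf_var_def by (rule expectation_bind_finite[OF p k])
  also have "\<dots> = measure_pmf.expectation p (\<lambda>x. pmf_var (k x) + (norm (pmf_mean (k x) - ?M))\<^sup>2)"
    unfolding expectation_finite[OF p] by (intro sum.cong refl) (simp add: pmf_var_eq[OF k])
  finally show ?thesis by (simp only: expectation_add_finite[OF p])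
qed

lemma pmf_mean_map_affine:
  assumes "finite (set_pmf p)"
  shows "pmf_mean (map_pmf (\<lambda>x. a + c *\<^sub>R x) p) = a + c *\<^sub>R pmf_mean p"
proof -
  have "pmf_mean (map_pmf (\<lambda>x. a + c *\<^sub>R x) p) = measure_pmf.expectation p (\<lambda>x. a + c *\<^sub>R x)"
    by (simp add: pmf_mean_def)
  also have "\<dots> = a + c *\<^sub>R pmf_mean p"
    by (simp add: expectation_add_finite[OF assms] pmf_mean_def)
  finally show ?thesis .
qed

lemma pmf_var_map_affine:
  assumes "finite (set_pmf p)"
  shows "pmf_var (map_pmf (\<lambda>x. a + c *\<^sub>R x) p) = c\<^sup>2 * pmf_var p"
proof -
  have "a + c *\<^sub>R x - (a + c *\<^sub>R pmf_mean p) = c *\<^sub>R (x - pmf_mean p)" for x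
    by (simp add: algebra_simps)
  then show ?thesis
    by (simp add: pmf_var_def pmf_mean_map_affine[OF assms] power_mult_distrib)
qed

text \<open>The convolution of two laws. Sums over \<open>replicate_pmf\<close> and over
  \<open>Pi_pmf\<close> unfold to it, which reduces both to the case of two summands.\<close>

definition pmf_indep_sum :: "'v::euclidean_space pmf \<Rightarrow> 'v pmf \<Rightarrow> 'v pmf" where
  "pmf_indep_sum p q = bind_pmf p (\<lambda>x. map_pmf (\<lambda>y. x + y) q)"

lemma pmf_mean_var_indep_sum:
  assumes p: "finite (set_pmf p)" and q: "finite (set_pmf q)"
  shows "pmf_mean (pmf_indep_sum p q) = pmf_mean p + pmf_mean q"
    and "pmf_var (pmf_indep_sum p q) = pmf_var p + pmf_var q"
proof -
  have m: "pmf_mean (map_pmf (\<lambda>y. x + y) q) = x + pmf_mean q"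
    and v: "pmf_var (map_pmf (\<lambda>y. x + y) q) = pmf_var q" for x
    using pmf_mean_map_affine[OF q, of x 1] pmf_var_map_affine[OF q, of x 1] by simp_all
  have "pmf_mean (pmf_indep_sum p q) = measure_pmf.expectation p (\<lambda>x. x + pmf_mean q)"
    unfolding pmf_indep_sum_def using p q by (subst pmf_mean_bind) (auto simp: m)
  also have "\<dots> = pmf_mean p + pmf_mean q"
    by (simp add: expectation_add_finite[OF p] pmf_mean_def)
  finally show mean: "pmf_mean (pmf_indep_sum p q) = pmf_mean p + pmf_mean q" .
  show "pmf_var (pmf_indep_sum p q) = pmf_var p + pmf_var q"
    using mean p q unfolding pmf_indep_sum_def
    by (subst pmf_var_bind) (auto simp: m v pmf_var_def[of p])
qed

lemma finite_set_replicate_pmf: "finite (set_pmf p) \<Longrightarrow> finite (set_pmf (replicate_pmf n p))"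
  by (induction n) auto

lemma pmf_mean_var_replicate:
  fixes f :: "'x \<Rightarrow> 'v::euclidean_space"
  assumes p: "finite (set_pmf p)"
  shows "pmf_mean (map_pmf (\<lambda>zs. \<Sum>z\<leftarrow>zs. f z) (replicate_pmf n p)) = real n *\<^sub>R pmf_mean (map_pmf f p)"
    and "pmf_var (map_pmf (\<lambda>zs. \<Sum>z\<leftarrow>zs. f z) (replicate_pmf n p)) = real n * pmf_var (map_pmf f p)"
proof (induction n)
  case 0
  { case 1 then show ?case by (simp add: pmf_mean_def)
  next case 2 then show ?case by (simp add: pmf_mean_def pmf_var_def) }
next
  case (Suc n)
  have e: "map_pmf (\<lambda>zs. \<Sum>z\<leftarrow>zs. f z) (replicate_pmf (Suc n) p) =
      pmf_indep_sum (map_pmf f p) (map_pmf (\<lambda>zs. \<Sum>z\<leftarrow>zs. f z) (replicate_pmf n p))"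
    by (simp add: pmf_indep_sum_def map_bind_pmf bind_map_pmf pmf.map_comp o_def map_pmf_def[symmetric])
  have f: "finite (set_pmf (map_pmf f p))" "finite (set_pmf (map_pmf (\<lambda>zs. \<Sum>z\<leftarrow>zs. f z) (replicate_pmf n p)))"
    using p by (auto simp: finite_set_replicate_pmf simp del: set_replicate_pmf)
  { case 1 then show ?case using Suc by (simp only: e pmf_mean_var_indep_sum[OF f]) (simp add: algebra_simps)
  next case 2 then show ?case using Suc by (simp only: e pmf_mean_var_indep_sum[OF f]) (simp add: algebra_simps) }
qed

lemma pmf_mean_var_Pi:
  fixes p :: "'i \<Rightarrow> 'v::euclidean_space pmf"
  assumes "finite A" and p: "\<And>i. finite (set_pmf (p i))"
  shows "finite (set_pmf (Pi_pmf A dflt p)) \<and>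
    pmf_mean (map_pmf (\<lambda>f. \<Sum>i\<in>A. f i) (Pi_pmf A dflt p)) = (\<Sum>i\<in>A. pmf_mean (p i)) \<and>
    pmf_var (map_pmf (\<lambda>f. \<Sum>i\<in>A. f i) (Pi_pmf A dflt p)) = (\<Sum>i\<in>A. pmf_var (p i))"
  using assms(1)
proof (induction A rule: finite_induct)
  case empty
  then show ?case by (simp add: pmf_mean_def pmf_var_def)
next
  case (insert i A)
  let ?Q = "Pi_pmf A dflt p"
  have P: "Pi_pmf (insert i A) dflt p = bind_pmf (p i) (\<lambda>y. map_pmf (\<lambda>f. f(i := y)) ?Q)"
    using insert.hyps by (simp add: Pi_pmf_insert pair_pmf_def map_bind_pmf map_pmf_def bind_assoc_pmf bind_return_pmf)
  have fin: "finite (set_pmf (Pi_pmf (insert i A) dflt p))"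
    unfolding P using insert.IH p by simp
  have "map_pmf (\<lambda>f. \<Sum>j\<in>insert i A. f j) (Pi_pmf (insert i A) dflt p) =
      bind_pmf (p i) (\<lambda>y. map_pmf (\<lambda>f. y + (\<Sum>j\<in>A. f j)) ?Q)"
    unfolding P map_bind_pmf pmf.map_comp o_def using insert.hyps
    by (intro bind_pmf_cong map_pmf_cong refl) (auto intro!: sum.cong)
  also have "\<dots> = pmf_indep_sum (p i) (map_pmf (\<lambda>f. \<Sum>j\<in>A. f j) ?Q)"
    by (simp add: pmf_indep_sum_def pmf.map_comp o_def)
  finally have e: "map_pmf (\<lambda>f. \<Sum>j\<in>insert i A. f j) (Pi_pmf (insert i A) dflt p) = \<dots>" .
  have f: "finite (set_pmf (map_pmf (\<lambda>f. \<Sum>j\<in>A. f j) ?Q))" using insert.IH by simp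
  show ?case
    unfolding e pmf_mean_var_indep_sum[OF p f] using insert fin by simp
qed

section \<open>Moments of the estimator and of one local step\<close>

context softmax_mdp
begin

definition grad_law :: "'s pmf \<Rightarrow> nat \<Rightarrow> nat \<Rightarrow> ('s, 'a) param \<Rightarrow> ('s, 'a) param pmf" where
  "grad_law \<rho> B T \<theta> = map_pmf (\<lambda>z. pg_estimator \<gamma> r B T z \<theta>) (replicate_pmf B (mdp_trajectory T P \<rho> (softmax \<theta>)))"

text \<open>Writes the estimator as a scaled sum over an independent sample, the form that
  \<open>pmf_mean_var_replicate\<close> handles.\<close>

lemma grad_law_eq:
  "grad_law \<rho> B T \<theta> = map_pmf (\<lambda>x. 0 + (1 / real B) *\<^sub>R x) (map_pmf (\<lambda>zs. \<Sum>z\<leftarrow>zs. traj_grad \<gamma> r T z \<theta>)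
     (replicate_pmf B (mdp_trajectory T P \<rho> (softmax \<theta>))))"
  unfolding grad_law_def pmf.map_comp
proof (rule map_pmf_cong[OF refl])
  fix z assume "z \<in> set_pmf (replicate_pmf B (mdp_trajectory T P \<rho> (softmax \<theta>)))"
  then have "length z = B" by (simp add: set_replicate_pmf)
  then show "pg_estimator \<gamma> r B T z \<theta> = ((\<lambda>x. 0 + (1 / real B) *\<^sub>R x) \<circ> (\<lambda>zs. \<Sum>z\<leftarrow>zs. traj_grad \<gamma> r T z \<theta>)) z"
    by (simp add: pg_estimator_def traj_grad_def sum_list_sum_nth atLeast0LessThan)
qed

lemma finite_grad_law: "finite (set_pmf (grad_law \<rho> B T \<theta>))"
  unfolding grad_law_def set_map_pmf by (intro finite_imageI finite_set_replicate_pmf finite_set_mdp_trajectory)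

text \<open>The variance is at most the second moment, hence at most the square of the bound in
  \<open>norm_traj_grad_le\<close>; the batch divides it by \<open>B\<close>.\<close>

lemma grad_law_mean_var:
  assumes "B \<ge> 1"
  shows "pmf_mean (grad_law \<rho> B T \<theta>) = trunc_grad \<gamma> P r T \<rho> \<theta>"
    and "pmf_var (grad_law \<rho> B T \<theta>) \<le> 4 / (real B * (1 - \<gamma>) ^ 4)"
proof -
  let ?D = "mdp_trajectory T P \<rho> (softmax \<theta>)" and ?X = "\<lambda>z. traj_grad \<gamma> r T z \<theta>"
  let ?S = "map_pmf (\<lambda>zs. \<Sum>z\<leftarrow>zs. ?X z) (replicate_pmf B ?D)"
  have fS: "finite (set_pmf ?S)"
    unfolding set_map_pmf by (intro finite_imageI finite_set_replicate_pmf finite_set_mdp_trajectory)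
  have fD: "finite (set_pmf ?D)" by (rule finite_set_mdp_trajectory)
  have "pmf_mean (map_pmf ?X ?D) = trunc_grad \<gamma> P r T \<rho> \<theta>"
    by (simp add: pmf_mean_def expectation_traj_grad)
  then show "pmf_mean (grad_law \<rho> B T \<theta>) = trunc_grad \<gamma> P r T \<rho> \<theta>"
    unfolding grad_law_eq pmf_mean_map_affine[OF fS] pmf_mean_var_replicate[OF fD] using assms by simp
  have "pmf_var (map_pmf ?X ?D) \<le> measure_pmf.expectation (map_pmf ?X ?D) (\<lambda>x. (norm (x - 0))\<^sup>2)"
    using fD by (subst pmf_var_eq) auto
  also have "\<dots> = measure_pmf.expectation ?D (\<lambda>z. (norm (?X z))\<^sup>2)" by simp
  also have "\<dots> \<le> measure_pmf.expectation ?D (\<lambda>z. (2 / (1 - \<gamma>)\<^sup>2)\<^sup>2)"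
    by (intro expectation_mono_finite fD power_mono norm_traj_grad_le) auto
  also have "\<dots> = 4 / (1 - \<gamma>) ^ 4"
    by (simp add: power_divide flip: power_mult)
  finally have "pmf_var (map_pmf ?X ?D) \<le> 4 / (1 - \<gamma>) ^ 4" .
  then have "pmf_var (map_pmf ?X ?D) / real B \<le> 4 / (1 - \<gamma>) ^ 4 / real B" by (rule divide_right_mono) simp
  then show "pmf_var (grad_law \<rho> B T \<theta>) \<le> 4 / (real B * (1 - \<gamma>) ^ 4)"
    unfolding grad_law_eq pmf_var_map_affine[OF fS] pmf_mean_var_replicate[OF fD] using assms
    by (simp add: power2_eq_square mult.commute)
qed

lemma local_step_eq:
  "local_step \<gamma> P r \<rho> \<eta> B T \<theta> = map_pmf (\<lambda>x. \<theta> + \<eta> *\<^sub>R x) (grad_law \<rho> B T \<theta>)"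
  by (simp add: local_step_def grad_law_def pmf.map_comp o_def)

lemma finite_local_iterate: "finite (set_pmf (local_iterate \<gamma> P r \<rho> \<eta> B T h \<theta>))"
  by (induction h) (auto simp: local_step_eq finite_grad_law)

text \<open>The increment is the expected gradient, which differs from the gradient at the mean;
  \<open>trunc_grad_mean_bias\<close> controls the difference.\<close>

lemma local_iterate_mean_Suc:
  assumes "B \<ge> 1"
  shows "pmf_mean (local_iterate \<gamma> P r \<rho> \<eta> B T (Suc h) \<theta>) = pmf_mean (local_iterate \<gamma> P r \<rho> \<eta> B T h \<theta>)
    + \<eta> *\<^sub>R measure_pmf.expectation (local_iterate \<gamma> P r \<rho> \<eta> B T h \<theta>) (trunc_grad \<gamma> P r T \<rho>)"
proof -
  let ?X = "local_iterate \<gamma> P r \<rho> \<eta> B T h \<theta>"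
  have "pmf_mean (local_iterate \<gamma> P r \<rho> \<eta> B T (Suc h) \<theta>) =
      measure_pmf.expectation ?X (\<lambda>x. x + \<eta> *\<^sub>R trunc_grad \<gamma> P r T \<rho> x)"
    unfolding local_iterate.simps local_step_eq[abs_def]
    by (subst pmf_mean_bind)
       (auto simp: finite_local_iterate finite_grad_law pmf_mean_map_affine grad_law_mean_var[OF assms])
  then show ?thesis
    by (simp add: expectation_add_finite[OF finite_local_iterate] pmf_mean_def)
qed

text \<open>Total variance: the estimator contributes the last summand, and the expected step is a
  Lipschitz map of the current iterate.\<close>

lemma local_iterate_var_Suc:
  assumes B: "B \<ge> 1" and eta: "\<eta> > 0"
  shows "pmf_var (local_iterate \<gamma> P r \<rho> \<eta> B T (Suc h) \<theta>) \<le>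
    (1 + \<eta> * (12 / (1 - \<gamma>) ^ 3))\<^sup>2 * pmf_var (local_iterate \<gamma> P r \<rho> \<eta> B T h \<theta>)
    + \<eta>\<^sup>2 * (4 / (real B * (1 - \<gamma>) ^ 4))"
proof -
  let ?X = "local_iterate \<gamma> P r \<rho> \<eta> B T h \<theta>" and ?L = "12 / (1 - \<gamma>) ^ 3"
  let ?\<Phi> = "\<lambda>x. x + \<eta> *\<^sub>R trunc_grad \<gamma> P r T \<rho> x" and ?m = "pmf_mean ?X"
  note fX = finite_local_iterate[of \<rho> \<eta> B T h \<theta>]
  have step: "pmf_mean (local_step \<gamma> P r \<rho> \<eta> B T x) = ?\<Phi> x"
    "pmf_var (local_step \<gamma> P r \<rho> \<eta> B T x) \<le> \<eta>\<^sup>2 * (4 / (real B * (1 - \<gamma>) ^ 4))" for x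
    unfolding local_step_eq pmf_mean_map_affine[OF finite_grad_law] pmf_var_map_affine[OF finite_grad_law]
    by (auto simp only: grad_law_mean_var[OF B] intro!: mult_left_mono grad_law_mean_var(2)[OF B]) auto
  have fs: "finite (set_pmf (local_step \<gamma> P r \<rho> \<eta> B T x))" for x
    by (simp add: local_step_eq finite_grad_law)
  have mean: "pmf_mean (bind_pmf ?X (local_step \<gamma> P r \<rho> \<eta> B T)) = measure_pmf.expectation ?X ?\<Phi>"
    by (subst pmf_mean_bind) (auto simp: fX fs step)
  \<comment> \<open>The mean minimises the second moment, so the centre may be moved to
    \<open>?\<Phi> ?m\<close>, where the Lipschitz bound applies.\<close>
  have "measure_pmf.expectation ?X (\<lambda>x. (norm (?\<Phi> x - measure_pmf.expectation ?X ?\<Phi>))\<^sup>2)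
      \<le> measure_pmf.expectation ?X (\<lambda>x. (norm (?\<Phi> x - ?\<Phi> ?m))\<^sup>2)"
    by (subst expectation_dist_sq[OF fX, of _ "?\<Phi> ?m"]) simp
  also have "\<dots> \<le> measure_pmf.expectation ?X (\<lambda>x. (1 + \<eta> * ?L)\<^sup>2 * (norm (x - ?m))\<^sup>2)"
  proof (rule expectation_mono_finite[OF fX])
    fix x
    have "norm (?\<Phi> x - ?\<Phi> ?m) \<le> norm (x - ?m) + norm (\<eta> *\<^sub>R (trunc_grad \<gamma> P r T \<rho> x - trunc_grad \<gamma> P r T \<rho> ?m))"
      by (rule order_trans[OF _ norm_triangle_ineq]) (simp add: algebra_simps)
    also have "\<dots> \<le> norm (x - ?m) + \<eta> * (?L * norm (x - ?m))"
      using eta unfolding norm_scaleR by (intro add_left_mono mult_mono trunc_grad_lipschitz) auto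
    finally have "norm (?\<Phi> x - ?\<Phi> ?m) \<le> (1 + \<eta> * ?L) * norm (x - ?m)" by (simp add: algebra_simps)
    then have "(norm (?\<Phi> x - ?\<Phi> ?m))\<^sup>2 \<le> ((1 + \<eta> * ?L) * norm (x - ?m))\<^sup>2" by (rule power_mono) simp
    then show "(norm (?\<Phi> x - ?\<Phi> ?m))\<^sup>2 \<le> (1 + \<eta> * ?L)\<^sup>2 * (norm (x - ?m))\<^sup>2"
      by (simp only: power_mult_distrib)
  qed
  also have "\<dots> = (1 + \<eta> * ?L)\<^sup>2 * pmf_var ?X" by (simp add: pmf_var_def)
  finally have 1: "measure_pmf.expectation ?X (\<lambda>x. (norm (?\<Phi> x - measure_pmf.expectation ?X ?\<Phi>))\<^sup>2)
      \<le> (1 + \<eta> * ?L)\<^sup>2 * pmf_var ?X" .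
  have "measure_pmf.expectation ?X (\<lambda>x. pmf_var (local_step \<gamma> P r \<rho> \<eta> B T x))
      \<le> measure_pmf.expectation ?X (\<lambda>x. \<eta>\<^sup>2 * (4 / (real B * (1 - \<gamma>) ^ 4)))"
    by (intro expectation_mono_finite fX step)
  also have "\<dots> = \<eta>\<^sup>2 * (4 / (real B * (1 - \<gamma>) ^ 4))" by simp
  finally show ?thesis
    using 1 unfolding local_iterate.simps pmf_var_bind[OF fX fs] mean step(1) by linarith
qed

end

section \<open>One communication round\<close>

context softmax_mdp
begin

text \<open>The noise of \<open>h\<close> steps adds up, amplified by at most
  \<open>c ^ (2 * h)\<close>; under \<open>small\<close> this factor is below
  \<open>exp (1 / 2)\<close>, hence below 2.\<close>

lemma local_iterate_var_le:
  assumes B: "B \<ge> 1" and eta: "\<eta> > 0" and h: "h \<le> H"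
    and small: "\<eta> * real H * (12 / (1 - \<gamma>) ^ 3) \<le> 1 / 49"
  shows "pmf_var (local_iterate \<gamma> P r \<rho> \<eta> B T h \<theta>) \<le> 2 * real h * (\<eta>\<^sup>2 * (4 / (real B * (1 - \<gamma>) ^ 4)))"
proof -
  define c where "c = 1 + \<eta> * (12 / (1 - \<gamma>) ^ 3)"
  define s where "s = \<eta>\<^sup>2 * (4 / (real B * (1 - \<gamma>) ^ 4))"
  have c1: "1 \<le> c" using eta gamma_less_1 by (simp add: c_def)
  have s0: "0 \<le> s" using gamma_less_1 by (simp add: s_def)
  have V: "pmf_var (local_iterate \<gamma> P r \<rho> \<eta> B T h \<theta>) \<le> c ^ (2 * h) * (real h * s)"
  proof (induction h)
    case 0
    show ?case by (simp add: pmf_var_def pmf_mean_def)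
  next
    case (Suc h)
    have "pmf_var (local_iterate \<gamma> P r \<rho> \<eta> B T (Suc h) \<theta>) \<le> c\<^sup>2 * (c ^ (2 * h) * (real h * s)) + s"
      using local_iterate_var_Suc[OF B eta, of \<rho> T h \<theta>] mult_left_mono[OF Suc.IH, of "c\<^sup>2"]
      unfolding c_def s_def by simp
    also have "\<dots> \<le> c\<^sup>2 * (c ^ (2 * h) * (real h * s)) + c ^ (2 * Suc h) * s"
      using one_le_power[OF c1, of "2 * Suc h"] s0 by (simp add: mult_le_cancel_right1)
    also have "\<dots> = c ^ (2 * Suc h) * (real (Suc h) * s)"
      by (simp add: algebra_simps power2_eq_square)
    finally show ?case .
  qed
  have "c ^ (2 * h) \<le> exp (\<eta> * (12 / (1 - \<gamma>) ^ 3)) ^ (2 * h)"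
    using c1 by (intro power_mono) (auto simp: c_def exp_ge_add_one_self)
  also have "\<dots> = exp (2 * (\<eta> * real h * (12 / (1 - \<gamma>) ^ 3)))"
    by (simp flip: exp_of_nat_mult add: mult_ac)
  also have "\<dots> \<le> exp (1 / 2)"
  proof -
    have "\<eta> * real h * (12 / (1 - \<gamma>) ^ 3) \<le> \<eta> * real H * (12 / (1 - \<gamma>) ^ 3)"
      using h eta gamma_less_1 by (intro mult_right_mono mult_left_mono) auto
    with small show ?thesis by simp
  qed
  also have "\<dots> \<le> (2::real)" using exp_bound_half[of "1 / 2 :: real"] by simp
  finally have "c ^ (2 * h) * (real h * s) \<le> 2 * (real h * s)"
    using s0 by (intro mult_right_mono) auto
  with V show ?thesis unfolding s_def by (simp add: mult_ac)
qed

text \<open>\<open>e\<close> is the average of the expected gradients along the local steps. If all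
  earlier ones lie within \<open>b\<close> of the initial gradient, the mean has moved little, and
  the Lipschitz bound together with the curvature bias \<open>w\<close> keeps the next one within
  \<open>b\<close>. The factor \<open>real H - 1\<close> in \<open>w\<close> reflects that a
  gradient is preceded by at most \<open>H - 1\<close> noisy steps.\<close>

lemma local_iterate_drift:
  assumes B: "B \<ge> 1" and H: "H \<ge> 1" and eta: "\<eta> > 0"
    and small: "\<eta> * real H * (12 / (1 - \<gamma>) ^ 3) \<le> 1 / 49"
    and w: "w = 156 / (1 - \<gamma>) ^ 4 * (real H - 1) * (\<eta>\<^sup>2 * (4 / (real B * (1 - \<gamma>) ^ 4)))"
  shows "\<exists>e. pmf_mean (local_iterate \<gamma> P r \<rho> \<eta> B T H \<theta>) = \<theta> + (\<eta> * real H) *\<^sub>R e \<and>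
    norm (e - trunc_grad \<gamma> P r T \<rho> \<theta>) \<le> norm (trunc_grad \<gamma> P r T \<rho> \<theta>) / 8 + 2 * w"
proof -
  let ?X = "\<lambda>h. local_iterate \<gamma> P r \<rho> \<eta> B T h \<theta>" and ?G = "trunc_grad \<gamma> P r T \<rho>"
  let ?L = "12 / (1 - \<gamma>) ^ 3"
  define a where "a h = measure_pmf.expectation (?X h) ?G" for h
  have w0: "0 \<le> w" using w H gamma_less_1 by simp
  have m: "pmf_mean (?X h) = \<theta> + \<eta> *\<^sub>R (\<Sum>k<h. a k)" for h
  proof (induction h)
    case (Suc h)
    then show ?case unfolding local_iterate_mean_Suc[OF B] a_def by (simp add: algebra_simps)
  qed (simp add: pmf_mean_def)
  \<comment> \<open>The induction closes because \<open>1 / 49 * (9 / 8)\<close> is at most 1/8 and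
    \<open>1 + 2 / 49\<close> is at most 2.\<close>
  define b where "b = norm (?G \<theta>) / 8 + 2 * w"
  have b0: "0 \<le> b" using w0 by (simp add: b_def)
  have dev: "norm (a h - ?G \<theta>) \<le> b" if "h < H" for h
    using that
  proof (induction h rule: less_induct)
    case (less h)
    have "norm (a h - ?G (pmf_mean (?X h))) \<le> 78 / (1 - \<gamma>) ^ 4 * pmf_var (?X h)"
      unfolding a_def by (rule trunc_grad_mean_bias[OF finite_local_iterate])
    also have "\<dots> \<le> 78 / (1 - \<gamma>) ^ 4 * (2 * real h * (\<eta>\<^sup>2 * (4 / (real B * (1 - \<gamma>) ^ 4))))"
      using less.prems by (intro mult_left_mono local_iterate_var_le[OF B eta _ small]) auto
    also have "\<dots> \<le> 78 / (1 - \<gamma>) ^ 4 * (2 * (real H - 1) * (\<eta>\<^sup>2 * (4 / (real B * (1 - \<gamma>) ^ 4))))"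
      using less.prems gamma_less_1 by (intro mult_left_mono mult_right_mono) auto
    also have "\<dots> = w" by (simp add: w)
    finally have 1: "norm (a h - ?G (pmf_mean (?X h))) \<le> w" .
    have "norm (\<Sum>k<h. a k) \<le> (\<Sum>k<h. norm (?G \<theta>) + b)"
    proof (intro order_trans[OF norm_sum] sum_mono)
      fix k assume "k \<in> {..<h}"
      then have "norm (a k - ?G \<theta>) \<le> b" using less by simp
      then show "norm (a k) \<le> norm (?G \<theta>) + b"
        using norm_triangle_sub[of "a k" "?G \<theta>"] by linarith
    qed
    also have "\<dots> \<le> real H * (norm (?G \<theta>) + b)"
      using less.prems b0 by (simp add: mult_right_mono)
    finally have "\<eta> * norm (\<Sum>k<h. a k) \<le> \<eta> * (real H * (norm (?G \<theta>) + b))"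
      using eta by (intro mult_left_mono) auto
    then have "norm (pmf_mean (?X h) - \<theta>) \<le> \<eta> * real H * (norm (?G \<theta>) + b)"
      using eta by (simp add: m mult.assoc)
    then have "?L * norm (pmf_mean (?X h) - \<theta>) \<le> ?L * (\<eta> * real H * (norm (?G \<theta>) + b))"
      using gamma_less_1 by (intro mult_left_mono) auto
    also have "\<dots> = \<eta> * real H * ?L * (norm (?G \<theta>) + b)" by (simp add: mult_ac)
    also have "\<dots> \<le> 1 / 49 * (norm (?G \<theta>) + b)"
      using b0 by (intro mult_right_mono small) auto
    finally have 2: "norm (?G (pmf_mean (?X h)) - ?G \<theta>) \<le> 1 / 49 * (norm (?G \<theta>) + b)"
      using trunc_grad_lipschitz[of T \<rho> "pmf_mean (?X h)" \<theta>] by linarith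
    have "norm (a h - ?G \<theta>) \<le> norm (a h - ?G (pmf_mean (?X h))) + norm (?G (pmf_mean (?X h)) - ?G \<theta>)"
      using norm_triangle_ineq[of "a h - ?G (pmf_mean (?X h))" "?G (pmf_mean (?X h)) - ?G \<theta>"] by simp
    with 1 2 have "norm (a h - ?G \<theta>) \<le> w + 1 / 49 * (norm (?G \<theta>) + b)" by linarith
    also have "\<dots> \<le> b" using w0 norm_ge_zero[of "?G \<theta>"] unfolding b_def by (simp add: field_simps)
    finally show ?case .
  qed
  define e where "e = (1 / real H) *\<^sub>R (\<Sum>k<H. a k)"
  have "e - ?G \<theta> = (1 / real H) *\<^sub>R (\<Sum>k<H. a k - ?G \<theta>)"
    using H by (simp add: e_def sum_subtractf scaleR_diff_right sum_constant_scaleR del: sum_constant)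
  also have "norm \<dots> \<le> 1 / real H * (real H * b)"
  proof -
    have "norm (\<Sum>k<H. a k - ?G \<theta>) \<le> (\<Sum>k<H. b)"
      using dev by (intro order_trans[OF norm_sum] sum_mono) auto
    then show ?thesis using H by (simp add: field_simps)
  qed
  also have "\<dots> = b" using H by simp
  finally have "norm (e - ?G \<theta>) \<le> b" .
  moreover have "pmf_mean (?X H) = \<theta> + (\<eta> * real H) *\<^sub>R e"
    using H by (simp add: m e_def)
  ultimately show ?thesis unfolding b_def by blast
qed

text \<open>Truncation costs \<beta> once directly and \<beta>/8 through the norm of the truncated
  gradient, which gives the factor 9/8.\<close>

lemma local_iterate_drift_policy_grad:
  assumes "B \<ge> 1" "H \<ge> 1" "\<eta> > 0" "\<eta> * real H * (12 / (1 - \<gamma>) ^ 3) \<le> 1 / 49"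
    and "w = 156 / (1 - \<gamma>) ^ 4 * (real H - 1) * (\<eta>\<^sup>2 * (4 / (real B * (1 - \<gamma>) ^ 4)))"
    and \<beta>: "\<beta> = 2 * \<gamma> ^ T / (1 - \<gamma>) * (real T + 1 / (1 - \<gamma>))"
  shows "\<exists>e. pmf_mean (local_iterate \<gamma> P r \<rho> \<eta> B T H \<theta>) = \<theta> + (\<eta> * real H) *\<^sub>R e \<and>
    norm (policy_grad \<gamma> P r \<rho> \<theta> - e) \<le> norm (policy_grad \<gamma> P r \<rho> \<theta>) / 8 + 9 / 8 * \<beta> + 2 * w"
proof -
  let ?G = "trunc_grad \<gamma> P r T \<rho> \<theta>" and ?g = "policy_grad \<gamma> P r \<rho> \<theta>"
  obtain e where e: "pmf_mean (local_iterate \<gamma> P r \<rho> \<eta> B T H \<theta>) = \<theta> + (\<eta> * real H) *\<^sub>R e"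
    "norm (e - ?G) \<le> norm ?G / 8 + 2 * w"
    using local_iterate_drift[OF assms(1-5), of \<rho> T \<theta>] by blast
  have b: "norm (?G - ?g) \<le> \<beta>" unfolding \<beta> by (rule policy_grad_bias)
  have "norm ?G \<le> norm ?g + norm (?G - ?g)" by (metis norm_triangle_sub)
  moreover have "norm (?g - e) \<le> norm (e - ?G) + norm (?G - ?g)"
    using norm_triangle_ineq[of "e - ?G" "?G - ?g"] by (simp add: norm_minus_commute)
  ultimately have "norm (?g - e) \<le> norm ?g / 8 + 9 / 8 * \<beta> + 2 * w" using b e(2) by (simp add: field_simps)
  with e(1) show ?thesis by blast
qed

end

section \<open>Averages over the agents\<close>

lemma sum_sq_three_le: "(a + b + c)\<^sup>2 \<le> 3 * (a\<^sup>2 + b\<^sup>2 + (c::real)\<^sup>2)"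
proof -
  have "0 \<le> (a - b)\<^sup>2 + (a - c)\<^sup>2 + (b - c)\<^sup>2" by simp
  then show ?thesis by (simp add: power2_eq_square algebra_simps)
qed

text \<open>\<open>expectation_dist_sq\<close> for the uniform law on the agents, about the
  origin.\<close>

lemma average_norm_sq:
  fixes f :: "'c::finite \<Rightarrow> 'v::euclidean_space"
  defines "m \<equiv> (1 / real CARD('c)) *\<^sub>R (\<Sum>c\<in>UNIV. f c)"
  shows "1 / real CARD('c) * (\<Sum>c\<in>UNIV. (norm (f c))\<^sup>2) =
    1 / real CARD('c) * (\<Sum>c\<in>UNIV. (norm (f c - m))\<^sup>2) + (norm m)\<^sup>2"
proof -
  have E: "measure_pmf.expectation (pmf_of_set (UNIV :: 'c set)) g = (1 / real CARD('c)) *\<^sub>R (\<Sum>c\<in>UNIV. g c)"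
    for g :: "'c \<Rightarrow> 'w::euclidean_space"
    by (subst expectation_finite) (simp_all add: scaleR_sum_right)
  show ?thesis
    using expectation_dist_sq[of "pmf_of_set (UNIV :: 'c set)" f 0]
    unfolding E m_def by simp
qed

lemma norm_average_sq_le:
  fixes f :: "'c::finite \<Rightarrow> 'v::euclidean_space"
  shows "(norm ((1 / real CARD('c)) *\<^sub>R (\<Sum>c\<in>UNIV. f c)))\<^sup>2 \<le> 1 / real CARD('c) * (\<Sum>c\<in>UNIV. (norm (f c))\<^sup>2)"
proof -
  have "0 \<le> 1 / real CARD('c) * (\<Sum>c\<in>UNIV. (norm (f c - (1 / real CARD('c)) *\<^sub>R (\<Sum>c\<in>UNIV. f c)))\<^sup>2)"
    by (intro mult_nonneg_nonneg sum_nonneg) auto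
  then show ?thesis unfolding average_norm_sq[of f] by linarith
qed

lemma average_le:
  fixes f :: "'c::finite \<Rightarrow> real"
  assumes "\<And>c. f c \<le> g c"
  shows "1 / real CARD('c) * (\<Sum>c\<in>UNIV. f c) \<le> 1 / real CARD('c) * (\<Sum>c\<in>UNIV. g c)"
  by (intro mult_left_mono sum_mono assms) auto

lemma average_const: "1 / real CARD('c::finite) * (\<Sum>c\<in>(UNIV :: 'c set). x) = x"
  by simp

locale federated_mdp =
  fixes \<gamma> :: real and P :: "'c::finite \<Rightarrow> 's::finite \<Rightarrow> 'a::finite \<Rightarrow> 's pmf"
    and r :: "'c \<Rightarrow> 's \<Rightarrow> 'a \<Rightarrow> real" and \<rho> :: "'s pmf"
  assumes agent: "softmax_mdp \<gamma> (r c)"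
begin

lemma gamma: "0 < \<gamma>" "\<gamma> < 1"
  using agent unfolding softmax_mdp_def by auto

abbreviation agent_grad :: "'c \<Rightarrow> ('s, 'a) param \<Rightarrow> ('s, 'a) param" where
  "agent_grad c \<theta> \<equiv> policy_grad \<gamma> (P c) (r c) \<rho> \<theta>"

definition fed_grad :: "('s, 'a) param \<Rightarrow> ('s, 'a) param" where
  "fed_grad \<theta> = (1 / real CARD('c)) *\<^sub>R (\<Sum>c\<in>UNIV. agent_grad c \<theta>)"

lemma fed_objective_lower_bound:
  "fed_objective \<gamma> P r \<rho> \<theta> + fed_grad \<theta> \<bullet> u - 6 / (1 - \<gamma>) ^ 3 * (norm u)\<^sup>2 \<le> fed_objective \<gamma> P r \<rho> (\<theta> + u)"
proof -
  let ?J = "\<lambda>c. discounted_value \<gamma> (P c) (r c) \<rho>"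
  have J: "fed_objective \<gamma> P r \<rho> x = 1 / real CARD('c) * (\<Sum>c\<in>UNIV. ?J c x)" for x
    unfolding fed_objective_def using softmax_mdp.local_objective_eq[OF agent] by simp
  have "1 / real CARD('c) * (\<Sum>c\<in>UNIV. ?J c \<theta> + agent_grad c \<theta> \<bullet> u - 6 / (1 - \<gamma>) ^ 3 * (norm u)\<^sup>2)
      \<le> 1 / real CARD('c) * (\<Sum>c\<in>UNIV. ?J c (\<theta> + u))"
    by (rule average_le) (rule softmax_mdp.discounted_value_lower_bound[OF agent])
  then show ?thesis
    by (simp add: J fed_grad_def inner_sum_left sum.distrib sum_subtractf add_divide_distrib diff_divide_distrib)
qed

text \<open>Here \<zeta> denotes the squared quantity \<open>zeta_sq\<close> of the theorem. The
  deviation from the average is an average of pairwise differences; squaring their bound yields 32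
  and 8, which lie below 56 and 36.\<close>

lemma agent_grad_deviation:
  assumes \<zeta>: "\<zeta> = 56 * (kernel_heterogeneity P)\<^sup>2 / (1 - \<gamma>) ^ 6 + 36 * (reward_heterogeneity r)\<^sup>2 / (1 - \<gamma>) ^ 4"
  shows "(norm (agent_grad c \<theta> - fed_grad \<theta>))\<^sup>2 \<le> \<zeta>"
proof -
  define eP er where "eP = kernel_heterogeneity P" and "er = reward_heterogeneity r"
  have "norm (agent_grad c \<theta> - agent_grad c' \<theta>) \<le> 4 * eP / (1 - \<gamma>) ^ 3 + 2 * er / (1 - \<gamma>) ^ 2" for c'
  proof (rule policy_grad_heterogeneity[OF agent agent])
    fix s a
    show "(\<Sum>s'\<in>UNIV. \<bar>pmf (P c s a) s' - pmf (P c' s a) s'\<bar>) \<le> eP"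
      unfolding eP_def kernel_heterogeneity_def
      by (rule Max_ge) (auto intro!: image_eqI[of _ _ "(s, a, c, c')"])
    show "\<bar>r c s a - r c' s a\<bar> \<le> er"
      unfolding er_def reward_heterogeneity_def
      by (rule Max_ge) (auto intro!: image_eqI[of _ _ "(c, c', s, a)"])
  qed
  then have b: "(norm (agent_grad c \<theta> - agent_grad c' \<theta>))\<^sup>2 \<le> (4 * eP / (1 - \<gamma>) ^ 3 + 2 * er / (1 - \<gamma>) ^ 2)\<^sup>2" for c'
    by (rule power_mono) simp
  have "agent_grad c \<theta> - fed_grad \<theta> = (1 / real CARD('c)) *\<^sub>R (\<Sum>c'\<in>UNIV. agent_grad c \<theta> - agent_grad c' \<theta>)"
    by (simp add: fed_grad_def sum_subtractf scaleR_diff_right sum_constant_scaleR del: sum_constant)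
  then have "(norm (agent_grad c \<theta> - fed_grad \<theta>))\<^sup>2 \<le> (4 * eP / (1 - \<gamma>) ^ 3 + 2 * er / (1 - \<gamma>) ^ 2)\<^sup>2"
    using order_trans[OF norm_average_sq_le average_le[of _ "\<lambda>_. (4 * eP / (1 - \<gamma>) ^ 3 + 2 * er / (1 - \<gamma>) ^ 2)\<^sup>2"], OF b]
    unfolding average_const by simp
  also have "\<dots> \<le> 2 * ((4 * eP / (1 - \<gamma>) ^ 3)\<^sup>2 + (2 * er / (1 - \<gamma>) ^ 2)\<^sup>2)"
    using zero_le_power2[of "4 * eP / (1 - \<gamma>) ^ 3 - 2 * er / (1 - \<gamma>) ^ 2"]
    by (simp add: power2_sum power2_diff)
  also have "\<dots> = 32 * (eP\<^sup>2 / (1 - \<gamma>) ^ 6) + 8 * (er\<^sup>2 / (1 - \<gamma>) ^ 4)"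
    by (simp add: power_divide power_mult_distrib flip: power_mult)
  also have "\<dots> \<le> 56 * (eP\<^sup>2 / (1 - \<gamma>) ^ 6) + 36 * (er\<^sup>2 / (1 - \<gamma>) ^ 4)"
    using gamma by (intro add_mono mult_right_mono) auto
  finally show ?thesis unfolding \<zeta> eP_def er_def by simp
qed

lemma fedpg_round_mean_var:
  fixes H B T :: nat and \<eta> :: real and \<theta> :: "('s, 'a) param"
  defines "X \<equiv> \<lambda>c. local_iterate \<gamma> (P c) (r c) \<rho> \<eta> B T H \<theta>"
  shows "finite (set_pmf (fedpg_round \<gamma> P r \<rho> \<eta> H B T \<theta>))"
    and "pmf_mean (fedpg_round \<gamma> P r \<rho> \<eta> H B T \<theta>) = (1 / real CARD('c)) *\<^sub>R (\<Sum>c\<in>UNIV. pmf_mean (X c))"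
    and "pmf_var (fedpg_round \<gamma> P r \<rho> \<eta> H B T \<theta>) = (1 / real CARD('c))\<^sup>2 * (\<Sum>c\<in>UNIV. pmf_var (X c))"
proof -
  let ?S = "map_pmf (\<lambda>f. \<Sum>c\<in>UNIV. f c) (Pi_pmf UNIV undefined X)"
  have fX: "finite (set_pmf (X c))" for c
    unfolding X_def by (rule softmax_mdp.finite_local_iterate[OF agent])
  have e: "fedpg_round \<gamma> P r \<rho> \<eta> H B T \<theta> = map_pmf (\<lambda>x. 0 + (1 / real CARD('c)) *\<^sub>R x) ?S"
    by (simp add: fedpg_round_def X_def pmf.map_comp o_def)
  have S: "finite (set_pmf ?S)" "pmf_mean ?S = (\<Sum>c\<in>UNIV. pmf_mean (X c))" "pmf_var ?S = (\<Sum>c\<in>UNIV. pmf_var (X c))"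
    using pmf_mean_var_Pi[of UNIV X undefined, OF _ fX] by auto
  show "finite (set_pmf (fedpg_round \<gamma> P r \<rho> \<eta> H B T \<theta>))" unfolding e set_map_pmf using S(1) by auto
  show "pmf_mean (fedpg_round \<gamma> P r \<rho> \<eta> H B T \<theta>) = (1 / real CARD('c)) *\<^sub>R (\<Sum>c\<in>UNIV. pmf_mean (X c))"
    unfolding e pmf_mean_map_affine[OF S(1)] S(2) by simp
  show "pmf_var (fedpg_round \<gamma> P r \<rho> \<eta> H B T \<theta>) = (1 / real CARD('c))\<^sup>2 * (\<Sum>c\<in>UNIV. pmf_var (X c))"
    unfolding e pmf_var_map_affine[OF S(1)] S(3) ..
qed

text \<open>The quadratic lower bound at \<theta> is averaged; the second moment about \<theta>
  splits into the variance and the squared displacement of the mean, so that noise and drift enter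
  separately.\<close>

lemma expectation_fed_objective_ge:
  assumes fin: "finite (set_pmf p)"
  shows "fed_objective \<gamma> P r \<rho> \<theta> + fed_grad \<theta> \<bullet> (pmf_mean p - \<theta>)
      - 6 / (1 - \<gamma>) ^ 3 * (pmf_var p + (norm (pmf_mean p - \<theta>))\<^sup>2)
    \<le> measure_pmf.expectation p (fed_objective \<gamma> P r \<rho>)"
proof -
  have "fed_objective \<gamma> P r \<rho> \<theta> + fed_grad \<theta> \<bullet> (pmf_mean p - \<theta>)
      - 6 / (1 - \<gamma>) ^ 3 * (pmf_var p + (norm (pmf_mean p - \<theta>))\<^sup>2) =
    measure_pmf.expectation p (\<lambda>x. fed_objective \<gamma> P r \<rho> \<theta> + fed_grad \<theta> \<bullet> (x - \<theta>) - 6 / (1 - \<gamma>) ^ 3 * (norm (x - \<theta>))\<^sup>2)"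
  proof -
    have i: "integrable (measure_pmf p) f" for f :: "_ \<Rightarrow> real" by (rule integrable_measure_pmf_finite[OF fin])
    have iv: "integrable (measure_pmf p) (\<lambda>x. x)" by (rule integrable_measure_pmf_finite[OF fin])
    have "measure_pmf.expectation p (\<lambda>x. fed_grad \<theta> \<bullet> (x - \<theta>)) = fed_grad \<theta> \<bullet> (pmf_mean p - \<theta>)"
      using iv by (simp add: inner_diff_right pmf_mean_def Bochner_Integration.integral_diff[OF i i])
    then show ?thesis
      unfolding pmf_var_eq[OF fin, symmetric]
      by (simp add: Bochner_Integration.integral_diff[OF i i] Bochner_Integration.integral_add[OF i i])
  qed
  also have "\<dots> \<le> measure_pmf.expectation p (fed_objective \<gamma> P r \<rho>)"
  proof (rule expectation_mono_finite[OF fin])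
    fix x
    show "fed_objective \<gamma> P r \<rho> \<theta> + fed_grad \<theta> \<bullet> (x - \<theta>) - 6 / (1 - \<gamma>) ^ 3 * (norm (x - \<theta>))\<^sup>2 \<le> fed_objective \<gamma> P r \<rho> x"
      using fed_objective_lower_bound[of \<theta> "x - \<theta>"] by simp
  qed
  finally show ?thesis .
qed

text \<open>The square of the average gap is at most the average of the squared gaps, each of which
  its own agent's gradient controls.\<close>

lemma fed_optimality_gap_sq_le:
  assumes opt: "\<And>c. optimal_policy \<gamma> (P c) (r c) (det_policy (k c))" and pos: "\<And>s. 0 < pmf \<rho> s"
    and \<mu>0: "0 \<le> \<mu>" and \<mu>: "\<mu> \<le> fed_mu \<gamma> P \<rho> k \<theta>"
  shows "2 * \<mu> * (fed_optimum \<gamma> P r \<rho> - fed_objective \<gamma> P r \<rho> \<theta>)\<^sup>2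
    \<le> 1 / real CARD('c) * (\<Sum>c\<in>UNIV. (norm (agent_grad c \<theta>))\<^sup>2)"
proof -
  let ?\<delta> = "\<lambda>c. local_optimum \<gamma> (P c) (r c) \<rho> - local_objective \<gamma> (P c) (r c) \<rho> \<theta>"
  have "(fed_optimum \<gamma> P r \<rho> - fed_objective \<gamma> P r \<rho> \<theta>)\<^sup>2 \<le> 1 / real CARD('c) * (\<Sum>c\<in>UNIV. (?\<delta> c)\<^sup>2)"
    using norm_average_sq_le[of ?\<delta>]
    by (simp add: fed_optimum_def fed_objective_def sum_subtractf right_diff_distrib diff_divide_distrib)
  then have "2 * \<mu> * (fed_optimum \<gamma> P r \<rho> - fed_objective \<gamma> P r \<rho> \<theta>)\<^sup>2 \<le> 2 * \<mu> * (1 / real CARD('c) * (\<Sum>c\<in>UNIV. (?\<delta> c)\<^sup>2))"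
    using \<mu>0 by (intro mult_left_mono) auto
  also have "\<dots> = 1 / real CARD('c) * (\<Sum>c\<in>UNIV. 2 * \<mu> * (?\<delta> c)\<^sup>2)"
    by (simp add: sum_distrib_left)
  also have "\<dots> \<le> 1 / real CARD('c) * (\<Sum>c\<in>UNIV. (norm (agent_grad c \<theta>))\<^sup>2)"
  proof (rule average_le)
    fix c
    have "fed_mu \<gamma> P \<rho> k \<theta> \<le> local_mu \<gamma> (P c) \<rho> (k c) \<theta>"
      unfolding fed_mu_def by (rule Min_le) auto
    then have "2 * \<mu> * (?\<delta> c)\<^sup>2 \<le> 2 * local_mu \<gamma> (P c) \<rho> (k c) \<theta> * (?\<delta> c)\<^sup>2"
      using \<mu> by (intro mult_right_mono) auto
    also have "\<dots> \<le> (norm (agent_grad c \<theta>))\<^sup>2"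
      by (rule softmax_mdp.policy_grad_lojasiewicz[OF agent opt pos])
    finally show "2 * \<mu> * (?\<delta> c)\<^sup>2 \<le> (norm (agent_grad c \<theta>))\<^sup>2" .
  qed
  finally show ?thesis .
qed

lemma fedpg_round_ascent:
  assumes B: "B \<ge> 1" and H: "H \<ge> 1" and eta: "\<eta> > 0"
    and small: "\<eta> * real H * (12 / (1 - \<gamma>) ^ 3) \<le> 1 / 49"
    and opt: "\<And>c. optimal_policy \<gamma> (P c) (r c) (det_policy (k c))" and pos: "\<And>s. 0 < pmf \<rho> s"
    and \<mu>0: "0 \<le> \<mu>" and \<mu>: "\<mu> \<le> fed_mu \<gamma> P \<rho> k \<theta>"
    and w: "w = 156 / (1 - \<gamma>) ^ 4 * (real H - 1) * (\<eta>\<^sup>2 * (4 / (real B * (1 - \<gamma>) ^ 4)))"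
    and \<beta>: "\<beta> = 2 * \<gamma> ^ T / (1 - \<gamma>) * (real T + 1 / (1 - \<gamma>))"
    and \<zeta>: "\<zeta> = 56 * (kernel_heterogeneity P)\<^sup>2 / (1 - \<gamma>) ^ 6 + 36 * (reward_heterogeneity r)\<^sup>2 / (1 - \<gamma>) ^ 4"
  shows "fed_objective \<gamma> P r \<rho> \<theta>
      + \<eta> * real H * \<mu> / 4 * (fed_optimum \<gamma> P r \<rho> - fed_objective \<gamma> P r \<rho> \<theta>)\<^sup>2
      - (48 * real H * \<eta>\<^sup>2 / (real CARD('c) * real B * (1 - \<gamma>) ^ 7)
         + \<eta> * real H * \<zeta> / 2 + 2 * \<eta> * real H * \<beta>\<^sup>2 + 6 * \<eta> * real H * w\<^sup>2)
    \<le> measure_pmf.expectation (fedpg_round \<gamma> P r \<rho> \<eta> H B T \<theta>) (fed_objective \<gamma> P r \<rho>)"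
proof -
  let ?M = "real CARD('c)" and ?D = "fedpg_round \<gamma> P r \<rho> \<eta> H B T \<theta>" and ?J = "fed_objective \<gamma> P r \<rho>"
  let ?X = "\<lambda>c. local_iterate \<gamma> (P c) (r c) \<rho> \<eta> B T H \<theta>"
  define x y where "x = \<eta> * real H" and "y = 6 / (1 - \<gamma>) ^ 3"
  define \<Delta> where "\<Delta> = fed_optimum \<gamma> P r \<rho> - ?J \<theta>"
  define S where "S = 1 / ?M * (\<Sum>c\<in>UNIV. (norm (agent_grad c \<theta>))\<^sup>2)"
  have x0: "0 < x" using eta H by (simp add: x_def)
  have y0: "0 \<le> y" using gamma by (simp add: y_def)
  have xy: "x * y \<le> 1 / 2" using small by (simp add: x_def y_def)
  have "\<forall>c. \<exists>e. pmf_mean (?X c) = \<theta> + x *\<^sub>R e \<and>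
      norm (agent_grad c \<theta> - e) \<le> norm (agent_grad c \<theta>) / 8 + 9 / 8 * \<beta> + 2 * w"
    unfolding x_def
    by (intro allI softmax_mdp.local_iterate_drift_policy_grad[OF agent B H eta small w \<beta>])
  then obtain e where e: "\<And>c. pmf_mean (?X c) = \<theta> + x *\<^sub>R e c"
    "\<And>c. norm (agent_grad c \<theta> - e c) \<le> norm (agent_grad c \<theta>) / 8 + 9 / 8 * \<beta> + 2 * w"
    by metis
  define v where "v = (1 / ?M) *\<^sub>R (\<Sum>c\<in>UNIV. e c)"
  have mean: "pmf_mean ?D - \<theta> = x *\<^sub>R v"
    unfolding fedpg_round_mean_var(2) e(1) v_def
    by (simp add: sum.distrib scaleR_add_right scaleR_sum_right[symmetric] sum_constant_scaleR del: sum_constant)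
  have "pmf_var ?D \<le> (1 / ?M)\<^sup>2 * (\<Sum>c\<in>(UNIV :: 'c set). 2 * real H * (\<eta>\<^sup>2 * (4 / (real B * (1 - \<gamma>) ^ 4))))"
    unfolding fedpg_round_mean_var(3)
    by (intro mult_left_mono sum_mono softmax_mdp.local_iterate_var_le[OF agent B eta order_refl small]) auto
  also have "\<dots> = 1 / ?M * (2 * real H * (\<eta>\<^sup>2 * (4 / (real B * (1 - \<gamma>) ^ 4))))"
    by (simp add: power2_eq_square)
  finally have "y * pmf_var ?D \<le> y * (1 / ?M * (2 * real H * (\<eta>\<^sup>2 * (4 / (real B * (1 - \<gamma>) ^ 4)))))"
    using y0 by (rule mult_left_mono)
  also have "\<dots> = 48 * real H * \<eta>\<^sup>2 / (?M * real B * (1 - \<gamma>) ^ 7)"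
  proof -
    have "(1 - \<gamma>) ^ 7 = (1 - \<gamma>) ^ 3 * (1 - \<gamma>) ^ 4" by (simp flip: power_add)
    then show ?thesis by (simp add: y_def mult_ac)
  qed
  finally have var: "y * pmf_var ?D \<le> 48 * real H * \<eta>\<^sup>2 / (?M * real B * (1 - \<gamma>) ^ 7)" .
  have "fed_grad \<theta> - v = (1 / ?M) *\<^sub>R (\<Sum>c\<in>UNIV. agent_grad c \<theta> - e c)"
    by (simp add: fed_grad_def v_def sum_subtractf scaleR_diff_right)
  then have "(norm (fed_grad \<theta> - v))\<^sup>2 \<le> 1 / ?M * (\<Sum>c\<in>UNIV. (norm (agent_grad c \<theta> - e c))\<^sup>2)"
    by (simp only: norm_average_sq_le)
  \<comment> \<open>The coefficients are 3 times the squares of 1/8, 9/8 and 2.\<close>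
  also have "\<dots> \<le> 1 / ?M * (\<Sum>c\<in>UNIV. 3 / 64 * (norm (agent_grad c \<theta>))\<^sup>2 + (243 / 64 * \<beta>\<^sup>2 + 12 * w\<^sup>2))"
  proof (rule average_le)
    fix c
    have "(norm (agent_grad c \<theta> - e c))\<^sup>2 \<le> (norm (agent_grad c \<theta>) / 8 + 9 / 8 * \<beta> + 2 * w)\<^sup>2"
      by (rule power_mono[OF e(2)]) simp
    also have "\<dots> \<le> 3 * ((norm (agent_grad c \<theta>) / 8)\<^sup>2 + (9 / 8 * \<beta>)\<^sup>2 + (2 * w)\<^sup>2)"
      by (rule sum_sq_three_le)
    also have "\<dots> = 3 / 64 * (norm (agent_grad c \<theta>))\<^sup>2 + (243 / 64 * \<beta>\<^sup>2 + 12 * w\<^sup>2)"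
      by (simp add: power2_eq_square)
    finally show "(norm (agent_grad c \<theta> - e c))\<^sup>2 \<le> 3 / 64 * (norm (agent_grad c \<theta>))\<^sup>2 + (243 / 64 * \<beta>\<^sup>2 + 12 * w\<^sup>2)" .
  qed
  also have "\<dots> = 3 / 64 * S + (243 / 64 * \<beta>\<^sup>2 + 12 * w\<^sup>2)"
    unfolding sum.distrib distrib_left[of "1 / ?M"] average_const S_def
    by (simp only: sum_distrib_left[symmetric] mult.left_commute)
  finally have dev: "(norm (fed_grad \<theta> - v))\<^sup>2 \<le> 3 / 64 * S + (243 / 64 * \<beta>\<^sup>2 + 12 * w\<^sup>2)" .
  have "1 / ?M * (\<Sum>c\<in>UNIV. (norm (agent_grad c \<theta> - fed_grad \<theta>))\<^sup>2) \<le> 1 / ?M * (\<Sum>c\<in>(UNIV :: 'c set). \<zeta>)"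
    by (rule average_le) (rule agent_grad_deviation[OF \<zeta>])
  \<comment> \<open>By \<open>average_norm_sq\<close>, \<open>S\<close> exceeds the squared norm of
    \<open>fed_grad\<close> by exactly the mean squared deviation of the agents.\<close>
  then have het: "S - \<zeta> \<le> (norm (fed_grad \<theta>))\<^sup>2"
    unfolding average_const
    using average_norm_sq[of "\<lambda>c. agent_grad c \<theta>"] by (simp add: S_def fed_grad_def)
  have gap: "2 * \<mu> * \<Delta>\<^sup>2 \<le> S"
    unfolding S_def \<Delta>_def by (rule fed_optimality_gap_sq_le[OF opt pos \<mu>0 \<mu>])
  have polar: "fed_grad \<theta> \<bullet> v = ((norm (fed_grad \<theta>))\<^sup>2 + (norm v)\<^sup>2 - (norm (fed_grad \<theta> - v))\<^sup>2) / 2"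
    unfolding power2_norm_eq_inner by (simp add: inner_diff_left inner_diff_right inner_commute)
  have "x * (y * x) * (norm v)\<^sup>2 \<le> x * (1 / 2) * (norm v)\<^sup>2"
    using x0 xy by (intro mult_right_mono mult_left_mono) (auto simp: mult.commute)
  then have v2: "y * (x\<^sup>2 * (norm v)\<^sup>2) \<le> x * ((norm v)\<^sup>2 / 2)" by (simp add: power2_eq_square mult_ac)
  have main: "?J \<theta> + x * (fed_grad \<theta> \<bullet> v) - (y * pmf_var ?D + y * (x\<^sup>2 * (norm v)\<^sup>2))
      \<le> measure_pmf.expectation ?D ?J"
    using expectation_fed_objective_ge[OF fedpg_round_mean_var(1), of \<theta> \<eta> H B T \<theta>]
    unfolding mean y_def by (simp add: power_mult_distrib distrib_left)
  have S0: "0 \<le> S" unfolding S_def by (intro mult_nonneg_nonneg sum_nonneg) auto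
  \<comment> \<open>Half of \<open>S\<close> comes from \<open>het\<close> and 3/128 of it is lost
    to \<open>dev\<close>; more than \<open>S / 8\<close> remains, which is what \<open>gap\<close>
    needs. The \<beta> coefficient 243/128 is rounded up to 2.\<close>
  have "\<mu> / 4 * \<Delta>\<^sup>2 - (\<zeta> / 2 + 2 * \<beta>\<^sup>2 + 6 * w\<^sup>2)
      \<le> ((norm (fed_grad \<theta>))\<^sup>2 - (norm (fed_grad \<theta> - v))\<^sup>2) / 2"
  proof -
    have "\<mu> / 4 * \<Delta>\<^sup>2 \<le> S / 8" using gap by simp
    then show ?thesis using dev het S0 zero_le_power2[of \<beta>] unfolding diff_divide_distrib by linarith
  qed
  then have "x * (\<mu> / 4 * \<Delta>\<^sup>2 - (\<zeta> / 2 + 2 * \<beta>\<^sup>2 + 6 * w\<^sup>2))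
      \<le> x * (((norm (fed_grad \<theta>))\<^sup>2 - (norm (fed_grad \<theta> - v))\<^sup>2) / 2)"
    using x0 by (intro mult_left_mono) auto
  also have "\<dots> = x * (fed_grad \<theta> \<bullet> v) - x * ((norm v)\<^sup>2 / 2)"
    unfolding polar by (simp add: field_simps)
  finally have "?J \<theta> + x * (\<mu> / 4 * \<Delta>\<^sup>2 - (\<zeta> / 2 + 2 * \<beta>\<^sup>2 + 6 * w\<^sup>2)) - y * pmf_var ?D
      \<le> measure_pmf.expectation ?D ?J"
    using main v2 by linarith
  moreover have "x * (\<mu> / 4 * \<Delta>\<^sup>2 - (\<zeta> / 2 + 2 * \<beta>\<^sup>2 + 6 * w\<^sup>2)) =
      \<eta> * real H * \<mu> / 4 * \<Delta>\<^sup>2 - (\<eta> * real H * \<zeta> / 2 + 2 * \<eta> * real H * \<beta>\<^sup>2 + 6 * \<eta> * real H * w\<^sup>2)"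
    by (simp add: x_def algebra_simps)
  ultimately show ?thesis using var unfolding \<Delta>_def by linarith
qed

end

section \<open>The recursion\<close>

text \<open>\<open>sqrt (e / a)\<close> is the stationary level. Below it a step gains at most
  \<open>e\<close>. Above it the excess \<open>y\<close> becomes at most
  \<open>y - a * y ^ 2\<close>, hence at most \<open>y / (1 + a * y)\<close>. The latter is
  increasing for positive \<open>y\<close>, so the induction hypothesis can be inserted, and its
  iterates from \<open>d 0\<close> are exactly \<open>D\<close>.\<close>

lemma quadratic_recursion_bound:
  fixes d :: "nat \<Rightarrow> real"
  assumes a: "0 < a" and e: "0 \<le> e" and d0: "0 \<le> d 0"
    and step: "\<And>k. d (Suc k) \<le> d k - a * (d k)\<^sup>2 + e"
  shows "d n \<le> d 0 / (1 + real n * a * d 0) + sqrt (e / a) + e"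
proof -
  define D where "D k = d 0 / (1 + real k * a * d 0)" for k
  define q where "q = sqrt (e / a)"
  have q0: "0 \<le> q" using a e by (simp add: q_def)
  have q2: "a * q\<^sup>2 = e" using a e by (simp add: q_def)
  have pos: "0 < 1 + real k * a * d 0" for k using a d0 by (intro add_pos_nonneg mult_nonneg_nonneg) auto
  have D0: "0 \<le> D k" for k using pos[of k] d0 by (simp add: D_def)
  have DS: "D (Suc k) = D k / (1 + a * D k)" for k
  proof -
    define c where "c = 1 + real k * a * d 0"
    have "0 < c" using pos[of k] by (simp add: c_def)
    then have "1 + a * (d 0 / c) = (c + a * d 0) / c" by (simp add: field_simps)
    moreover have "1 + real (Suc k) * a * d 0 = c + a * d 0" by (simp add: c_def algebra_simps)
    ultimately show ?thesis using pos[of k] unfolding D_def c_def[symmetric] by simp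
  qed
  have "d k \<le> D k + q + e" for k
  proof (induction k)
    case 0
    show ?case using q0 e by (simp add: D_def)
  next
    case (Suc k)
    define y where "y = d k - q"
    show ?case
    proof (cases "y \<le> 0")
      case True
      have "d (Suc k) \<le> d k + e" using step[of k] a by (smt (verit) mult_nonneg_nonneg zero_le_power2)
      with True D0[of "Suc k"] show ?thesis by (simp add: y_def)
    next
      case False
      then have y: "0 < y" by simp
      \<comment> \<open>The error \<open>e\<close> is \<open>a * q ^ 2\<close> and cancels against
        the expanded square; the cross term only helps.\<close>
      have "d (Suc k) \<le> (y + q) - a * (y + q)\<^sup>2 + a * q\<^sup>2"
        using step[of k] by (simp add: y_def q2)
      also have "\<dots> = q + (y - a * y\<^sup>2) - 2 * a * y * q" by (simp add: power2_eq_square algebra_simps)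
      also have "\<dots> \<le> q + (y - a * y\<^sup>2)" using a y q0 by simp
      finally have 1: "d (Suc k) \<le> q + (y - a * y\<^sup>2)" .
      have "(y - a * y\<^sup>2) * (1 + a * y) = y - y * (a * y)\<^sup>2" by (simp add: power2_eq_square algebra_simps)
      also have "\<dots> \<le> y" using y by simp
      finally have 2: "y - a * y\<^sup>2 \<le> y / (1 + a * y)" using a y by (simp add: pos_le_divide_eq add_pos_pos)
      have yD: "y \<le> D k + e" using Suc.IH by (simp add: y_def)
      have De: "0 \<le> D k + e" using D0[of k] e by simp
      have "y / (1 + a * y) \<le> (D k + e) / (1 + a * (D k + e))"
      proof -
        have "y * (1 + a * (D k + e)) \<le> (D k + e) * (1 + a * y)" using yD by (simp add: algebra_simps)
        moreover have "0 < 1 + a * y" "0 < 1 + a * (D k + e)"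
          using a y De by (auto intro!: add_pos_nonneg mult_nonneg_nonneg)
        ultimately show ?thesis by (simp add: divide_simps)
      qed
      also have "\<dots> = D k / (1 + a * (D k + e)) + e / (1 + a * (D k + e))" by (rule add_divide_distrib)
      \<comment> \<open>The surplus \<open>e\<close> does not accumulate: it is removed from one
        denominator, and the other denominator is at least 1.\<close>
      also have "\<dots> \<le> D k / (1 + a * D k) + e / 1"
        using a e D0[of k] De
        by (intro add_mono divide_left_mono mult_pos_pos add_pos_nonneg mult_nonneg_nonneg) auto
      finally show ?thesis using 1 2 DS[of k] by simp
    qed
  qed
  then show ?thesis by (simp add: D_def q_def)
qed

lemma sqrt_sum_four_le:
  assumes "0 \<le> a" "0 \<le> b" "0 \<le> c" "0 \<le> d"
  shows "sqrt (a + b + c + d) \<le> sqrt a + sqrt b + sqrt c + sqrt d"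
  using sqrt_add_le_add_sqrt[of "a + b + c" d] sqrt_add_le_add_sqrt[of "a + b" c]
    sqrt_add_le_add_sqrt[of a b] assms by simp

theorem theoremC10:
  fixes P :: "'c::finite \<Rightarrow> 's::finite \<Rightarrow> 'a::finite \<Rightarrow> 's pmf"
    and r :: "'c \<Rightarrow> 's \<Rightarrow> 'a \<Rightarrow> real"
    and \<rho> :: "'s pmf"
    and a\<^sub>o\<^sub>p\<^sub>t :: "'c \<Rightarrow> 's \<Rightarrow> 'a"
    and \<theta>\<^sub>0 :: "('s, 'a) param"
    and H B T R :: nat
    and \<gamma> \<eta> \<mu> L2 L3 zeta_sq \<beta> sigma2_sq sigma4_pow4 Jstar J0 :: real
  assumes "0 < \<gamma>" and "\<gamma> < 1"
    and "\<And>c s a. 0 \<le> r c s a \<and> r c s a \<le> 1"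
    and "\<And>c. optimal_policy \<gamma> (P c) (r c) (det_policy (a\<^sub>o\<^sub>p\<^sub>t c))"
    and "Min (range (pmf \<rho>)) > 0"
    and "H \<ge> 1" and "B \<ge> 1" and "T \<ge> 1" and "\<eta> > 0"
    and "0 < \<mu>" and "\<mu> < 1"
    and "AE \<theta> in fedpg \<gamma> P r \<rho> \<eta> H B T \<theta>\<^sub>0. (INF k. fed_mu \<gamma> P \<rho> a\<^sub>o\<^sub>p\<^sub>t (\<theta> k)) \<ge> \<mu>"
    and "L2 = 8 / (1 - \<gamma>) ^ 3"
    and "L3 = 480 / (1 - \<gamma>) ^ 4"
    and "zeta_sq = 56 * (kernel_heterogeneity P)\<^sup>2 / (1 - \<gamma>) ^ 6
                 + 36 * (reward_heterogeneity r)\<^sup>2 / (1 - \<gamma>) ^ 4"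
    and "\<beta> = 2 * \<gamma> ^ T / (1 - \<gamma>) * (real T + 1 / (1 - \<gamma>))"
    and "sigma2_sq = 12 / (real B * (1 - \<gamma>) ^ 4)"
    and "sigma4_pow4 = 1120 / ((real B)\<^sup>2 * (1 - \<gamma>) ^ 8)"
    and "Jstar = fed_optimum \<gamma> P r \<rho>"
    and "J0 = fed_objective \<gamma> P r \<rho> \<theta>\<^sub>0"
    and "\<eta> * real H * L2 \<le> 1 / 74"
  shows "Jstar - (\<integral>\<theta>. fed_objective \<gamma> P r \<rho> (\<theta> R) \<partial>fedpg \<gamma> P r \<rho> \<eta> H B T \<theta>\<^sub>0)
    \<le> (Jstar - J0) / (1 + real R * (Jstar - J0) * \<eta> * real H * \<mu> / 4)
      + sqrt (6 * \<eta> * L2 * sigma2_sq / (real CARD('c) * \<mu>))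
      + sqrt (16 * 12 ^ 3 * \<eta> ^ 4 * L3\<^sup>2 * real H * (real H - 1) * sigma4_pow4 / \<mu>)
      + sqrt (2 * zeta_sq / \<mu>)
      + sqrt (8 * \<beta>\<^sup>2 / \<mu>)
      + zeta_sq / (12 * L2)
      + \<eta> * sigma2_sq / (4 * real CARD('c))
      + \<beta>\<^sup>2 / (3 * L2)
      + 12 ^ 3 * \<eta> ^ 4 * L3\<^sup>2 * real H * (real H - 1) * sigma4_pow4 / L2"
proof -
  note gamma = assms(1,2) and eta = \<open>\<eta> > 0\<close> and mu = \<open>0 < \<mu>\<close>
  interpret federated_mdp \<gamma> P r \<rho>
    by (rule federated_mdp.intro, rule softmax_mdp.intro) (use assms(1-3) in auto)
  define M where "M = real CARD('c)"
  define g where "g = 1 - \<gamma>"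
  define x where "x = \<eta> * real H"
  have M0: "0 < M" by (simp add: M_def)
  have g0: "0 < g" using gamma by (simp add: g_def)
  have x0: "0 < x" using eta \<open>H \<ge> 1\<close> by (simp add: x_def)
  have B0: "0 < real B" using \<open>B \<ge> 1\<close> by simp
  have H1: "0 \<le> real H - 1" using \<open>H \<ge> 1\<close> by simp
  have L2: "L2 = 8 / g ^ 3" and L3: "L3 = 480 / g ^ 4"
    and s2: "sigma2_sq = 12 / (real B * g ^ 4)" and s4: "sigma4_pow4 = 1120 / ((real B)\<^sup>2 * g ^ 8)"
    using assms by (simp_all add: g_def)
  have L20: "0 < L2" using g0 by (simp add: L2)
  have xL: "x * L2 \<le> 1 / 74" using assms by (simp add: x_def)
  \<comment> \<open>\<open>12 / 8 * (1 / 74)\<close> is 3/148, just below 1/49.\<close>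
  have small: "\<eta> * real H * (12 / (1 - \<gamma>) ^ 3) \<le> 1 / 49"
    using xL unfolding L2 x_def g_def by simp
  have z0: "0 \<le> zeta_sq" using assms(15) g0 unfolding g_def by simp
  have pos: "0 < pmf \<rho> s" for s
    using \<open>Min (range (pmf \<rho>)) > 0\<close> by (subst (asm) Min_gr_iff) auto

  let ?J = "fed_objective \<gamma> P r \<rho>" and ?K = "fedpg_round \<gamma> P r \<rho> \<eta> H B T"
  define law where "law k = chain_marginal k (return_pmf \<theta>\<^sub>0) ?K" for k
  have fin: "finite (set_pmf (law k))" for k
    unfolding law_def by (induction k) (auto simp: fedpg_round_mean_var(1))
  define d where "d k = Jstar - measure_pmf.expectation (law k) ?J" for k
  have goal: "(\<integral>\<theta>. ?J (\<theta> R) \<partial>fedpg \<gamma> P r \<rho> \<eta> H B T \<theta>\<^sub>0) = measure_pmf.expectation (law R) ?J"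
    unfolding fedpg_def law_def by (rule integral_markov_chain_component)
  have mu_le: "\<mu> \<le> fed_mu \<gamma> P \<rho> a\<^sub>o\<^sub>p\<^sub>t \<theta>" if "\<theta> \<in> set_pmf (law k)" for \<theta> k
  proof (rule AE_markov_chain_componentD[where Q = "\<lambda>\<theta>. \<mu> \<le> fed_mu \<gamma> P \<rho> a\<^sub>o\<^sub>p\<^sub>t \<theta>"])
    show "\<theta> \<in> set_pmf (chain_marginal k (return_pmf \<theta>\<^sub>0) ?K)" using that by (simp add: law_def)
    \<comment> \<open>The infimum lies below each value only when the range is bounded below;
      nonnegativity provides this.\<close>
    have "0 \<le> fed_mu \<gamma> P \<rho> a\<^sub>o\<^sub>p\<^sub>t \<theta>" for \<theta>
      unfolding fed_mu_def by (subst Min_ge_iff) (auto simp: local_mu_nonneg)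
    then have le: "(INF k. fed_mu \<gamma> P \<rho> a\<^sub>o\<^sub>p\<^sub>t (\<theta> k)) \<le> fed_mu \<gamma> P \<rho> a\<^sub>o\<^sub>p\<^sub>t (\<theta> k)" for \<theta> :: "nat \<Rightarrow> ('s, 'a) param"
      by (intro cINF_lower bdd_belowI[where m = 0]) auto
    show "AE \<theta> in markov_chain (return_pmf \<theta>\<^sub>0) ?K. \<mu> \<le> fed_mu \<gamma> P \<rho> a\<^sub>o\<^sub>p\<^sub>t (\<theta> k)"
      using assms(12) unfolding fedpg_def by (rule eventually_mono) (rule order_trans[OF _ le])
  qed

  define w where "w = 156 / (1 - \<gamma>) ^ 4 * (real H - 1) * (\<eta>\<^sup>2 * (4 / (real B * (1 - \<gamma>) ^ 4)))"
  define E1 E2 E3 E4 where "E1 = 6 * \<eta> * L2 * sigma2_sq / (M * \<mu>)"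
    and "E2 = 16 * 12 ^ 3 * \<eta> ^ 4 * L3\<^sup>2 * real H * (real H - 1) * sigma4_pow4 / \<mu>"
    and "E3 = 2 * zeta_sq / \<mu>" and "E4 = 8 * \<beta>\<^sup>2 / \<mu>"
  define a where "a = x * \<mu> / 4"
  \<comment> \<open>Chosen so that \<open>e / a\<close> is the sum of the terms under the square
    roots. It must then dominate the error of one round: \<open>t1\<close> and \<open>t2\<close>
    treat the two noise terms, while the other two agree exactly.\<close>
  define e where "e = a * (E1 + E2 + E3 + E4)"
  have a0: "0 < a" using x0 mu by (simp add: a_def)
  have E0: "0 \<le> E1" "0 \<le> E2" "0 \<le> E3" "0 \<le> E4"
    using eta L20 M0 mu g0 z0 H1 B0 by (auto simp: E1_def E2_def E3_def E4_def s2 s4)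
  have e0: "0 \<le> e" using a0 E0 by (simp add: e_def)
  have aE: "a * E1 = 3 / 2 * (x * L2) * (\<eta> * sigma2_sq / M)"
    "a * E2 = 4 * x * (12 ^ 3 * \<eta> ^ 4 * L3\<^sup>2 * real H * (real H - 1) * sigma4_pow4)"
    "a * E3 = x * zeta_sq / 2" "a * E4 = 2 * x * \<beta>\<^sup>2"
    using mu M0 by (simp_all add: a_def E1_def E2_def E3_def E4_def field_simps)
  \<comment> \<open>48 from the round against \<open>3 / 2 * 8 * 12\<close>, that is 144, from the
    statement.\<close>
  have t1: "48 * real H * \<eta>\<^sup>2 / (M * real B * (1 - \<gamma>) ^ 7) \<le> a * E1"
  proof -
    define Z where "Z = real H * \<eta>\<^sup>2 / (M * real B * (1 - \<gamma>) ^ 7)"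
    have g7: "g ^ 7 = g ^ 3 * g ^ 4" by (simp flip: power_add)
    have "48 * real H * \<eta>\<^sup>2 / (M * real B * (1 - \<gamma>) ^ 7) = 48 * Z" by (simp add: Z_def)
    also have "\<dots> \<le> 144 * Z"
      using M0 B0 g0 unfolding Z_def g_def by (intro mult_right_mono) auto
    also have "\<dots> = a * E1"
      unfolding Z_def aE(1) L2 s2 x_def g_def[symmetric] g7 by (simp add: power2_eq_square mult_ac)
    finally show ?thesis .
  qed
  \<comment> \<open>Both sides carry \<open>Q\<close>, with \<open>(1 - \<gamma>) ^ 16\<close> in
    the denominator. What remains is that \<open>(real H - 1) ^ 2\<close> is at most
    \<open>real H * (real H - 1)\<close> and a comparison of numerical factors.\<close>
  have t2: "6 * \<eta> * real H * w\<^sup>2 \<le> a * E2"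
  proof -
    define Q where "Q = \<eta> ^ 4 / ((real B)\<^sup>2 * g ^ 16)"
    have Q0: "0 \<le> Q" using g0 by (simp add: Q_def)
    have w_eq: "w = 624 * ((real H - 1) * (\<eta>\<^sup>2 / (real B * g ^ 8)))"
    proof -
      have g8: "g ^ 8 = g ^ 4 * g ^ 4" by (simp flip: power_add)
      have "156 / g ^ 4 * h * (\<eta>\<^sup>2 * (4 / (real B * g ^ 4))) = 624 * (h * (\<eta>\<^sup>2 / (real B * g ^ 8)))" for h
        unfolding g8 by (simp add: mult_ac)
      then show ?thesis unfolding w_def g_def[symmetric] .
    qed
    have w2: "w\<^sup>2 = 389376 * ((real H - 1)\<^sup>2 * Q)"
      unfolding w_eq Q_def by (simp add: power_mult_distrib power_divide flip: power_mult)
    have g16: "g ^ 16 = g ^ 8 * g ^ 8" by (simp flip: power_add)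
    have g4: "(480 / g ^ 4)\<^sup>2 = 230400 / g ^ 8" by (simp add: power_divide flip: power_mult)
    have L: "L3\<^sup>2 * sigma4_pow4 * \<eta> ^ 4 = 258048000 * Q"
      unfolding L3 s4 Q_def g16 g4 by (simp add: mult_ac)
    have "4 * x * (12 ^ 3 * n * l * k * h * s) = x * (4 * 12 ^ 3 * (k * h * (l * s * n)))" for n l k h s :: real
      by (simp add: mult_ac)
    then have aE2: "a * E2 = x * (4 * 12 ^ 3 * (real H * (real H - 1) * (258048000 * Q)))"
      unfolding aE(2) L[symmetric] .
    define U V where "U = (real H - 1)\<^sup>2 * Q" and "V = real H * (real H - 1) * Q"
    have "U \<le> V"
      using H1 Q0 unfolding U_def V_def power2_eq_square by (intro mult_right_mono) auto
    moreover have "0 \<le> V" using H1 Q0 by (simp add: V_def)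
    ultimately have "6 * (389376 * U) \<le> 4 * 12 ^ 3 * (258048000 * V)" by simp
    then have "6 * (389376 * ((real H - 1)\<^sup>2 * Q)) \<le> 4 * 12 ^ 3 * (real H * (real H - 1) * (258048000 * Q))"
      unfolding U_def V_def by (simp only: mult_ac)
    then have "x * (6 * (389376 * ((real H - 1)\<^sup>2 * Q))) \<le> a * E2"
      unfolding aE2 using x0 by (intro mult_left_mono) auto
    then show ?thesis unfolding w2 x_def by (simp add: mult_ac)
  qed

  have step: "d (Suc k) \<le> d k - a * (d k)\<^sup>2 + e" for k
  proof -
    have "measure_pmf.expectation (law k) (\<lambda>\<theta>. ?J \<theta> + a * (?J \<theta> - Jstar)\<^sup>2 + - e)
        \<le> measure_pmf.expectation (law k) (\<lambda>\<theta>. measure_pmf.expectation (?K \<theta>) ?J)"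
    proof (rule expectation_mono_finite[OF fin])
      fix \<theta> assume "\<theta> \<in> set_pmf (law k)"
      from fedpg_round_ascent[OF \<open>B \<ge> 1\<close> \<open>H \<ge> 1\<close> eta small assms(4) pos less_imp_le[OF mu] mu_le[OF this]
          w_def assms(16) assms(15)]
      have "?J \<theta> + a * (Jstar - ?J \<theta>)\<^sup>2
          - (48 * real H * \<eta>\<^sup>2 / (M * real B * (1 - \<gamma>) ^ 7) + x * zeta_sq / 2 + 2 * x * \<beta>\<^sup>2 + 6 * \<eta> * real H * w\<^sup>2)
          \<le> measure_pmf.expectation (?K \<theta>) ?J"
        by (simp add: assms(19) M_def a_def x_def mult.assoc)
      moreover have "(Jstar - ?J \<theta>)\<^sup>2 = (?J \<theta> - Jstar)\<^sup>2" by (rule power2_commute)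
      ultimately show "?J \<theta> + a * (?J \<theta> - Jstar)\<^sup>2 + - e \<le> measure_pmf.expectation (?K \<theta>) ?J"
        using t1 t2 unfolding e_def distrib_left aE(3,4) by simp
    qed
    also have "\<dots> = measure_pmf.expectation (law (Suc k)) ?J"
      unfolding law_def chain_marginal.simps
      by (rule expectation_bind_finite[symmetric]) (use fin fedpg_round_mean_var(1) in \<open>auto simp: law_def\<close>)
    finally have 1: "measure_pmf.expectation (law k) ?J + a * measure_pmf.expectation (law k) (\<lambda>\<theta>. (?J \<theta> - Jstar)\<^sup>2) - e
        \<le> measure_pmf.expectation (law (Suc k)) ?J"
      unfolding expectation_add_finite[OF fin] by simp
    \<comment> \<open>Jensen's inequality for the square, read off from the decomposition about
      \<open>Jstar\<close> by dropping the variance.\<close>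
    have "(d k)\<^sup>2 \<le> measure_pmf.expectation (law k) (\<lambda>\<theta>. (?J \<theta> - Jstar)\<^sup>2)"
      using expectation_dist_sq[OF fin, of k ?J Jstar]
        Bochner_Integration.integral_nonneg[of "measure_pmf (law k)" "\<lambda>\<theta>. (?J \<theta> - measure_pmf.expectation (law k) ?J)\<^sup>2"]
      by (simp add: d_def power2_commute)
    then have "a * (d k)\<^sup>2 \<le> a * measure_pmf.expectation (law k) (\<lambda>\<theta>. (?J \<theta> - Jstar)\<^sup>2)"
      using a0 by (intro mult_left_mono) auto
    with 1 show ?thesis by (simp add: d_def)
  qed

  have d0: "d 0 = Jstar - J0" by (simp add: d_def law_def assms(20))
  have d0_nonneg: "0 \<le> d 0"
  proof -
    have "?J \<theta>\<^sub>0 \<le> fed_optimum \<gamma> P r \<rho>"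
      unfolding fed_objective_def fed_optimum_def
      by (rule average_le) (rule softmax_mdp.local_objective_le_optimum[OF agent])
    then show ?thesis by (simp add: d0 assms(19,20))
  qed
  have "real R * a * d 0 = real R * (Jstar - J0) * \<eta> * real H * \<mu> / 4"
    by (simp add: a_def x_def d0)
  with quadratic_recursion_bound[where d = d and n = R, OF a0 e0 d0_nonneg step]
  have 1: "d R \<le> (Jstar - J0) / (1 + real R * (Jstar - J0) * \<eta> * real H * \<mu> / 4) + sqrt (e / a) + e"
    by (simp only: d0)
  have "e / a = E1 + E2 + E3 + E4" using a0 by (simp add: e_def)
  then have 2: "sqrt (e / a) \<le> sqrt E1 + sqrt E2 + sqrt E3 + sqrt E4"
    using sqrt_sum_four_le[OF E0] by simp
  \<comment> \<open>1/6 is the share that turns \<open>x * zeta_sq / 2\<close> and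
    \<open>2 * x * \<beta> ^ 2\<close> into the stated terms over \<open>12 * L2\<close> and
    \<open>3 * L2\<close>.\<close>
  have x_le: "x \<le> 1 / 6 * (1 / L2)" using xL L20 by (simp add: field_simps)
  have "a * E1 \<le> \<eta> * sigma2_sq / (4 * M)"
  proof -
    have "3 / 2 * (x * L2) * (\<eta> * sigma2_sq / M) \<le> 1 / 4 * (\<eta> * sigma2_sq / M)"
    proof (rule mult_right_mono)
      show "3 / 2 * (x * L2) \<le> 1 / 4" using xL by linarith
      show "0 \<le> \<eta> * sigma2_sq / M" using eta M0 g0 B0 by (simp add: s2)
    qed
    then show ?thesis unfolding aE by simp
  qed
  moreover have "a * E2 \<le> 12 ^ 3 * \<eta> ^ 4 * L3\<^sup>2 * real H * (real H - 1) * sigma4_pow4 / L2"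
  proof -
    define W where "W = 12 ^ 3 * \<eta> ^ 4 * L3\<^sup>2 * real H * (real H - 1) * sigma4_pow4"
    have "0 \<le> W" using eta H1 g0 by (simp add: W_def s4)
    moreover have "4 * x \<le> 1 / L2"
    proof -
      have "0 < 1 / L2" using L20 by simp
      with x_le show ?thesis by linarith
    qed
    ultimately have "4 * x * W \<le> 1 / L2 * W" by (intro mult_right_mono)
    then show ?thesis unfolding aE W_def by simp
  qed
  moreover have "a * E3 \<le> zeta_sq / (12 * L2)"
    using mult_right_mono[OF x_le z0] unfolding aE by (simp add: field_simps)
  moreover have "a * E4 \<le> \<beta>\<^sup>2 / (3 * L2)"
    using mult_right_mono[OF x_le zero_le_power2[of \<beta>]] unfolding aE by (simp add: field_simps)
  ultimately have 3: "e \<le> zeta_sq / (12 * L2) + \<eta> * sigma2_sq / (4 * M) + \<beta>\<^sup>2 / (3 * L2)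
      + 12 ^ 3 * \<eta> ^ 4 * L3\<^sup>2 * real H * (real H - 1) * sigma4_pow4 / L2"
    unfolding e_def distrib_left by linarith
  show ?thesis
    using 1 2 3 unfolding goal d_def[symmetric] E1_def E2_def E3_def E4_def M_def by linarith
qed

end
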